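(* Let $\omega\in(0,1)$ be fixed, $n=n_1+n_2$ and $n_1=\omega n$. Let $X_{11},\ldots,X_{1n_1}$ be a random sample from $f(x;\theta_1)$ and, independently, $X_{21},\ldots,X_{2n_2}$ a random sample from $f(x;\theta_2)$, with $f$ in the natural exponential family described in the context and $(\theta_1,\theta_2)$ constrained to $\mathcal{C}_2=\{(\theta_1,\theta_2):\theta_1\le\theta_2\}$; put $\Delta=\theta_2-\theta_1$. Assume the true value of $(\theta_1,\theta_2)$ is $(\theta_{10,n},\theta_{20,n})\in\mathcal{C}_2$ with $$\theta_{10,n}=\eta_0-(1-\omega)\Delta_{0,n},\qquad \theta_{20,n}=\eta_0+\omega\Delta_{0,n},\qquad \Delta_{0,n}=\delta n^{-1/2},$$ where $\eta_0$ is fixed and $\delta\ge0$ is a fixed local parameter not depending on $n$. Let $\sigma_0^2=b''(\psi_0)$ with $\psi_0=(b')^{-1}(\eta_0)$, $\sigma_0>0$. Let $\alpha_1,\alpha_2\in(0,0.5)$, and let $q^*_{1,\alpha},q^*_{2,\alpha},q^*_{\Delta,\alpha}$ be the bootstrap quantiles, $F_{12}$ the joint distribution function, $\Phi_{(\mu,\Sigma)}$ the bivariate normal distribution function, and $\Lambda_1,\Lambda_2$ the matrices defined in the context. Then, as $n\to\infty$: (a) $$\mathrm{pr}\left(\theta_{10,n}\in[q^*_{1,\alpha_1},q^*_{1,1-\alpha_2}]\right)\to\iint I\{\alpha_1\le g_1(x,y)\le 1-\alpha_2\}\,dF_{12}(x,y),$$ where $g_1(x,y)=\Phi\{-C_{11}(x)\}+\Phi\{-C_{12}(x,y)\}-\Phi_{(0,\Lambda_1)}\{-C_{11}(x),-C_{12}(x,y)\}$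 with $C_{11}(x)=\omega^{1/2}x$ and $C_{12}(x,y)=\omega x+(1-\omega)y+(1-\omega)\delta/\sigma_0$; (b) $$\mathrm{pr}\left(\theta_{20,n}\in[q^*_{2,\alpha_1},q^*_{2,1-\alpha_2}]\right)\to\iint I\{\alpha_1\le g_2(x,y)\le 1-\alpha_2\}\,dF_{12}(x,y),$$ where $g_2(x,y)=\Phi_{(0,\Lambda_2)}\{-C_{21}(y),-C_{22}(x,y)\}$ with $C_{21}(y)=(1-\omega)^{1/2}y$ and $C_{22}(x,y)=\omega x+(1-\omega)y-\omega\delta/\sigma_0$; (c) $$\mathrm{pr}\left(\Delta_{0,n}\in[q^*_{\Delta,\alpha_1},q^*_{\Delta,1-\alpha_2}]\right)\to\begin{cases}1-\alpha_1-\alpha_2, & \delta>\Phi^{-1}(1-\alpha_2)\sigma_0/\{\omega(1-\omega)\}^{1/2},\\ 1-\alpha_1, & \delta<\Phi^{-1}(1-\alpha_2)\sigma_0/\{\omega(1-\omega)\}^{1/2}.\end{cases}$$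
   Context: Natural exponential family: $f(x;\theta)=a(x)\exp\{\psi x-b(\psi)\}$ is a probability density function or probability mass function, where $\psi$ is the natural parameter, ranging over an open interval, and $b$ is twice continuously differentiable with $b''(\psi)>0$. The mean parameter is $\theta=b'(\psi)$ and the variance is $b''(\psi)$. Let $M$ be the range of $b'$; the fixed value $\eta_0$ lies in $M$, so $\theta_{10,n},\theta_{20,n}\in M$ for all large $n$. The limit $n\to\infty$ is taken along $n$ for which $n_1=\omega n$ and $n_2=(1-\omega)n$ are integers. Estimators: with $\bar X_{ni}=\sum_{j=1}^{n_i}X_{ij}/n_i$, $i=1,2$, and $y^+=\max(y,0)$, the maximum likelihood estimators subject to $\theta_1\le\theta_2$ are $\hat\theta_{n1}=\min\{\bar X_{n1},\omega\bar X_{n1}+(1-\omega)\bar X_{n2}\}$, $\hat\theta_{n2}=\max\{\bar X_{n2},\omega\bar X_{n1}+(1-\omega)\bar X_{n2}\}$, $\hat\Delta_n=(\bar X_{n2}-\bar X_{n1})^+$. Bootstrap: given $(\hat\theta_{n1},\hat\theta_{n2})$, let $X^*_{11},\ldots,X^*_{1n_1}$ be a random sample from $f(x;\hat\theta_{n1})$ and, independently, $X^*_{21},\ldots,X^*_{2n_2}$ a random sample from $f(x;\hat\theta_{n2})$. Put $\bar X^*_{ni}=\sum_{j=1}^{n_i}X^*_{ij}/n_i$ and $\hat\theta^*_{n1}=\min\{\bar X^*_{n1},\omega\bar X^*_{n1}+(1-\omega)\bar X^*_{n2}\}$, $\hat\theta^*_{n2}=\max\{\bar X^*_{n2},\omega\bar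 X^*_{n1}+(1-\omega)\bar X^*_{n2}\}$, $\hat\Delta^*_n=(\bar X^*_{n2}-\bar X^*_{n1})^+$. Let $q^*_{1,\alpha},q^*_{2,\alpha},q^*_{\Delta,\alpha}$ be the $\alpha$-quantiles (generalised inverses $\inf\{x:G(x)\ge\alpha\}$) of the conditional distribution functions $G$ given $(\hat\theta_{n1},\hat\theta_{n2})$ of $\hat\theta^*_{n1},\hat\theta^*_{n2},\hat\Delta^*_n$ respectively. On the event that $\hat\theta_{n1}\notin M$ or $\hat\theta_{n2}\notin M$ the bootstrap quantities may be defined arbitrarily. $\mathrm{pr}(\cdot)$ is probability under the true parameters $(\theta_{10,n},\theta_{20,n})$; $I\{\cdot\}$ is the indicator function; $\Phi$ is the standard normal cumulative distribution function; $\Phi_{(\mu,\Sigma)}(x,y)$ is the joint cumulative distribution function of a bivariate normal vector with mean $\mu$ and covariance matrix $\Sigma$. $F_{12}(x,y)$ is the joint cumulative distribution function of the two random variables $$\min\{\omega^{-1/2}Z_1,\ \omega^{1/2}Z_1+(1-\omega)^{1/2}Z_2+(1-\omega)\delta/\sigma_0\}$$ and $$\max\{(1-\omega)^{-1/2}Z_2,\ \omega^{1/2}Z_1+(1-\omega)^{1/2}Z_2-\omega\delta/\sigma_0\},$$ where $Z_1,Z_2$ are independent standard normal random variables. The matrices are $$\Lambda_1=\begin{pmatrix}1&\omega^{1/2}\\ \omega^{1/2}&1\end{pmatrix},\qquad \Lambda_2=\begin{pmatrix}1&(1-\omega)^{1/2}\\(1-\omega)^{1/2}&1\end{pmatrix}.$$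 *)

theory Defs
  imports "HOL-Probability.Probability"
begin

definition nef_density :: "(real \<Rightarrow> real) \<Rightarrow> (real \<Rightarrow> real) \<Rightarrow> real \<Rightarrow> real \<Rightarrow> real" where
  "nef_density a b \<psi> x = a x * exp (\<psi> * x - b \<psi>)"

text \<open>The dominating measure \<open>\<nu>\<close> is Lebesgue measure (so that the density is a probability density
  function) or counting measure on the reals (so that it is a probability mass function; since its
  total mass is one, its support is then automatically countable).\<close>

definition natural_exponential_family ::
    "real measure \<Rightarrow> (real \<Rightarrow> real) \<Rightarrow> (real \<Rightarrow> real) \<Rightarrow> real set \<Rightarrow> bool" where
  "natural_exponential_family \<nu> a b \<Psi> \<longleftrightarrow>
     (\<nu> = lborel \<or> \<nu> = count_space UNIV) \<and>
     open \<Psi> \<and> is_interval \<Psi> \<and> \<Psi> \<noteq> {} \<and>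
     a \<in> borel_measurable \<nu> \<and> (\<forall>x. 0 \<le> a x) \<and>
     (\<forall>\<psi>\<in>\<Psi>. (\<integral>\<^sup>+ x. ennreal (nef_density a b \<psi> x) \<partial>\<nu>) = 1) \<and>
     (\<forall>\<psi>\<in>\<Psi>. (b has_real_derivative deriv b \<psi>) (at \<psi>)) \<and>
     (\<forall>\<psi>\<in>\<Psi>. (deriv b has_real_derivative deriv (deriv b) \<psi>) (at \<psi>)) \<and>
     continuous_on \<Psi> (deriv (deriv b)) \<and>
     (\<forall>\<psi>\<in>\<Psi>. 0 < deriv (deriv b) \<psi>)"

definition mean_range :: "(real \<Rightarrow> real) \<Rightarrow> real set \<Rightarrow> real set" where
  "mean_range b \<Psi> = deriv b ` \<Psi>"

definition natural_param :: "(real \<Rightarrow> real) \<Rightarrow> real set \<Rightarrow> real \<Rightarrow> real" where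
  "natural_param b \<Psi> \<theta> = inv_into \<Psi> (deriv b) \<theta>"

text \<open>The distribution \<open>f(\<cdot>;\<theta>)\<close> as a Borel measure; it is meaningful for \<open>\<theta>\<close> in the mean range only.
  The identity map transports it to the Borel sigma-algebra when \<open>\<nu>\<close> is counting measure.\<close>

definition nef_law ::
    "real measure \<Rightarrow> (real \<Rightarrow> real) \<Rightarrow> (real \<Rightarrow> real) \<Rightarrow> real set \<Rightarrow> real \<Rightarrow> real measure" where
  "nef_law \<nu> a b \<Psi> \<theta> =
     distr (density \<nu> (\<lambda>x. ennreal (nef_density a b (natural_param b \<Psi> \<theta>) x))) borel (\<lambda>x. x)"

definition two_samples ::
    "'a measure \<Rightarrow> (nat \<Rightarrow> 'a \<Rightarrow> real) \<Rightarrow> (nat \<Rightarrow> 'a \<Rightarrow> real) \<Rightarrow> nat \<Rightarrow> nat \<Rightarrow>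
      real measure \<Rightarrow> real measure \<Rightarrow> bool" where
  "two_samples P X1 X2 n1 n2 D1 D2 \<longleftrightarrow>
     prob_space P \<and>
     prob_space.indep_vars P (\<lambda>_. borel) (case_sum X1 X2) ({1..n1} <+> {1..n2}) \<and>
     (\<forall>j\<in>{1..n1}. distr P borel (X1 j) = D1) \<and>
     (\<forall>j\<in>{1..n2}. distr P borel (X2 j) = D2)"

definition sample_mean :: "nat \<Rightarrow> (nat \<Rightarrow> real) \<Rightarrow> real" where
  "sample_mean m x = (\<Sum>j=1..m. x j) / real m"

definition pooled_mean :: "real \<Rightarrow> nat \<Rightarrow> nat \<Rightarrow> (nat \<Rightarrow> real) \<Rightarrow> (nat \<Rightarrow> real) \<Rightarrow> real" where
  "pooled_mean \<omega> n1 n2 x1 x2 = \<omega> * sample_mean n1 x1 + (1 - \<omega>) * sample_mean n2 x2"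

definition theta1_hat :: "real \<Rightarrow> nat \<Rightarrow> nat \<Rightarrow> (nat \<Rightarrow> real) \<Rightarrow> (nat \<Rightarrow> real) \<Rightarrow> real" where
  "theta1_hat \<omega> n1 n2 x1 x2 = min (sample_mean n1 x1) (pooled_mean \<omega> n1 n2 x1 x2)"

definition theta2_hat :: "real \<Rightarrow> nat \<Rightarrow> nat \<Rightarrow> (nat \<Rightarrow> real) \<Rightarrow> (nat \<Rightarrow> real) \<Rightarrow> real" where
  "theta2_hat \<omega> n1 n2 x1 x2 = max (sample_mean n2 x2) (pooled_mean \<omega> n1 n2 x1 x2)"

definition Delta_hat :: "nat \<Rightarrow> nat \<Rightarrow> (nat \<Rightarrow> real) \<Rightarrow> (nat \<Rightarrow> real) \<Rightarrow> real" where
  "Delta_hat n1 n2 x1 x2 = max (sample_mean n2 x2 - sample_mean n1 x1) 0"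

text \<open>The distribution function of a statistic \<open>T\<close> of two independent random samples of sizes
  \<open>n1\<close>, \<open>n2\<close> from \<open>D1\<close>, \<open>D2\<close>. Evaluated at \<open>D1\<close>, \<open>D2\<close> depending on the estimates, it is the
  conditional distribution function of the bootstrap statistic given the estimates.\<close>

definition two_sample_cdf ::
    "real measure \<Rightarrow> real measure \<Rightarrow> nat \<Rightarrow> nat \<Rightarrow> ((nat \<Rightarrow> real) \<Rightarrow> (nat \<Rightarrow> real) \<Rightarrow> real) \<Rightarrow>
      real \<Rightarrow> real" where
  "two_sample_cdf D1 D2 n1 n2 T =
     cdf (distr (PiM {1..n1} (\<lambda>_. D1) \<Otimes>\<^sub>M PiM {1..n2} (\<lambda>_. D2)) borel (\<lambda>(x1, x2). T x1 x2))"

definition quantile :: "(real \<Rightarrow> real) \<Rightarrow> real \<Rightarrow> real" where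
  "quantile G \<alpha> = Inf {x. \<alpha> \<le> G x}"

definition Phi :: "real \<Rightarrow> real" where
  "Phi = cdf std_normal_distribution"

text \<open>Bivariate normal distributions with nonsingular covariance matrix \<open>\<Sigma>\<close>.\<close>

definition binormal_density :: "real^2 \<Rightarrow> real^2^2 \<Rightarrow> real^2 \<Rightarrow> real" where
  "binormal_density \<mu> \<Sigma> v =
     exp (- ((v - \<mu>) \<bullet> (matrix_inv \<Sigma> *v (v - \<mu>))) / 2) / (2 * pi * sqrt (det \<Sigma>))"

definition binormal_cdf :: "real^2 \<Rightarrow> real^2^2 \<Rightarrow> real \<Rightarrow> real \<Rightarrow> real" where
  "binormal_cdf \<mu> \<Sigma> x y =
     measure (density lborel (\<lambda>v. ennreal (binormal_density \<mu> \<Sigma> v))) {v. v $ 1 \<le> x \<and> v $ 2 \<le> y}"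

definition corr_matrix :: "real \<Rightarrow> real^2^2" where
  "corr_matrix r = vector [vector [1, r], vector [r, 1]]"

definition Lambda1 :: "real \<Rightarrow> real^2^2" where
  "Lambda1 \<omega> = corr_matrix (sqrt \<omega>)"

definition Lambda2 :: "real \<Rightarrow> real^2^2" where
  "Lambda2 \<omega> = corr_matrix (sqrt (1 - \<omega>))"

text \<open>The joint distribution whose distribution function is \<open>F\<^sub>1\<^sub>2\<close>; integration with respect to
  \<open>dF\<^sub>1\<^sub>2\<close> is integration with respect to this measure.\<close>

definition F12 :: "real \<Rightarrow> real \<Rightarrow> real \<Rightarrow> (real \<times> real) measure" where
  "F12 \<omega> \<delta> \<sigma>0 =
     distr (std_normal_distribution \<Otimes>\<^sub>M std_normal_distribution) borel
       (\<lambda>(z1, z2).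
         (min (z1 / sqrt \<omega>) (sqrt \<omega> * z1 + sqrt (1 - \<omega>) * z2 + (1 - \<omega>) * \<delta> / \<sigma>0),
          max (z2 / sqrt (1 - \<omega>)) (sqrt \<omega> * z1 + sqrt (1 - \<omega>) * z2 - \<omega> * \<delta> / \<sigma>0)))"

definition C11 :: "real \<Rightarrow> real \<Rightarrow> real" where
  "C11 \<omega> x = sqrt \<omega> * x"

definition C12 :: "real \<Rightarrow> real \<Rightarrow> real \<Rightarrow> real \<Rightarrow> real \<Rightarrow> real" where
  "C12 \<omega> \<delta> \<sigma>0 x y = \<omega> * x + (1 - \<omega>) * y + (1 - \<omega>) * \<delta> / \<sigma>0"

definition C21 :: "real \<Rightarrow> real \<Rightarrow> real" where
  "C21 \<omega> y = sqrt (1 - \<omega>) * y"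

definition C22 :: "real \<Rightarrow> real \<Rightarrow> real \<Rightarrow> real \<Rightarrow> real \<Rightarrow> real" where
  "C22 \<omega> \<delta> \<sigma>0 x y = \<omega> * x + (1 - \<omega>) * y - \<omega> * \<delta> / \<sigma>0"

definition g1 :: "real \<Rightarrow> real \<Rightarrow> real \<Rightarrow> real \<Rightarrow> real \<Rightarrow> real" where
  "g1 \<omega> \<delta> \<sigma>0 x y =
     Phi (- C11 \<omega> x) + Phi (- C12 \<omega> \<delta> \<sigma>0 x y)
       - binormal_cdf 0 (Lambda1 \<omega>) (- C11 \<omega> x) (- C12 \<omega> \<delta> \<sigma>0 x y)"

definition g2 :: "real \<Rightarrow> real \<Rightarrow> real \<Rightarrow> real \<Rightarrow> real \<Rightarrow> real" where
  "g2 \<omega> \<delta> \<sigma>0 x y =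
     binormal_cdf 0 (Lambda2 \<omega>) (- C21 \<omega> y) (- C22 \<omega> \<delta> \<sigma>0 x y)"

text \<open>The sequence \<open>n \<rightarrow> \<infinity>\<close> restricted to those \<open>n\<close> for which \<open>\<omega>n\<close> and \<open>(1 - \<omega>)n\<close> are integers.
  For irrational \<open>\<omega>\<close> no \<open>n > 0\<close> is admissible and this filter is \<open>bot\<close>.\<close>

definition admissible_sizes :: "real \<Rightarrow> nat filter" where
  "admissible_sizes \<omega> =
     inf sequentially (principal {n. \<omega> * real n \<in> \<int> \<and> (1 - \<omega>) * real n \<in> \<int>})"

end

theory Submission
  imports Defs
begin

text \<open>Measure everything in local coordinates: for the two sample means put
  \<open>p = sqrt n * (mean1 - \<theta>10) / \<sigma>0\<close> and \<open>q = sqrt n * (mean2 - \<theta>20) / \<sigma>0\<close>.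
  In these coordinates the constrained estimators are fixed continuous functions \<open>est1 (p, q)\<close> and
  \<open>est2 (p, q)\<close>, in which \<open>n\<close> no longer appears, and a statement such as
  ``the bootstrap estimator is at most the true value'' says that the local coordinates of the bootstrap
  means lie in a fixed set, for instance \<open>{z. est1 z \<le> 0}\<close>.

  The central limit theorem (\<open>std_mean_weak_conv\<close>) holds along every convergent sequence of
  parameters. It shows that \<open>(p, q)\<close> converges in law to
  \<open>(Z1 / sqrt \<omega>, Z2 / sqrt (1 - \<omega>))\<close>. The bootstrap samples are drawn from parameters whose local
  coordinates are \<open>est1 (p, q)\<close> and \<open>est2 (p, q)\<close>. So along any deterministic sequence of
  values of the data with \<open>(p, q)\<close> convergent, the same theorem, applied a second time, shows that the
  bootstrap means converge in law to the same Gaussian pair translated by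
  \<open>(est1 (p, q), est2 (p, q))\<close>. Hence the conditional distribution function of a bootstrap
  estimator at the true parameter converges to the Gaussian probability \<open>lim_prob\<close> of a fixed set after that
  translation; for the two means this is \<open>g1\<close> or \<open>g2\<close>
  (\<open>lim_prob_est1_eq_g1\<close>, \<open>lim_prob_est2_eq_g2\<close>).

  A generalised inverse turns the event \<open>\<theta> \<in> [q\<^sub>\<alpha>, q\<^sub>\<beta>]\<close> into
  \<open>\<alpha> \<le> G(\<theta>)\<close> and, up to equality, \<open>G(\<theta>-) \<le> \<beta>\<close>. Therefore the indicator of
  the event converges pointwise wherever the limiting conditional probability differs from \<open>\<alpha>\<close>
  and \<open>\<beta>\<close>, and the limit theorem for \<open>(p, q)\<close> gives the limit of the coverage
  probability (\<open>coverage_tendsto\<close>). For the two means the exceptional set is null because, for fixed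
  \<open>Z1\<close>, the limiting conditional probability is strictly decreasing in \<open>Z2\<close>
  (\<open>AE_lim_prob_ne\<close>).

  For the difference the identity \<open>est1 z - est2 z = min (p - q) (\<delta> / \<sigma>0)\<close> makes the
  limiting conditional probability equal to \<open>Phi (min N (sqrt (\<omega> * (1 - \<omega>)) * \<delta> / \<sigma>0))\<close>
  with \<open>N\<close> standard normal. The lower quantile condition then always reads \<open>\<alpha> \<le> Phi N\<close>.
  The upper one reads \<open>Phi N \<le> \<beta>\<close> when the truncation level exceeds the \<open>\<beta>\<close>-quantile of the
  normal law, and it holds automatically when the level is smaller. This is the dichotomy in the theorem
  (\<open>coverage_Delta\<close>).\<close>

abbreviation borel2 :: "(real \<times> real) measure" where
  "borel2 \<equiv> borel \<Otimes>\<^sub>M borel"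

section \<open>Weak limits of products, admissible sizes and quantiles\<close>

text \<open>A continuous mapping theorem for independent pairs, with integrands that may change along the sequence.
  Skorohod's representation is used for each coordinate separately; on the product of the two underlying
  spaces the pairs converge pointwise, and dominated convergence applies.\<close>

lemma product_weak_conv_integral:
  fixes \<mu> \<nu> :: "nat \<Rightarrow> real measure" and f :: "nat \<Rightarrow> real \<times> real \<Rightarrow> real"
  assumes \<mu>: "\<And>k. real_distribution (\<mu> k)" "real_distribution M" "weak_conv_m \<mu> M"
    and \<nu>: "\<And>k. real_distribution (\<nu> k)" "real_distribution N" "weak_conv_m \<nu> N"
    and f [measurable]: "\<And>k. f k \<in> borel_measurable borel2"
    and g [measurable]: "g \<in> borel_measurable borel2"
    and bound: "\<And>k z. \<bar>f k z\<bar> \<le> B"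
    and conv: "AE z in M \<Otimes>\<^sub>M N. \<forall>z'. z' \<longlonglongrightarrow> z \<longrightarrow> (\<lambda>k. f k (z' k)) \<longlonglongrightarrow> g z"
  shows "(\<lambda>k. \<integral>z. f k z \<partial>(\<mu> k \<Otimes>\<^sub>M \<nu> k)) \<longlonglongrightarrow> (\<integral>z. g z \<partial>(M \<Otimes>\<^sub>M N))"
proof -
  obtain \<Omega>1 :: "real measure" and Y1 Z1 where sk1: "prob_space \<Omega>1 \<and> (\<forall>k. Y1 k \<in> borel_measurable \<Omega>1) \<and>
      (\<forall>k. distr \<Omega>1 borel (Y1 k) = \<mu> k) \<and> Z1 \<in> measurable \<Omega>1 lborel \<and> distr \<Omega>1 borel Z1 = M \<and>
      (\<forall>x\<in>space \<Omega>1. (\<lambda>k. Y1 k x) \<longlonglongrightarrow> Z1 x)"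
    using Skorohod[OF \<mu>] by (elim exE)
  then have 1: "prob_space \<Omega>1" "\<And>k. Y1 k \<in> borel_measurable \<Omega>1"
    "\<And>k. distr \<Omega>1 borel (Y1 k) = \<mu> k" "Z1 \<in> borel_measurable \<Omega>1" "distr \<Omega>1 borel Z1 = M"
    "\<And>x. x \<in> space \<Omega>1 \<Longrightarrow> (\<lambda>k. Y1 k x) \<longlonglongrightarrow> Z1 x"
    by simp_all
  obtain \<Omega>2 :: "real measure" and Y2 Z2 where sk2: "prob_space \<Omega>2 \<and> (\<forall>k. Y2 k \<in> borel_measurable \<Omega>2) \<and>
      (\<forall>k. distr \<Omega>2 borel (Y2 k) = \<nu> k) \<and> Z2 \<in> measurable \<Omega>2 lborel \<and> distr \<Omega>2 borel Z2 = N \<and>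
      (\<forall>x\<in>space \<Omega>2. (\<lambda>k. Y2 k x) \<longlonglongrightarrow> Z2 x)"
    using Skorohod[OF \<nu>] by (elim exE)
  then have 2: "prob_space \<Omega>2" "\<And>k. Y2 k \<in> borel_measurable \<Omega>2"
    "\<And>k. distr \<Omega>2 borel (Y2 k) = \<nu> k" "Z2 \<in> borel_measurable \<Omega>2" "distr \<Omega>2 borel Z2 = N"
    "\<And>x. x \<in> space \<Omega>2 \<Longrightarrow> (\<lambda>k. Y2 k x) \<longlonglongrightarrow> Z2 x"
    by simp_all
  note [measurable] = 1(2,4) 2(2,4)
  interpret P1: prob_space \<Omega>1 by fact
  interpret P2: prob_space \<Omega>2 by fact
  interpret P: pair_prob_space \<Omega>1 \<Omega>2 ..
  have distr_prod: "distr \<Omega>1 borel Y \<Otimes>\<^sub>M distr \<Omega>2 borel W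
      = distr (\<Omega>1 \<Otimes>\<^sub>M \<Omega>2) borel2 (\<lambda>(a, b). (Y a, W b))"
    if [measurable]: "Y \<in> borel_measurable \<Omega>1" "W \<in> borel_measurable \<Omega>2" for Y W :: "real \<Rightarrow> real"
    by (rule pair_measure_distr) (auto intro!: prob_space_imp_sigma_finite P2.prob_space_distr)
  have seq: "(\<integral>z. f k z \<partial>(\<mu> k \<Otimes>\<^sub>M \<nu> k)) = (\<integral>z. f k (Y1 k (fst z), Y2 k (snd z)) \<partial>(\<Omega>1 \<Otimes>\<^sub>M \<Omega>2))" for k
    unfolding 1(3)[symmetric] 2(3)[symmetric] distr_prod[OF 1(2) 2(2)]
    by (subst integral_distr) (simp_all add: case_prod_beta)
  have lim: "(\<integral>z. g z \<partial>(M \<Otimes>\<^sub>M N)) = (\<integral>z. g (Z1 (fst z), Z2 (snd z)) \<partial>(\<Omega>1 \<Otimes>\<^sub>M \<Omega>2))"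
    unfolding 1(5)[symmetric] 2(5)[symmetric] distr_prod[OF 1(4) 2(4)]
    by (subst integral_distr) (simp_all add: case_prod_beta)
  have "AE z in distr (\<Omega>1 \<Otimes>\<^sub>M \<Omega>2) borel2 (\<lambda>(a, b). (Z1 a, Z2 b)).
      \<forall>z'. z' \<longlonglongrightarrow> z \<longrightarrow> (\<lambda>k. f k (z' k)) \<longlonglongrightarrow> g z"
    using conv unfolding distr_prod[OF 1(4) 2(4), symmetric] 1(5) 2(5) .
  then have "AE z in \<Omega>1 \<Otimes>\<^sub>M \<Omega>2. \<forall>z'. z' \<longlonglongrightarrow> (case z of (a, b) \<Rightarrow> (Z1 a, Z2 b)) \<longrightarrow>
      (\<lambda>k. f k (z' k)) \<longlonglongrightarrow> g (case z of (a, b) \<Rightarrow> (Z1 a, Z2 b))"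
    by (rule AE_distrD[rotated]) measurable
  then have ae: "AE z in \<Omega>1 \<Otimes>\<^sub>M \<Omega>2. (\<lambda>k. f k (Y1 k (fst z), Y2 k (snd z))) \<longlonglongrightarrow> g (Z1 (fst z), Z2 (snd z))"
  proof (rule AE_mp, intro AE_I2 impI)
    fix z assume z: "z \<in> space (\<Omega>1 \<Otimes>\<^sub>M \<Omega>2)"
      and *: "\<forall>z'. z' \<longlonglongrightarrow> (case z of (a, b) \<Rightarrow> (Z1 a, Z2 b)) \<longrightarrow>
        (\<lambda>k. f k (z' k)) \<longlonglongrightarrow> g (case z of (a, b) \<Rightarrow> (Z1 a, Z2 b))"
    have "(\<lambda>k. (Y1 k (fst z), Y2 k (snd z))) \<longlonglongrightarrow> (Z1 (fst z), Z2 (snd z))"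
      using z by (intro tendsto_Pair 1(6) 2(6)) (auto simp: space_pair_measure)
    with * show "(\<lambda>k. f k (Y1 k (fst z), Y2 k (snd z))) \<longlonglongrightarrow> g (Z1 (fst z), Z2 (snd z))"
      by (simp add: case_prod_beta)
  qed
  show ?thesis
    unfolding seq lim
  proof (rule integral_dominated_convergence[where w="\<lambda>_. B"])
    show "integrable (\<Omega>1 \<Otimes>\<^sub>M \<Omega>2) (\<lambda>_. B)" by simp
    show "AE z in \<Omega>1 \<Otimes>\<^sub>M \<Omega>2. norm (f k (Y1 k (fst z), Y2 k (snd z))) \<le> B" for k
      using bound by simp
  qed (use ae in measurable)
qed

text \<open>Reduction to ordinary sequences: a failure of convergence would be visible along an infinite set of
  admissible sizes, whose enumeration is one of the sequences \<open>r\<close>. If there are only finitely many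
  admissible sizes, as for irrational \<open>\<omega>\<close>, there is no such \<open>r\<close> and the claim holds because the
  filter is trivial.\<close>

lemma tendsto_admissible_sizesI:
  fixes f :: "nat \<Rightarrow> real"
  assumes Q: "\<forall>\<^sub>F n in admissible_sizes \<omega>. Q n"
    and seq: "\<And>r :: nat \<Rightarrow> nat. strict_mono r \<Longrightarrow>
      (\<And>k. \<omega> * real (r k) \<in> \<int> \<and> (1 - \<omega>) * real (r k) \<in> \<int> \<and> 0 < r k \<and> Q (r k)) \<Longrightarrow>
      (\<lambda>k. f (r k)) \<longlonglongrightarrow> L"
  shows "(f \<longlongrightarrow> L) (admissible_sizes \<omega>)"
proof (rule ccontr)
  let ?A = "\<lambda>n. \<omega> * real n \<in> \<int> \<and> (1 - \<omega>) * real n \<in> \<int>"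
  assume "\<not> ?thesis"
  then obtain e where e: "0 < e" "\<not> (\<forall>\<^sub>F n in admissible_sizes \<omega>. dist (f n) L < e)"
    unfolding tendsto_iff by auto
  have "\<exists>\<^sub>\<infinity>n. ?A n \<and> 0 < n \<and> Q n \<and> \<not> dist (f n) L < e"
  proof (rule ccontr)
    assume "\<not> ?thesis"
    then have "\<forall>\<^sub>F n in sequentially. \<not> (?A n \<and> 0 < n \<and> Q n \<and> \<not> dist (f n) L < e)"
      by (simp only: cofinite_eq_sequentially not_frequently)
    moreover have "\<forall>\<^sub>F n in sequentially. ?A n \<longrightarrow> Q n"
      using Q unfolding admissible_sizes_def by (simp add: eventually_inf_principal)
    ultimately have "\<forall>\<^sub>F n in sequentially. ?A n \<longrightarrow> dist (f n) L < e"
      using eventually_gt_at_top[of "0::nat"] by eventually_elim auto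
    then show False
      using e(2) unfolding admissible_sizes_def by (simp add: eventually_inf_principal)
  qed
  then have inf: "infinite {n. ?A n \<and> 0 < n \<and> Q n \<and> \<not> dist (f n) L < e}"
    by (simp add: frequently_cofinite)
  define r where "r = enumerate {n. ?A n \<and> 0 < n \<and> Q n \<and> \<not> dist (f n) L < e}"
  have r: "?A (r k) \<and> 0 < r k \<and> Q (r k) \<and> \<not> dist (f (r k)) L < e" for k
    using enumerate_in_set[OF inf, of k] by (auto simp: r_def)
  have "(\<lambda>k. f (r k)) \<longlonglongrightarrow> L"
    by (rule seq) (use r strict_mono_enumerate[OF inf] in \<open>auto simp: r_def\<close>)
  then have "\<forall>\<^sub>F k in sequentially. dist (f (r k)) L < e"
    using e(1) by (rule tendstoD)
  then show False using r by (auto simp: eventually_sequentially)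
qed

text \<open>Right continuity of the distribution function makes the infimum that defines the quantile attained.\<close>

lemma (in real_distribution) quantile_le_iff:
  assumes "0 < \<alpha>" "\<alpha> < 1"
  shows "quantile (cdf M) \<alpha> \<le> t \<longleftrightarrow> \<alpha> \<le> cdf M t"
proof -
  let ?S = "{x. \<alpha> \<le> cdf M x}"
  have "\<forall>\<^sub>F x in at_top. \<alpha> < cdf M x"
    using order_tendstoD(1)[OF cdf_lim_at_top_prob] assms by auto
  then have ne: "?S \<noteq> {}" by (auto simp: eventually_at_top_linorder intro: less_imp_le)
  have "\<forall>\<^sub>F x in at_bot. cdf M x < \<alpha>"
    using order_tendstoD(2)[OF cdf_lim_at_bot] assms by auto
  then obtain l where l: "\<And>x. x \<le> l \<Longrightarrow> cdf M x < \<alpha>" by (auto simp: eventually_at_bot_linorder)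
  then have bdd: "bdd_below ?S"
  proof (intro bdd_belowI[of _ l])
    fix x assume "x \<in> ?S"
    then show "l \<le> x" using l[of x] linear[of x l] by auto
  qed
  show ?thesis
  proof
    assume "\<alpha> \<le> cdf M t" then show "quantile (cdf M) \<alpha> \<le> t"
      unfolding quantile_def by (intro cInf_lower bdd) auto
  next
    assume q: "quantile (cdf M) \<alpha> \<le> t"
    have gt: "\<alpha> \<le> cdf M y" if "t < y" for y
    proof -
      have "Inf ?S < y" using q that by (simp add: quantile_def)
      then obtain x where "\<alpha> \<le> cdf M x" "x < y" using cInf_lessD[OF ne] by auto
      then show ?thesis using cdf_nondecreasing[of x y] by simp
    qed
    have "(cdf M \<longlongrightarrow> cdf M t) (at_right t)"
      using cdf_is_right_cont[of t] by (simp add: continuous_within)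
    moreover have "\<forall>\<^sub>F y in at_right t. \<alpha> \<le> cdf M y"
      using gt by (auto simp: eventually_at_filter)
    ultimately show "\<alpha> \<le> cdf M t" by (rule tendsto_lowerbound) simp
  qed
qed

text \<open>A countable version of the condition \<open>G(x) < \<alpha>\<close> for all \<open>x < t\<close>; only in this form is
  it visibly measurable in a parameter of \<open>G\<close>.\<close>

lemma (in real_distribution) le_quantile_iff:
  assumes "0 < \<alpha>" "\<alpha> < 1"
  shows "t \<le> quantile (cdf M) \<alpha> \<longleftrightarrow> (\<forall>j::nat. cdf M (t - 1 / real (Suc j)) < \<alpha>)"
proof -
  have "t \<le> quantile (cdf M) \<alpha> \<longleftrightarrow> (\<forall>j::nat. \<not> quantile (cdf M) \<alpha> \<le> t - 1 / real (Suc j))"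
  proof
    assume a: "\<forall>j::nat. \<not> quantile (cdf M) \<alpha> \<le> t - 1 / real (Suc j)"
    show "t \<le> quantile (cdf M) \<alpha>"
    proof (rule ccontr)
      assume "\<not> ?thesis"
      then obtain j where "inverse (real (Suc j)) < t - quantile (cdf M) \<alpha>"
        using reals_Archimedean[of "t - quantile (cdf M) \<alpha>"] by auto
      with a[rule_format, of j] show False by (simp add: inverse_eq_divide)
    qed
  next
    assume t: "t \<le> quantile (cdf M) \<alpha>"
    show "\<forall>j::nat. \<not> quantile (cdf M) \<alpha> \<le> t - 1 / real (Suc j)"
    proof
      fix j :: nat
      have "0 < 1 / real (Suc j)" by simp
      with t show "\<not> quantile (cdf M) \<alpha> \<le> t - 1 / real (Suc j)" by linarith
    qed
  qed
  then show ?thesis by (simp add: quantile_le_iff[OF assms] not_le)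
qed

text \<open>This lemma and the next one compare \<open>t \<le> q\<^sub>\<alpha>\<close> with the left limit \<open>G(t-)\<close>. They leave
  only the case of equality open, which has probability zero in the limit.\<close>

lemma (in real_distribution) le_quantile_imp:
  assumes "0 < \<alpha>" "\<alpha> < 1" "t \<le> quantile (cdf M) \<alpha>"
  shows "measure M {..<t} \<le> \<alpha>"
proof -
  have "cdf M y \<le> \<alpha>" if "y < t" for y
    using quantile_le_iff[OF assms(1,2), of y] that assms(3) by linarith
  then have "\<forall>\<^sub>F y in at_left t. cdf M y \<le> \<alpha>" by (auto simp: eventually_at_filter)
  then show ?thesis by (rule tendsto_upperbound[OF cdf_at_left]) simp
qed

lemma (in real_distribution) less_imp_le_quantile:
  assumes "0 < \<alpha>" "\<alpha> < 1" "measure M {..<t} < \<alpha>"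
  shows "t \<le> quantile (cdf M) \<alpha>"
proof (rule ccontr)
  define y where "y = quantile (cdf M) \<alpha>"
  assume "\<not> ?thesis"
  then have "y < t" by (simp add: y_def)
  then have "cdf M y \<le> measure M {..<t}"
    unfolding cdf_def by (intro finite_measure_mono) auto
  moreover have "\<alpha> \<le> cdf M y" using quantile_le_iff[OF assms(1,2), of y] by (simp add: y_def)
  ultimately show False using assms(3) by linarith
qed

section \<open>A pair of independent standard normal variables\<close>

abbreviation gauss2 :: "(real \<times> real) measure" where
  "gauss2 \<equiv> std_normal_distribution \<Otimes>\<^sub>M std_normal_distribution"

interpretation std_normal: real_distribution std_normal_distribution
  by (rule real_dist_normal_dist)

interpretation gauss2: pair_prob_space std_normal_distribution std_normal_distribution ..

lemma space_gauss2 [simp]: "space gauss2 = UNIV"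
  by (simp add: space_pair_measure)

lemma sets_gauss2 [measurable_cong, simp]: "sets gauss2 = sets borel2"
  by (simp cong: sets_pair_measure_cong)

lemma AE_std_normal_countable:
  assumes "countable A" shows "AE x in std_normal_distribution. x \<notin> A"
proof -
  have "AE x in lborel. x \<notin> A"
    using assms by (intro AE_not_in countable_imp_null_set_lborel)
  then show ?thesis by (auto simp: AE_density)
qed

text \<open>Fubini: a set is null when its vertical sections are countable, and in particular when they have at most one
  point.\<close>

lemma AE_gauss2_sections:
  assumes [measurable]: "Measurable.pred borel2 Q"
    and "\<And>u. countable {v. \<not> Q (u, v)}"
  shows "AE z in gauss2. Q z"
proof (rule gauss2.AE_pair_measure)
  show "{x \<in> space gauss2. Q x} \<in> sets gauss2"
    by measurable
  show "AE u in std_normal_distribution. AE v in std_normal_distribution. Q (u, v)"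
    using AE_std_normal_countable[OF assms(2)] by simp
qed

lemma distr_gauss2_swap:
  "distr gauss2 borel2 (\<lambda>(u, v). (v, u)) = gauss2"
  using gauss2.distr_pair_swap by (metis distr_cong sets_gauss2)

lemma AE_gauss2_sections_swap:
  assumes [measurable]: "Measurable.pred borel2 Q"
    and "\<And>v. countable {u. \<not> Q (u, v)}"
  shows "AE z in gauss2. Q z"
proof -
  have "AE z in gauss2. Q (case z of (u, v) \<Rightarrow> (v, u))"
    using assms(2) by (intro AE_gauss2_sections) auto
  then have "AE z in distr gauss2 borel2 (\<lambda>(u, v). (v, u)). Q z"
    by (subst AE_distr_iff) auto
  then show ?thesis by (simp only: distr_gauss2_swap)
qed

lemma AE_gauss2_line:
  assumes "\<alpha> \<noteq> 0 \<or> \<beta> \<noteq> 0"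
  shows "AE (u, v) in gauss2. \<alpha> * u + \<beta> * v \<noteq> \<gamma>"
proof (cases "\<beta> = 0")
  case True
  then have "{u. \<alpha> * u = \<gamma>} \<subseteq> {\<gamma> / \<alpha>}" using assms by auto
  with True have "countable {u. \<alpha> * u + \<beta> * v = \<gamma>}" for v
    by (auto intro: countable_subset[of _ "{\<gamma> / \<alpha>}"])
  then show ?thesis
    by (intro AE_gauss2_sections_swap) auto
next
  case False
  then have "{v. \<alpha> * u + \<beta> * v = \<gamma>} \<subseteq> {(\<gamma> - \<alpha> * u) / \<beta>}" for u
    by (auto simp: field_simps)
  then have "countable {v. \<alpha> * u + \<beta> * v = \<gamma>}" for u
    by (rule countable_subset) simp
  then show ?thesis
    by (intro AE_gauss2_sections) auto
qed

lemma emeasure_std_normal_open_interval_pos: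
  assumes "a < b" shows "0 < emeasure std_normal_distribution {a<..<b}"
proof (rule ccontr)
  assume "\<not> ?thesis"
  then have "AE x in std_normal_distribution. x \<notin> {a<..<b}"
    by (intro AE_not_in) (auto simp: null_sets_def)
  then have "AE x in lborel. x \<notin> {a<..<b}"
    by (simp add: AE_density normal_density_pos)
  then have "{a<..<b} \<in> null_sets lborel" by (subst (asm) AE_iff_null_sets[symmetric]) auto
  then show False using assms by (auto simp: null_sets_def)
qed

lemma measure_gauss2_open_pos:
  fixes U :: "(real \<times> real) set"
  assumes "open U" "z \<in> U"
  shows "0 < measure gauss2 U"
proof -
  obtain A B where AB: "open A" "open B" "z \<in> A \<times> B" "A \<times> B \<subseteq> U"
    using open_prod_elim[OF assms] by metis
  obtain e where e: "0 < e" "{fst z - e <..< fst z + e} \<subseteq> A"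
    using AB(1,3) by (auto simp: open_real_def open_dist subset_iff dist_real_def) (metis openE ball_eq_greaterThanLessThan subset_iff greaterThanLessThan_iff AB(1))
  obtain d where d: "0 < d" "{snd z - d <..< snd z + d} \<subseteq> B"
    using AB(2,3) by (metis mem_Times_iff openE ball_eq_greaterThanLessThan)
  have "0 < emeasure std_normal_distribution {fst z - e <..< fst z + e}
      * emeasure std_normal_distribution {snd z - d <..< snd z + d}"
    using emeasure_std_normal_open_interval_pos[of "fst z - e" "fst z + e"]
      emeasure_std_normal_open_interval_pos[of "snd z - d" "snd z + d"] e d
    by (simp add: ennreal_zero_less_mult_iff)
  also have "\<dots> = emeasure gauss2 ({fst z - e <..< fst z + e} \<times> {snd z - d <..< snd z + d})"
    by (subst std_normal.emeasure_pair_measure_Times) auto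
  also have "\<dots> \<le> emeasure gauss2 U"
    using e(2) d(2) AB(4) assms(1) by (intro emeasure_mono) (force, metis borel_prod borel_open assms(1) sets_gauss2)
  finally show ?thesis
    by (simp add: gauss2.P.emeasure_eq_measure)
qed

text \<open>Rotation invariance of the Gaussian pair, in the form needed here: the characteristic function of
  \<open>r Z1 + s Z2\<close> factorises.\<close>

lemma distr_gauss2_rotation:
  fixes r s :: real
  assumes "r\<^sup>2 + s\<^sup>2 = 1"
  shows "distr gauss2 borel (\<lambda>(u, v). r * u + s * v) = std_normal_distribution"
proof (rule Levy_uniqueness)
  show "real_distribution (distr gauss2 borel (\<lambda>(u, v). r * u + s * v))"
    by (rule gauss2.P.real_distribution_distr) simp
  show "char (distr gauss2 borel (\<lambda>(u, v). r * u + s * v)) = char std_normal_distribution"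
  proof
    fix t :: real
    have "char (distr gauss2 borel (\<lambda>(u, v). r * u + s * v)) t
        = (CLINT z|gauss2. iexp (t * (r * fst z + s * snd z)))"
      unfolding char_def
      by (subst integral_distr) (auto simp: case_prod_beta)
    also have "\<dots> = (CLINT u|std_normal_distribution. CLINT v|std_normal_distribution. iexp (t * r * u) * iexp (t * s * v))"
    proof (subst gauss2.integral_fst'[symmetric])
      show "complex_integrable gauss2 (\<lambda>z. iexp (t * (r * fst z + s * snd z)))"
        by (rule gauss2.P.integrable_iexp) auto
    qed (simp add: exp_add[symmetric] algebra_simps)
    also have "\<dots> = char std_normal_distribution (t * r) * char std_normal_distribution (t * s)"
      by (simp add: char_def)
    also have "\<dots> = char std_normal_distribution t"
    proof -
      have "exp (- ((t * r)\<^sup>2) / 2) * exp (- ((t * s)\<^sup>2) / 2) = exp (- (t\<^sup>2 * (r\<^sup>2 + s\<^sup>2)) / 2)"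
        by (simp add: exp_add[symmetric] field_simps)
      then show ?thesis by (simp add: char_std_normal_distribution assms flip: of_real_mult)
    qed
    finally show "char (distr gauss2 borel (\<lambda>(u, v). r * u + s * v)) t = char std_normal_distribution t" .
  qed
qed (rule real_dist_normal_dist)

lemma measure_gauss2_halfplane:
  assumes "r\<^sup>2 + s\<^sup>2 = 1"
  shows "measure gauss2 {z. r * fst z + s * snd z \<le> t} = Phi t"
proof -
  have "Phi t = measure (distr gauss2 borel (\<lambda>(u, v). r * u + s * v)) {..t}"
    by (simp only: Phi_def cdf_def distr_gauss2_rotation[OF assms])
  also have "\<dots> = measure gauss2 {z. r * fst z + s * snd z \<le> t}"
    by (subst measure_distr) (auto simp: vimage_def case_prod_beta)
  finally show ?thesis by simp
qed

section \<open>The bivariate normal distribution function as a probability of the pair\<close>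

lemma continuous_on_vector2: "continuous_on UNIV (\<lambda>p::real\<times>real. vector [fst p, snd p] :: real^2)"
proof -
  have "(vector [x, y] :: real^2) = (\<chi> i. if i = 1 then x else y)" for x y :: real
    by (simp add: vec_eq_iff forall_2)
  moreover have "continuous_on UNIV (\<lambda>p::real\<times>real. if i = 1 then fst p else snd p)" for i :: 2
    by (cases "i = 1") (simp_all add: continuous_on_fst continuous_on_snd continuous_on_id)
  ultimately show ?thesis
    by (simp add: continuous_on_vec_lambda)
qed

text \<open>The bivariate densities are given on \<open>real^2\<close>; this identification makes Tonelli's theorem on
  \<open>real \<times> real\<close> available for them.\<close>

lemma lborel_vec2_eq_distr:
  "(lborel :: (real^2) measure) = distr (lborel \<Otimes>\<^sub>M lborel) borel (\<lambda>(x, y). vector [x, y])"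
proof (rule lborel_eqI)
  note cont = continuous_on_vector2
  have meas [measurable]: "(\<lambda>(x, y). vector [x, y] :: real^2) \<in> borel_measurable (lborel \<Otimes>\<^sub>M lborel)"
    using borel_measurable_continuous_onI[OF cont] by (simp add: lborel_prod case_prod_beta)
  fix l u :: "real^2"
  assume "\<And>b. b \<in> Basis \<Longrightarrow> l \<bullet> b \<le> u \<bullet> b"
  then have "l \<bullet> axis i 1 \<le> u \<bullet> axis i 1" for i
    by (simp add: axis_in_Basis_iff)
  then have le: "l $ i \<le> u $ i" for i by (simp add: inner_axis)
  have Basis: "(Basis :: (real^2) set) = (\<lambda>i. axis i 1) ` UNIV" by (auto simp: Basis_vec_def)
  have "(\<lambda>(x, y). vector [x, y] :: real^2) -` box l u \<inter> space (lborel \<Otimes>\<^sub>M lborel)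
      = {l $ 1 <..< u $ 1} \<times> {l $ 2 <..< u $ 2}"
    by (auto simp: mem_box_cart forall_2 space_pair_measure)
  then have "emeasure (distr (lborel \<Otimes>\<^sub>M lborel) borel (\<lambda>(x, y). vector [x, y] :: real^2)) (box l u)
      = ennreal (u $ 1 - l $ 1) * ennreal (u $ 2 - l $ 2)"
    using le by (subst emeasure_distr) (auto simp: lborel.emeasure_pair_measure_Times)
  also have "\<dots> = ennreal ((u $ 1 - l $ 1) * (u $ 2 - l $ 2))"
    using le by (simp add: ennreal_mult)
  also have "(u $ 1 - l $ 1) * (u $ 2 - l $ 2) = (\<Prod>b\<in>Basis. (u - l) \<bullet> b)"
    unfolding Basis by (subst prod.reindex) (auto simp: inj_on_def axis_eq_axis inner_axis UNIV_2)
  finally show "emeasure (distr (lborel \<Otimes>\<^sub>M lborel) borel (\<lambda>(x, y). vector [x, y] :: real^2)) (box l u)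
      = ennreal (\<Prod>b\<in>Basis. (u - l) \<bullet> b)" .
qed simp

lemma matrix_inv_eqI:
  fixes A B :: "real^'n^'n"
  assumes "A ** B = mat 1" "B ** A = mat 1"
  shows "matrix_inv A = B"
proof -
  have "A ** matrix_inv A = mat 1 \<and> matrix_inv A ** A = mat 1"
    unfolding matrix_inv_def by (rule someI[of _ B]) (use assms in simp)
  then show ?thesis using assms by (metis matrix_mul_assoc matrix_mul_lid matrix_mul_rid)
qed

text \<open>The quadratic form diagonalises under the substitution \<open>y = r x + sqrt (1 - r\<^sup>2) z\<close>.\<close>

lemma binormal_density_corr_matrix:
  assumes r: "r\<^sup>2 < 1"
  shows "binormal_density 0 (corr_matrix r) (vector [x, r * x + sqrt (1 - r\<^sup>2) * z])
    = std_normal_density x * std_normal_density z / sqrt (1 - r\<^sup>2)"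
proof -
  define d where "d = 1 / (1 - r\<^sup>2)"
  define B :: "real^2^2" where "B = vector [vector [d, - (r * d)], vector [- (r * d), d]]"
  have nz: "1 - r\<^sup>2 \<noteq> 0" using r by simp
  have d: "d - r * (r * d) = 1" using nz by (simp add: d_def field_simps power2_eq_square)
  have "corr_matrix r ** B = mat 1" "B ** corr_matrix r = mat 1"
    using d by (simp_all add: corr_matrix_def B_def vec_eq_iff forall_2 matrix_matrix_mult_def sum_2 mat_def mult_ac)
  then have inv: "matrix_inv (corr_matrix r) = B" by (rule matrix_inv_eqI)
  have det: "det (corr_matrix r) = 1 - r\<^sup>2"
    by (simp add: det_2 corr_matrix_def power2_eq_square)
  define s where "s = sqrt (1 - r\<^sup>2)"
  have s: "0 < s" "s\<^sup>2 = 1 - r\<^sup>2" using r by (simp_all add: s_def)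
  define y where "y = r * x + s * z"
  have "(vector [x, y] - 0 :: real^2) \<bullet> (B *v (vector [x, y] - 0)) = d * (x\<^sup>2 - 2 * r * x * y + y\<^sup>2)"
    by (simp add: inner_vec_def sum_2 matrix_vector_mult_def B_def power2_eq_square algebra_simps)
  also have "x\<^sup>2 - 2 * r * x * y + y\<^sup>2 = (1 - r\<^sup>2) * x\<^sup>2 + s\<^sup>2 * z\<^sup>2"
    by (simp add: y_def power2_eq_square algebra_simps)
  also have "d * \<dots> = x\<^sup>2 + z\<^sup>2"
    using nz by (simp add: s(2) d_def distrib_left[symmetric] del: distrib_left_numeral)
  finally have q: "(vector [x, y] - 0 :: real^2) \<bullet> (B *v (vector [x, y] - 0)) = x\<^sup>2 + z\<^sup>2" .
  have "exp (- (x\<^sup>2 + z\<^sup>2) / 2) / (2 * pi * s) = std_normal_density x * std_normal_density z / s"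
    by (simp add: std_normal_density_def exp_add[symmetric] field_simps flip: real_sqrt_mult)
  then show ?thesis
    unfolding binormal_density_def inv det s_def[symmetric] y_def[symmetric] q .
qed

text \<open>A vector with correlation \<open>r\<close> is realised as \<open>(Z1, r Z1 + sqrt (1 - r\<^sup>2) Z2)\<close>; the
  proof is the affine substitution in the inner integral.\<close>

lemma binormal_cdf_corr_matrix:
  assumes r: "r\<^sup>2 < 1"
  shows "binormal_cdf 0 (corr_matrix r) x y
    = measure gauss2 {z. fst z \<le> x \<and> r * fst z + sqrt (1 - r\<^sup>2) * snd z \<le> y}"
proof -
  define s where "s = sqrt (1 - r\<^sup>2)"
  have s: "0 < s" using r by (simp add: s_def)
  define f where "f = (\<lambda>v::real^2. ennreal (binormal_density 0 (corr_matrix r) v))"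
  have [measurable]: "(\<lambda>v::real^2. matrix_inv (corr_matrix r) *v (v - 0)) \<in> borel_measurable borel"
    by (intro borel_measurable_continuous_onI linear_continuous_on) (simp add: linear_linear matrix_vector_mul_linear)
  have [measurable]: "f \<in> borel_measurable borel"
    unfolding f_def binormal_density_def by measurable
  note cont = continuous_on_vector2
  have meas [measurable]: "(\<lambda>(x, y). vector [x, y] :: real^2) \<in> borel_measurable (lborel \<Otimes>\<^sub>M lborel)"
    using borel_measurable_continuous_onI[OF cont] by (simp add: lborel_prod case_prod_beta)
  have meas' [measurable]: "(\<lambda>p. vector [fst p, snd p] :: real^2) \<in> borel_measurable borel2"
    using borel_measurable_continuous_onI[OF cont] by (simp add: borel_prod)
  let ?S = "{v :: real^2. v $ 1 \<le> x \<and> v $ 2 \<le> y}"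
  have S [measurable]: "?S \<in> sets borel"
    by (intro borel_closed closed_Collect_conj closed_Collect_le continuous_intros)
  let ?T = "{z. fst z \<le> x \<and> r * fst z + s * snd z \<le> y}"
  have "{z \<in> space borel2. fst z \<le> x \<and> r * fst z + s * snd z \<le> y} \<in> sets borel2"
    by measurable
  then have [measurable]: "?T \<in> sets borel2"
    by (simp add: space_pair_measure)
  have "emeasure (density lborel f) ?S = (\<integral>\<^sup>+v. f v * indicator ?S v \<partial>lborel)"
    by (rule emeasure_density) simp_all
  also have "\<dots> = (\<integral>\<^sup>+p. f (vector [fst p, snd p]) * indicator ?S (vector [fst p, snd p]) \<partial>(lborel \<Otimes>\<^sub>M lborel))"
    by (subst lborel_vec2_eq_distr, subst nn_integral_distr) (simp_all add: case_prod_beta)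
  also have "\<dots> = (\<integral>\<^sup>+u. \<integral>\<^sup>+w. f (vector [u, w]) * indicator ?S (vector [u, w]) \<partial>lborel \<partial>lborel)"
    by (subst lborel.nn_integral_fst[symmetric]) simp_all
  also have "\<dots> = (\<integral>\<^sup>+u. \<integral>\<^sup>+v. ennreal (std_normal_density u) * (ennreal (std_normal_density v) * indicator ?T (u, v)) \<partial>lborel \<partial>lborel)"
  proof (rule nn_integral_cong)
    fix u :: real
    have "(\<lambda>w. vector [u, w] :: real^2) \<in> borel_measurable borel"
      using measurable_compose[OF _ meas', of "\<lambda>w. (u, w)" borel] by simp
    then have m: "(\<lambda>w. f (vector [u, w]) * indicator ?S (vector [u, w] :: real^2)) \<in> borel_measurable borel"
      by measurable
    have "(\<integral>\<^sup>+w. f (vector [u, w]) * indicator ?S (vector [u, w]) \<partial>lborel)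
      = ennreal \<bar>s\<bar> * (\<integral>\<^sup>+v. f (vector [u, r * u + s * v]) * indicator ?S (vector [u, r * u + s * v]) \<partial>lborel)"
      using s by (intro nn_integral_real_affine[OF m]) simp
    also have "\<dots> = (\<integral>\<^sup>+v. ennreal \<bar>s\<bar> * (f (vector [u, r * u + s * v]) * indicator ?S (vector [u, r * u + s * v])) \<partial>lborel)"
      using measurable_compose[OF _ m, of "\<lambda>v. r * u + s * v" borel] by (subst nn_integral_cmult) simp_all
    also have "\<dots> = (\<integral>\<^sup>+v. ennreal (std_normal_density u) * (ennreal (std_normal_density v) * indicator ?T (u, v)) \<partial>lborel)"
      using s
      by (intro nn_integral_cong)
         (auto simp: f_def binormal_density_corr_matrix[OF r, folded s_def] indicator_def
            simp flip: ennreal_mult'[of s] ennreal_mult)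
    finally show "(\<integral>\<^sup>+w. f (vector [u, w]) * indicator ?S (vector [u, w]) \<partial>lborel) =
      (\<integral>\<^sup>+v. ennreal (std_normal_density u) * (ennreal (std_normal_density v) * indicator ?T (u, v)) \<partial>lborel)" .
  qed
  also have "\<dots> = emeasure gauss2 ?T"
    by (subst std_normal.emeasure_pair_measure)
       (simp_all add: nn_integral_density nn_integral_cmult)
  finally show ?thesis
    by (simp add: binormal_cdf_def measure_def f_def s_def)
qed

section \<open>Characteristic functions in a natural exponential family\<close>

text \<open>The key to a central limit theorem that uses no moments: \<open>exp (i u)\<close> agrees up to third order with
  \<open>1 + i sinh u - (cosh u - 1)\<close>, since both expand as \<open>1 + i u - u\<^sup>2 / 2 + \<dots>\<close>. The
  expectation of the right-hand side involves only the moment generating function, which is explicit in an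
  exponential family.\<close>

lemma iexp_hyperbolic_approx:
  fixes u :: real
  shows "cmod (iexp u - (2 + (complex_of_real (exp u) * (\<i> - 1) - complex_of_real (exp (- u)) * (1 + \<i>)) / 2))
    \<le> 2 * \<bar>u\<bar> ^ 3 * exp \<bar>u\<bar>"
proof -
  define E where "E z = exp z - (1 + z + z\<^sup>2 / 2)" for z :: complex
  have E: "cmod (E z) \<le> exp \<bar>u\<bar> * \<bar>u\<bar> ^ 3 / 2" if "cmod z = \<bar>u\<bar>" "\<bar>Re z\<bar> \<le> \<bar>u\<bar>" for z
  proof -
    have "cmod (E z) \<le> exp \<bar>Re z\<bar> * cmod z ^ 3 / 2"
      using Taylor_exp[of z 2] by (simp add: E_def eval_nat_numeral fact_numeral)
    also have "\<dots> \<le> exp \<bar>u\<bar> * \<bar>u\<bar> ^ 3 / 2"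
      using that by (intro divide_right_mono mult_mono) auto
    finally show ?thesis .
  qed
  have eq: "iexp u - (2 + (complex_of_real (exp u) * (\<i> - 1) - complex_of_real (exp (- u)) * (1 + \<i>)) / 2)
      = E (\<i> * of_real u) + (E (of_real u) * (1 - \<i>) + E (- of_real u) * (1 + \<i>)) / 2"
    by (simp add: E_def exp_of_real[symmetric] field_simps power2_eq_square)
  have n: "cmod (1 - \<i>) \<le> 2" "cmod (1 + \<i>) \<le> 2"
    using norm_triangle_ineq4[of 1 \<i>] norm_triangle_ineq[of 1 \<i>] by auto
  have "cmod (E (of_real u) * (1 - \<i>) + E (- of_real u) * (1 + \<i>))
      \<le> exp \<bar>u\<bar> * \<bar>u\<bar> ^ 3 / 2 * 2 + exp \<bar>u\<bar> * \<bar>u\<bar> ^ 3 / 2 * 2"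
    by (intro norm_triangle_le add_mono order_trans[OF norm_mult_ineq] mult_mono E n) auto
  then have "cmod ((E (of_real u) * (1 - \<i>) + E (- of_real u) * (1 + \<i>)) / 2) \<le> exp \<bar>u\<bar> * \<bar>u\<bar> ^ 3"
    by (simp add: norm_divide)
  moreover have "cmod (E (\<i> * of_real u)) \<le> exp \<bar>u\<bar> * \<bar>u\<bar> ^ 3 / 2"
    by (rule E) (simp_all add: norm_mult)
  ultimately have "cmod (E (\<i> * of_real u) + (E (of_real u) * (1 - \<i>) + E (- of_real u) * (1 + \<i>)) / 2)
      \<le> exp \<bar>u\<bar> * \<bar>u\<bar> ^ 3 / 2 + exp \<bar>u\<bar> * \<bar>u\<bar> ^ 3"
    by (intro norm_triangle_le add_mono)
  moreover have "0 \<le> exp \<bar>u\<bar> * \<bar>u\<bar> ^ 3" by simp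
  ultimately have "cmod (E (\<i> * of_real u) + (E (of_real u) * (1 - \<i>) + E (- of_real u) * (1 + \<i>)) / 2)
      \<le> 2 * (exp \<bar>u\<bar> * \<bar>u\<bar> ^ 3)"
    by linarith
  also have "2 * (exp \<bar>u\<bar> * \<bar>u\<bar> ^ 3) = 2 * \<bar>u\<bar> ^ 3 * exp \<bar>u\<bar>" by simp
  finally show ?thesis unfolding eq .
qed

text \<open>Bounds the error of the preceding approximation by something whose expectation is again given by the moment
  generating function. The constant comes from \<open>x\<^sup>3 / 6 \<le> exp x\<close> with
  \<open>x = \<epsilon> \<bar>y\<bar> / 2\<close>.\<close>

lemma cube_exp_le_two_sided_exp:
  fixes t \<epsilon> y :: real
  assumes "0 < \<epsilon>" "\<bar>t\<bar> \<le> \<epsilon> / 2"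
  shows "\<bar>t * y\<bar> ^ 3 * exp \<bar>t * y\<bar> \<le> 48 / \<epsilon> ^ 3 * \<bar>t\<bar> ^ 3 * (exp (\<epsilon> * y) + exp (- (\<epsilon> * y)))"
proof -
  define x where "x = \<epsilon> * \<bar>y\<bar> / 2"
  have x: "0 \<le> x" using assms by (simp add: x_def)
  obtain s where "exp x = (\<Sum>i<4. x ^ i / fact i) + exp s / fact 4 * x ^ 4"
    using Maclaurin_exp_le[of x 4] by blast
  moreover have "x ^ 3 / 6 \<le> (\<Sum>i<4. x ^ i / fact i)"
    using x by (simp add: eval_nat_numeral)
  moreover have "0 \<le> exp s / fact 4 * x ^ 4" by simp
  ultimately have "x ^ 3 / 6 \<le> exp x" by linarith
  then have c: "\<bar>y\<bar> ^ 3 \<le> 48 / \<epsilon> ^ 3 * exp x"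
    using assms by (simp add: x_def field_simps power_mult_distrib power_divide)
  have "\<bar>t * y\<bar> ^ 3 * exp \<bar>t * y\<bar> = \<bar>t\<bar> ^ 3 * (\<bar>y\<bar> ^ 3 * exp \<bar>t * y\<bar>)"
    by (simp add: abs_mult power_mult_distrib)
  also have "\<dots> \<le> \<bar>t\<bar> ^ 3 * ((48 / \<epsilon> ^ 3 * exp x) * exp x)"
  proof -
    have "\<bar>t * y\<bar> \<le> x"
      using mult_right_mono[OF assms(2), of "\<bar>y\<bar>"] by (simp add: x_def abs_mult)
    then show ?thesis
      using assms by (intro mult_left_mono mult_mono c) auto
  qed
  also have "exp x * exp x = exp (\<epsilon> * \<bar>y\<bar>)"
    by (simp add: x_def exp_add[symmetric])
  then have "\<bar>t\<bar> ^ 3 * ((48 / \<epsilon> ^ 3 * exp x) * exp x) = 48 / \<epsilon> ^ 3 * \<bar>t\<bar> ^ 3 * exp (\<epsilon> * \<bar>y\<bar>)"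
    by (simp add: mult_ac)
  also have "\<dots> \<le> 48 / \<epsilon> ^ 3 * \<bar>t\<bar> ^ 3 * (exp (\<epsilon> * y) + exp (- (\<epsilon> * y)))"
    using assms by (intro mult_left_mono) (auto simp: abs_if)
  finally show ?thesis .
qed

lemma tendsto_mult_exp_minus_one:
  fixes x :: "nat \<Rightarrow> real" and m :: "nat \<Rightarrow> real"
  assumes "(\<lambda>k. m k * x k) \<longlonglongrightarrow> c" "filterlim m at_top sequentially"
  shows "(\<lambda>k. m k * (exp (x k) - 1)) \<longlonglongrightarrow> c"
proof -
  have "(\<lambda>k. (m k * x k) * inverse (m k)) \<longlonglongrightarrow> c * 0"
    by (intro tendsto_mult assms tendsto_inverse_0_at_top)
  moreover have "\<forall>\<^sub>F k in sequentially. (m k * x k) * inverse (m k) = x k"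
    using filterlim_at_top_dense[THEN iffD1, OF assms(2), rule_format, of 0] by eventually_elim simp
  ultimately have x: "x \<longlonglongrightarrow> 0"
    by (simp add: Lim_transform_eventually)
  have "(\<lambda>k. m k * (exp (x k) - 1) - m k * x k) \<longlonglongrightarrow> 0"
  proof (rule Lim_null_comparison)
    show "\<forall>\<^sub>F k in sequentially. norm (m k * (exp (x k) - 1) - m k * x k) \<le> \<bar>m k * x k\<bar> * \<bar>x k\<bar> * exp \<bar>x k\<bar>"
    proof (intro always_eventually allI)
      fix k
      have "\<bar>exp (x k) - 1 - x k\<bar> = \<bar>exp (x k) - (1 + x k)\<bar>" by (simp add: algebra_simps)
      then have "\<bar>exp (x k) - 1 - x k\<bar> \<le> exp \<bar>x k\<bar> * (\<bar>x k\<bar> * \<bar>x k\<bar>)"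
        using Taylor_exp_field[of "x k" 1] by simp
      from mult_left_mono[OF this, of "\<bar>m k\<bar>"]
      show "norm (m k * (exp (x k) - 1) - m k * x k) \<le> \<bar>m k * x k\<bar> * \<bar>x k\<bar> * exp \<bar>x k\<bar>"
        by (simp add: abs_mult[symmetric] right_diff_distrib) (simp add: abs_mult mult_ac)
    qed
    have "(\<lambda>k. \<bar>m k * x k\<bar> * \<bar>x k\<bar> * exp \<bar>x k\<bar>) \<longlonglongrightarrow> \<bar>c\<bar> * \<bar>0\<bar> * exp \<bar>0\<bar>"
      by (intro tendsto_intros assms x)
    then show "(\<lambda>k. \<bar>m k * x k\<bar> * \<bar>x k\<bar> * exp \<bar>x k\<bar>) \<longlonglongrightarrow> 0" by simp
  qed
  from tendsto_add[OF this assms(1)] show ?thesis by simp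
qed

text \<open>The family indexed by the natural parameter. This is the convenient index for changes of measure; the law with
  mean parameter \<open>\<theta>\<close> is \<open>natural_law\<close> at \<open>natural_param b \<Psi> \<theta>\<close>.\<close>

definition natural_law :: "real measure \<Rightarrow> (real \<Rightarrow> real) \<Rightarrow> (real \<Rightarrow> real) \<Rightarrow> real \<Rightarrow> real measure" where
  "natural_law \<nu> a b \<psi> = distr (density \<nu> (\<lambda>x. ennreal (nef_density a b \<psi> x))) borel (\<lambda>x. x)"

locale nef =
  fixes \<nu> a b \<Psi>
  assumes nef: "natural_exponential_family \<nu> a b \<Psi>"
begin

abbreviation "law \<equiv> natural_law \<nu> a b"
abbreviation "mean \<equiv> deriv b"
abbreviation "var \<equiv> deriv (deriv b)"

lemma open_Psi: "open \<Psi>" and interval_Psi: "is_interval \<Psi>"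
  and a_measurable [measurable]: "a \<in> borel_measurable \<nu>" and a_nonneg: "0 \<le> a x"
  and total_mass: "\<psi> \<in> \<Psi> \<Longrightarrow> (\<integral>\<^sup>+x. ennreal (nef_density a b \<psi> x) \<partial>\<nu>) = 1"
  and DERIV_b: "\<psi> \<in> \<Psi> \<Longrightarrow> (b has_real_derivative mean \<psi>) (at \<psi>)"
  and DERIV_mean: "\<psi> \<in> \<Psi> \<Longrightarrow> (mean has_real_derivative var \<psi>) (at \<psi>)"
  and cont_var: "continuous_on \<Psi> var" and var_pos: "\<psi> \<in> \<Psi> \<Longrightarrow> 0 < var \<psi>"
  using nef unfolding natural_exponential_family_def by auto

lemma id_measurable: "(\<lambda>x. x) \<in> borel_measurable \<nu>"
  using nef unfolding natural_exponential_family_def by auto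

lemma nef_density_measurable [measurable]: "nef_density a b \<psi> \<in> borel_measurable \<nu>"
  using id_measurable unfolding nef_density_def by measurable

lemma sets_law [measurable_cong, simp]: "sets (law \<psi>) = sets borel"
  and space_law [simp]: "space (law \<psi>) = UNIV"
  by (simp_all add: natural_law_def)

lemma borel_measurable_law [simp]: "borel_measurable (law \<psi>) = borel_measurable borel"
  by (rule measurable_cong_sets) simp_all

lemma nn_integral_law:
  assumes [measurable]: "f \<in> borel_measurable borel"
  shows "(\<integral>\<^sup>+x. f x \<partial>law \<psi>) = (\<integral>\<^sup>+x. ennreal (nef_density a b \<psi> x) * f x \<partial>\<nu>)"
proof -
  have [measurable]: "f \<in> borel_measurable \<nu>"
    using measurable_compose[OF id_measurable assms] by simp
  note [measurable] = id_measurable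
  show ?thesis
    unfolding natural_law_def by (subst nn_integral_distr) (simp_all add: nn_integral_density)
qed

lemma nef_density_tilt:
  "nef_density a b \<psi>' x = nef_density a b \<psi> x * exp ((\<psi>' - \<psi>) * x - (b \<psi>' - b \<psi>))"
proof -
  have "exp (\<psi>' * x - b \<psi>') = exp (\<psi> * x - b \<psi>) * exp ((\<psi>' - \<psi>) * x - (b \<psi>' - b \<psi>))"
    unfolding exp_add[symmetric] by (simp add: algebra_simps)
  then show ?thesis by (simp add: nef_density_def)
qed

lemma nef_density_nonneg: "0 \<le> nef_density a b \<psi> x"
  by (simp add: nef_density_def a_nonneg)

text \<open>Two members of the family differ by an exponential tilt. Both the moment generating function and the
  measurability of bootstrap probabilities in the parameters come from this.\<close>

lemma law_tilt:
  "law \<psi>' = density (law \<psi>) (\<lambda>x. ennreal (exp ((\<psi>' - \<psi>) * x - (b \<psi>' - b \<psi>))))"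
proof (rule measure_eqI)
  fix A assume "A \<in> sets (law \<psi>')"
  then have [measurable]: "A \<in> sets borel" by simp
  have "emeasure (law \<psi>') A = (\<integral>\<^sup>+x. indicator A x \<partial>law \<psi>')" by simp
  also have "\<dots> = (\<integral>\<^sup>+x. ennreal (nef_density a b \<psi> x) *
      (ennreal (exp ((\<psi>' - \<psi>) * x - (b \<psi>' - b \<psi>))) * indicator A x) \<partial>\<nu>)"
    by (subst nn_integral_law, simp, subst nef_density_tilt[of _ _ \<psi>])
       (simp add: ennreal_mult nef_density_nonneg mult_ac)
  also have "\<dots> = emeasure (density (law \<psi>) (\<lambda>x. ennreal (exp ((\<psi>' - \<psi>) * x - (b \<psi>' - b \<psi>))))) A"
    by (subst emeasure_density) (simp_all add: nn_integral_law)
  finally show "emeasure (law \<psi>') A = \<dots>" .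
qed simp

lemma real_distribution_law: "\<psi> \<in> \<Psi> \<Longrightarrow> real_distribution (law \<psi>)"
proof -
  assume "\<psi> \<in> \<Psi>"
  then have "emeasure (law \<psi>) UNIV = 1"
    using nn_integral_law[of "\<lambda>_. 1" \<psi>] by (simp add: total_mass)
  then interpret prob_space "law \<psi>" by (intro prob_spaceI) simp
  show ?thesis by unfold_locales (simp_all)
qed

text \<open>Tilting by \<open>t\<close> again gives a member of the family, and its density integrates to one.\<close>

lemma mgf_law:
  assumes "\<psi> \<in> \<Psi>" "\<psi> + t \<in> \<Psi>"
  shows "integrable (law \<psi>) (\<lambda>x. exp (t * (x - c)))"
    and "(\<integral>x. exp (t * (x - c)) \<partial>law \<psi>) = exp (b (\<psi> + t) - b \<psi> - t * c)"
proof -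
  have "(\<integral>\<^sup>+x. ennreal (exp (t * (x - c))) \<partial>law \<psi>)
      = (\<integral>\<^sup>+x. ennreal (exp (b (\<psi> + t) - b \<psi> - t * c)) * ennreal (nef_density a b (\<psi> + t) x) \<partial>\<nu>)"
    by (subst nn_integral_law, simp, intro nn_integral_cong, subst nef_density_tilt[of "\<psi> + t" _ \<psi>])
       (simp add: ennreal_mult[symmetric] nef_density_nonneg mult_exp_exp algebra_simps exp_diff[symmetric])
  also have "\<dots> = ennreal (exp (b (\<psi> + t) - b \<psi> - t * c))"
    using assms by (subst nn_integral_cmult) (simp_all add: total_mass)
  finally have *: "(\<integral>\<^sup>+x. ennreal (exp (t * (x - c))) \<partial>law \<psi>) = ennreal (exp (b (\<psi> + t) - b \<psi> - t * c))" .
  then show "integrable (law \<psi>) (\<lambda>x. exp (t * (x - c)))"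
    by (intro integrableI_nonneg) simp_all
  show "(\<integral>x. exp (t * (x - c)) \<partial>law \<psi>) = exp (b (\<psi> + t) - b \<psi> - t * c)"
    using * by (subst integral_eq_nn_integral) simp_all
qed

text \<open>Integrates the two elementary estimates; here \<open>m s\<close> is the moment generating function of the law
  centred at \<open>c\<close>.\<close>

lemma char_centered_approx:
  fixes c \<psi> \<epsilon> t :: real
  assumes \<psi>: "\<psi> \<in> \<Psi>" and \<epsilon>: "0 < \<epsilon>" "\<psi> + \<epsilon> \<in> \<Psi>" "\<psi> - \<epsilon> \<in> \<Psi>" and t: "\<bar>t\<bar> \<le> \<epsilon> / 2"
  defines "m \<equiv> \<lambda>s. exp (b (\<psi> + s) - b \<psi> - s * c)"
  shows "cmod ((CLINT x|law \<psi>. iexp (t * (x - c)))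
      - (2 + (complex_of_real (m t) * (\<i> - 1) - complex_of_real (m (- t)) * (1 + \<i>)) / 2))
    \<le> 96 / \<epsilon> ^ 3 * \<bar>t\<bar> ^ 3 * (m \<epsilon> + m (- \<epsilon>))"
proof -
  let ?m = "2 + (complex_of_real (m t) * (\<i> - 1) - complex_of_real (m (- t)) * (1 + \<i>)) / 2"
  interpret real_distribution "law \<psi>" by (rule real_distribution_law[OF \<psi>])
  have mem: "\<psi> + s \<in> \<Psi>" if "\<bar>s\<bar> \<le> \<epsilon>" for s
  proof -
    have "\<psi> - \<epsilon> \<le> \<psi> + s" "\<psi> + s \<le> \<psi> + \<epsilon>" using that by linarith+
    with interval_Psi \<epsilon> show ?thesis unfolding is_interval_1 by blast
  qed
  have int: "integrable (law \<psi>) (\<lambda>x. exp (s * (x - c)))" "(\<integral>x. exp (s * (x - c)) \<partial>law \<psi>) = m s"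
    if "\<bar>s\<bar> \<le> \<epsilon>" for s
    using mgf_law[OF \<psi> mem[OF that], of c] by (simp_all add: m_def)
  have t': "\<bar>t\<bar> \<le> \<epsilon>" "\<bar>- t\<bar> \<le> \<epsilon>" and e': "\<bar>\<epsilon>\<bar> \<le> \<epsilon>" "\<bar>- \<epsilon>\<bar> \<le> \<epsilon>" using t \<epsilon> by auto
  define w where "w = (\<lambda>x. 2 + (complex_of_real (exp (t * (x - c))) * (\<i> - 1) - complex_of_real (exp (- t * (x - c))) * (1 + \<i>)) / 2)"
  have intw: "complex_integrable (law \<psi>) w"
    unfolding w_def using int(1)[OF t'(1)] int(1)[OF t'(2)]
    by (intro Bochner_Integration.integrable_add Bochner_Integration.integrable_diff
        integrable_divide integrable_mult_left integrable_of_real) auto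
  have inti: "complex_integrable (law \<psi>) (\<lambda>x. iexp (t * (x - c)))"
    by (rule integrable_iexp) auto
  define G where "G = (\<lambda>x. 96 / \<epsilon> ^ 3 * \<bar>t\<bar> ^ 3 * (exp (\<epsilon> * (x - c)) + exp (- \<epsilon> * (x - c))))"
  have intd: "integrable (law \<psi>) (\<lambda>x. cmod (iexp (t * (x - c)) - w x))"
    by (rule integrable_norm[OF Bochner_Integration.integrable_diff[OF inti intw]])
  have intG: "integrable (law \<psi>) G"
    unfolding G_def using int(1)[OF e'(1)] int(1)[OF e'(2)]
    by (intro integrable_mult_right Bochner_Integration.integrable_add)
  have dom: "cmod (iexp (t * (x - c)) - w x) \<le> G x" for x
  proof -
    have "cmod (iexp (t * (x - c)) - w x) \<le> 2 * (\<bar>t * (x - c)\<bar> ^ 3 * exp \<bar>t * (x - c)\<bar>)"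
      using iexp_hyperbolic_approx[of "t * (x - c)"] unfolding w_def by (simp only: mult_minus_left mult.assoc)
    also have "\<dots> \<le> 2 * (48 / \<epsilon> ^ 3 * \<bar>t\<bar> ^ 3 * (exp (\<epsilon> * (x - c)) + exp (- (\<epsilon> * (x - c)))))"
      using cube_exp_le_two_sided_exp[OF \<epsilon>(1) t, of "x - c"] by (rule mult_left_mono) simp
    also have "\<dots> = G x" unfolding G_def by simp
    finally show ?thesis .
  qed
  have "(CLINT x|law \<psi>. w x) = ?m"
    unfolding w_def using int[OF t'(1)] int[OF t'(2)] prob_space by (simp del: of_real_exp)
  then have "(CLINT x|law \<psi>. iexp (t * (x - c)))
      - ?m
      = (CLINT x|law \<psi>. iexp (t * (x - c)) - w x)"
    using inti intw by (simp only: Bochner_Integration.integral_diff)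
  also have "cmod \<dots> \<le> (\<integral>x. cmod (iexp (t * (x - c)) - w x) \<partial>law \<psi>)"
    by (rule integral_norm_bound)
  also have "\<dots> \<le> (\<integral>x. G x \<partial>law \<psi>)"
    by (rule integral_mono[OF intd intG dom])
  also have "\<dots> = 96 / \<epsilon> ^ 3 * \<bar>t\<bar> ^ 3 * (m \<epsilon> + m (- \<epsilon>))"
    unfolding G_def using int[OF e'(1)] int[OF e'(2)] by simp
  finally show ?thesis .
qed
end

section \<open>The central limit theorem along a sequence of parameters\<close>

abbreviation std_mean :: "nat \<Rightarrow> real \<Rightarrow> real \<Rightarrow> (nat \<Rightarrow> real) \<Rightarrow> real" where
  "std_mean m \<theta> \<sigma> x \<equiv> (sqrt (real m) * (sample_mean m x - \<theta>)) / \<sigma>"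

text \<open>Both the data and the bootstrap samples enter only through their sample means. The scale \<open>\<sigma>\<close> is
  fixed rather than the standard deviation of \<open>D\<close>, because in the applications the parameters vary
  while \<open>\<sigma>\<close> is the limiting standard deviation.\<close>

definition std_mean_law :: "real measure \<Rightarrow> real \<Rightarrow> real \<Rightarrow> nat \<Rightarrow> real measure" where
  "std_mean_law D \<theta> \<sigma> m =
     distr (PiM {1..m} (\<lambda>_. D)) borel (\<lambda>x. std_mean m \<theta> \<sigma> x)"

lemma sample_mean_measurable [measurable]:
  assumes "sets D = sets borel"
  shows "sample_mean m \<in> borel_measurable (PiM {1..m} (\<lambda>_. D))"
proof -
  have "(\<lambda>x. x j) \<in> borel_measurable (PiM {1..m} (\<lambda>_. D))" if "j \<in> {1..m}" for j
    using measurable_component_singleton[OF that, of "\<lambda>_. D"] measurable_cong_sets[OF refl assms] by blast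
  then show ?thesis unfolding sample_mean_def by measurable
qed

lemma real_distribution_std_mean_law:
  assumes "real_distribution D"
  shows "real_distribution (std_mean_law D \<theta> \<sigma> m)"
proof -
  interpret D: real_distribution D by fact
  interpret prob_space "PiM {1..m} (\<lambda>_. D)" by (rule prob_space_PiM) unfold_locales
  show ?thesis unfolding std_mean_law_def
    by (rule real_distribution_distr) (use D.events_eq_borel in measurable)
qed

lemma char_std_mean_law:
  assumes "real_distribution D" "0 < m"
  shows "char (std_mean_law D \<theta> \<sigma> m) t
    = (CLINT x|D. iexp (t / (sqrt (real m) * \<sigma>) * (x - \<theta>))) ^ m"
proof -
  interpret D: real_distribution D by fact
  interpret P: product_sigma_finite "\<lambda>_::nat. D" by unfold_locales
  have [measurable_cong]: "sets D = sets borel" by (rule D.events_eq_borel)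
  define s where "s = t / (sqrt (real m) * \<sigma>)"
  have "char (std_mean_law D \<theta> \<sigma> m) t
      = (CLINT x|PiM {1..m} (\<lambda>_. D). iexp (t * (std_mean m \<theta> \<sigma> x)))"
    unfolding char_def std_mean_law_def
    by (subst integral_distr) (use sample_mean_measurable[OF D.events_eq_borel] in measurable)
  also have "\<dots> = (CLINT x|PiM {1..m} (\<lambda>_. D). (\<Prod>j\<in>{1..m}. iexp (s * (x j - \<theta>))))"
  proof (rule Bochner_Integration.integral_cong[OF refl])
    fix x :: "nat \<Rightarrow> real"
    have "t * (std_mean m \<theta> \<sigma> x) = s * real m * (sample_mean m x - \<theta>)"
      using assms(2) real_sqrt_mult_self[of "real m"] by (simp add: s_def divide_simps)
    also have "\<dots> = s * ((\<Sum>j=1..m. x j) - real m * \<theta>)"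
      using assms(2) by (simp add: sample_mean_def field_simps)
    also have "\<dots> = (\<Sum>j=1..m. s * (x j - \<theta>))"
      by (simp add: sum_distrib_left[symmetric] sum_subtractf)
    finally have "t * (std_mean m \<theta> \<sigma> x) = (\<Sum>j=1..m. s * (x j - \<theta>))" .
    then show "iexp (t * (std_mean m \<theta> \<sigma> x)) = (\<Prod>j\<in>{1..m}. iexp (s * (x j - \<theta>)))"
      by (simp only: of_real_sum sum_distrib_left exp_sum finite_atLeastAtMost)
  qed
  also have "\<dots> = (\<Prod>j\<in>{1..m}. (CLINT x|D. iexp (s * (x - \<theta>))))"
    by (rule P.product_integral_prod, simp, rule D.integrable_iexp) simp_all
  finally show ?thesis by (simp add: s_def)
qed

context nef
begin

lemma mean_strict_mono:
  assumes "\<psi> \<in> \<Psi>" "\<psi>' \<in> \<Psi>" "\<psi> < \<psi>'"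
  shows "mean \<psi> < mean \<psi>'"
proof (rule DERIV_pos_imp_increasing[OF assms(3)])
  fix x assume "\<psi> \<le> x" "x \<le> \<psi>'"
  then have "x \<in> \<Psi>" using interval_Psi assms(1,2) unfolding is_interval_1 by blast
  then show "\<exists>y. (mean has_real_derivative y) (at x) \<and> 0 < y"
    using DERIV_mean var_pos by (intro exI[of _ "var x"]) simp
qed

lemma inj_on_mean: "inj_on mean \<Psi>"
proof (rule inj_onI, rule ccontr)
  fix x y assume *: "x \<in> \<Psi>" "y \<in> \<Psi>" "mean x = mean y" "x \<noteq> y"
  then consider "x < y" | "y < x" by (rule_tac linorder_cases[of x y]) auto
  then show False
    using mean_strict_mono[of x y] mean_strict_mono[of y x] * by cases auto
qed

lemma continuous_on_mean: "continuous_on \<Psi> mean"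
  using DERIV_isCont[OF DERIV_mean] by (intro continuous_at_imp_continuous_on) simp

lemma open_mean_range: "open (mean_range b \<Psi>)"
  unfolding mean_range_def by (rule invariance_of_domain[OF continuous_on_mean open_Psi inj_on_mean])

lemma natural_param_mean [simp]: "\<psi> \<in> \<Psi> \<Longrightarrow> natural_param b \<Psi> (mean \<psi>) = \<psi>"
  unfolding natural_param_def by (rule inv_into_f_f[OF inj_on_mean])

lemma natural_param_mem: "\<theta> \<in> mean_range b \<Psi> \<Longrightarrow> natural_param b \<Psi> \<theta> \<in> \<Psi>"
  unfolding natural_param_def mean_range_def by (rule inv_into_into)

lemma mean_natural_param [simp]: "\<theta> \<in> mean_range b \<Psi> \<Longrightarrow> mean (natural_param b \<Psi> \<theta>) = \<theta>"
  unfolding natural_param_def mean_range_def by (rule f_inv_into_f)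

lemma continuous_on_natural_param: "continuous_on (mean_range b \<Psi>) (natural_param b \<Psi>)"
  unfolding mean_range_def
  by (rule continuous_on_inverse_open[OF open_Psi continuous_on_mean]) simp_all

lemma cumulant_Taylor:
  assumes "\<psi> \<in> \<Psi>" "\<psi> + t \<in> \<Psi>"
  shows "\<exists>\<xi>\<in>\<Psi>. \<bar>\<xi> - \<psi>\<bar> \<le> \<bar>t\<bar> \<and> b (\<psi> + t) - b \<psi> - t * mean \<psi> = var \<xi> * t\<^sup>2 / 2"
proof (cases "t = 0")
  case False
  define d where "d = (\<lambda>n::nat. if n = 0 then b else if n = 1 then mean else var)"
  define l u where "l = min \<psi> (\<psi> + t)" and "u = max \<psi> (\<psi> + t)"
  have mem: "\<xi> \<in> \<Psi>" if "l \<le> \<xi>" "\<xi> \<le> u" for \<xi>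
  proof -
    have "l \<in> \<Psi>" "u \<in> \<Psi>" using assms by (auto simp: l_def u_def min_def max_def)
    with interval_Psi that show ?thesis unfolding is_interval_1 by blast
  qed
  have "\<exists>\<xi>. (if \<psi> + t < \<psi> then \<psi> + t < \<xi> \<and> \<xi> < \<psi> else \<psi> < \<xi> \<and> \<xi> < \<psi> + t) \<and>
      b (\<psi> + t) = (\<Sum>k<2. d k \<psi> / fact k * (\<psi> + t - \<psi>) ^ k) + d 2 \<xi> / fact 2 * (\<psi> + t - \<psi>) ^ 2"
  proof (rule Taylor)
    show "\<forall>m s. m < 2 \<and> l \<le> s \<and> s \<le> u \<longrightarrow> (d m has_real_derivative d (Suc m) s) (at s)"
      using mem DERIV_b DERIV_mean by (auto simp: d_def less_2_cases_iff)
  qed (use False in \<open>auto simp: d_def l_def u_def\<close>)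
  then obtain \<xi> where \<xi>: "if \<psi> + t < \<psi> then \<psi> + t < \<xi> \<and> \<xi> < \<psi> else \<psi> < \<xi> \<and> \<xi> < \<psi> + t"
    "b (\<psi> + t) = b \<psi> + mean \<psi> * t + var \<xi> / 2 * t\<^sup>2"
    by (auto simp: d_def lessThan_nat_numeral eval_nat_numeral)
  then have "\<xi> \<in> \<Psi>" by (intro mem) (auto simp: l_def u_def split: if_splits)
  then show ?thesis using \<xi> by (intro bexI[of _ \<xi>]) (auto split: if_splits simp: mult.commute)
qed (use assms in auto)

text \<open>The Taylor formula for \<open>b\<close> with a remainder in \<open>b''\<close>, which is continuous at
  \<open>\<psi>0\<close>, gives \<open>m \<cdot> (exp L - 1) \<longlongrightarrow> t\<^sup>2 / 2\<close> for the cumulants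
  \<open>L\<close> at \<open>s\<close> and \<open>- s\<close>, where \<open>s = t / (sqrt m \<sigma>)\<close>. In the approximation
  of the characteristic function the imaginary parts cancel and the error is of order
  \<open>m \<bar>s\<bar>\<^sup>3 \<longlongrightarrow> 0\<close>.\<close>

lemma char_centered_tendsto:
  fixes m :: "nat \<Rightarrow> nat"
  assumes \<psi>: "\<And>k. \<psi> k \<in> \<Psi>" "\<psi> \<longlonglongrightarrow> \<psi>0" "\<psi>0 \<in> \<Psi>"
    and m: "filterlim m at_top sequentially" and \<sigma>: "0 < \<sigma>" "\<sigma>\<^sup>2 = var \<psi>0"
  shows "(\<lambda>k. of_nat (m k) * ((CLINT x|law (\<psi> k). iexp (t / (sqrt (real (m k)) * \<sigma>) * (x - mean (\<psi> k)))) - 1))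
    \<longlonglongrightarrow> complex_of_real (- t\<^sup>2 / 2)"
proof -
  define s where "s = (\<lambda>k. t / (sqrt (real (m k)) * \<sigma>))"
  define L where "L = (\<lambda>k r. b (\<psi> k + r) - b (\<psi> k) - r * mean (\<psi> k))"
  define W where "W = (\<lambda>k. 2 + (complex_of_real (exp (L k (s k))) * (\<i> - 1) - complex_of_real (exp (L k (- s k))) * (1 + \<i>)) / 2)"
  define \<phi> where "\<phi> = (\<lambda>k. CLINT x|law (\<psi> k). iexp (s k * (x - mean (\<psi> k))))"
  have rm: "filterlim (\<lambda>k. real (m k)) at_top sequentially"
    by (rule filterlim_compose[OF filterlim_real_sequentially m])
  have m_pos: "\<forall>\<^sub>F k in sequentially. 0 < m k"
    by (rule eventually_compose_filterlim[OF eventually_gt_at_top m])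
  have s0: "s \<longlonglongrightarrow> 0"
    unfolding s_def
    by (intro tendsto_divide_0[OF tendsto_const] filterlim_at_top_imp_at_infinity
        filterlim_at_top_mult_tendsto_pos[OF tendsto_const \<sigma>(1)] filterlim_compose[OF sqrt_at_top rm])
  have ms: "\<forall>\<^sub>F k in sequentially. real (m k) * (s k)\<^sup>2 = t\<^sup>2 / \<sigma>\<^sup>2"
    using m_pos by eventually_elim (simp add: s_def power_divide power_mult_distrib)
  obtain e0 where e0: "0 < e0" "cball \<psi>0 e0 \<subseteq> \<Psi>"
    using open_Psi \<psi>(3) open_contains_cball by blast
  \<comment> \<open>half the radius, so that \<open>\<psi> k\<close> can be moved by \<open>\<epsilon>\<close> without leaving \<open>\<Psi>\<close>\<close>
  define \<epsilon> where "\<epsilon> = e0 / 2"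
  have \<epsilon>: "0 < \<epsilon>" using e0 by (simp add: \<epsilon>_def)
  have near: "\<forall>\<^sub>F k in sequentially. \<bar>\<psi> k - \<psi>0\<bar> < \<epsilon>"
    using tendstoD[OF \<psi>(2) \<epsilon>] by (simp add: dist_real_def)
  have mem: "\<psi> k + r \<in> \<Psi>" if "\<bar>\<psi> k - \<psi>0\<bar> < \<epsilon>" "\<bar>r\<bar> \<le> \<epsilon>" for k r
  proof -
    have "\<psi> k + r \<in> cball \<psi>0 e0" using that unfolding mem_cball dist_real_def \<epsilon>_def by linarith
    with e0 show ?thesis by blast
  qed
  have mL: "(\<lambda>k. real (m k) * (exp (L k (r k)) - 1)) \<longlonglongrightarrow> t\<^sup>2 / 2"
    if r: "r \<longlonglongrightarrow> 0" "\<And>k. (r k)\<^sup>2 = (s k)\<^sup>2" for r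
  proof (rule tendsto_mult_exp_minus_one[OF _ rm])
    \<comment> \<open>the intermediate point of the Taylor remainder; it exists once the argument has entered \<open>\<Psi>\<close>\<close>
    define \<xi> where "\<xi> = (\<lambda>k. SOME x. x \<in> \<Psi> \<and> \<bar>x - \<psi> k\<bar> \<le> \<bar>r k\<bar> \<and> L k (r k) = var x * (r k)\<^sup>2 / 2)"
    have "\<forall>\<^sub>F k in sequentially. \<bar>r k\<bar> < \<epsilon>"
      using tendstoD[OF r(1) \<epsilon>] by simp
    with near have ev: "\<forall>\<^sub>F k in sequentially. \<xi> k \<in> \<Psi> \<and> \<bar>\<xi> k - \<psi> k\<bar> \<le> \<bar>r k\<bar> \<and> L k (r k) = var (\<xi> k) * (r k)\<^sup>2 / 2"
    proof eventually_elim
      case (elim k)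
      then have "\<psi> k + r k \<in> \<Psi>" by (intro mem) auto
      from cumulant_Taylor[OF \<psi>(1) this] show ?case
        unfolding \<xi>_def L_def by (intro someI_ex[of "\<lambda>x. x \<in> \<Psi> \<and> _ x"]) blast
    qed
    have "(\<lambda>k. \<xi> k - \<psi> k) \<longlonglongrightarrow> 0"
      by (rule Lim_null_comparison[OF _ tendsto_rabs_zero[OF r(1)]]) (use ev in \<open>auto elim: eventually_mono\<close>)
    from tendsto_add[OF this \<psi>(2)] have "\<xi> \<longlonglongrightarrow> \<psi>0" by simp
    moreover have "isCont var \<psi>0"
      using cont_var open_Psi \<psi>(3) by (simp add: continuous_on_eq_continuous_at)
    ultimately have "(\<lambda>k. var (\<xi> k)) \<longlonglongrightarrow> var \<psi>0" by (rule isCont_tendsto_compose[rotated])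
    then have "(\<lambda>k. var (\<xi> k) * (t\<^sup>2 / \<sigma>\<^sup>2) / 2) \<longlonglongrightarrow> var \<psi>0 * (t\<^sup>2 / \<sigma>\<^sup>2) / 2"
      by (intro tendsto_intros) simp_all
    also have "var \<psi>0 * (t\<^sup>2 / \<sigma>\<^sup>2) / 2 = t\<^sup>2 / 2"
      using \<sigma> by (simp flip: \<sigma>(2))
    finally show "(\<lambda>k. real (m k) * L k (r k)) \<longlonglongrightarrow> t\<^sup>2 / 2"
    proof (rule Lim_transform_eventually)
      show "\<forall>\<^sub>F k in sequentially. var (\<xi> k) * (t\<^sup>2 / \<sigma>\<^sup>2) / 2 = real (m k) * L k (r k)"
        using ev ms
      proof eventually_elim
        case (elim k)
        then have "real (m k) * L k (r k) = real (m k) * (var (\<xi> k) * (s k)\<^sup>2 / 2)" by (simp only: r(2))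
        also have "\<dots> = var (\<xi> k) * (real (m k) * (s k)\<^sup>2) / 2" by simp
        also have "\<dots> = var (\<xi> k) * (t\<^sup>2 / \<sigma>\<^sup>2) / 2" by (simp only: elim(2))
        finally show ?case by (rule sym)
      qed
    qed
  qed
  have W: "(\<lambda>k. of_nat (m k) * (W k - 1)) \<longlonglongrightarrow> complex_of_real (- t\<^sup>2 / 2)"
  proof -
    have "(\<lambda>k. (complex_of_real (real (m k) * (exp (L k (s k)) - 1)) * (\<i> - 1)
        - complex_of_real (real (m k) * (exp (L k (- s k)) - 1)) * (1 + \<i>)) / 2)
      \<longlonglongrightarrow> (complex_of_real (t\<^sup>2 / 2) * (\<i> - 1) - complex_of_real (t\<^sup>2 / 2) * (1 + \<i>)) / 2"
      by (intro tendsto_intros mL s0 tendsto_minus_cancel_left[THEN iffD1]) (simp_all add: s0 tendsto_minus_cancel_left)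
    also have "(\<lambda>k. (complex_of_real (real (m k) * (exp (L k (s k)) - 1)) * (\<i> - 1)
        - complex_of_real (real (m k) * (exp (L k (- s k)) - 1)) * (1 + \<i>)) / 2) = (\<lambda>k. of_nat (m k) * (W k - 1))"
      by (simp add: fun_eq_iff W_def field_simps del: of_real_exp)
    also have "(complex_of_real (t\<^sup>2 / 2) * (\<i> - 1) - complex_of_real (t\<^sup>2 / 2) * (1 + \<i>)) / 2 = complex_of_real (- t\<^sup>2 / 2)"
      by (simp add: field_simps)
    finally show ?thesis .
  qed
  have "(\<lambda>k. of_nat (m k) * (\<phi> k - 1) - of_nat (m k) * (W k - 1)) \<longlonglongrightarrow> 0"
  proof (rule Lim_null_comparison)
    have "\<forall>\<^sub>F k in sequentially. \<bar>s k\<bar> < \<epsilon> / 2"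
      using tendstoD[OF s0, of "\<epsilon> / 2"] \<epsilon> by simp
    with near ms show "\<forall>\<^sub>F k in sequentially. norm (of_nat (m k) * (\<phi> k - 1) - of_nat (m k) * (W k - 1))
        \<le> 96 / \<epsilon> ^ 3 * (t\<^sup>2 / \<sigma>\<^sup>2 * \<bar>s k\<bar>) * (exp (L k \<epsilon>) + exp (L k (- \<epsilon>)))"
    proof eventually_elim
      case (elim k)
      have "cmod (\<phi> k - W k) \<le> 96 / \<epsilon> ^ 3 * \<bar>s k\<bar> ^ 3 * (exp (L k \<epsilon>) + exp (L k (- \<epsilon>)))"
        using char_centered_approx[OF \<psi>(1) \<epsilon>, of k "s k" "mean (\<psi> k)"] elim mem[of k \<epsilon>] mem[of k "- \<epsilon>"] \<epsilon>
        by (simp add: \<phi>_def W_def L_def)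
      from mult_left_mono[OF this, of "real (m k)"]
      have "real (m k) * cmod (\<phi> k - W k) \<le> 96 / \<epsilon> ^ 3 * ((real (m k) * (s k)\<^sup>2) * \<bar>s k\<bar>) * (exp (L k \<epsilon>) + exp (L k (- \<epsilon>)))"
        by (simp add: power3_eq_cube power2_eq_square mult_ac)
      then show ?case
        by (simp add: elim norm_mult flip: right_diff_distrib)
    qed
    have isC: "isCont b \<psi>0" "isCont mean \<psi>0" "isCont b (\<psi>0 + \<epsilon>)" "isCont b (\<psi>0 - \<epsilon>)"
      using e0 \<psi>(3) \<epsilon> by (auto intro!: DERIV_isCont[OF DERIV_b] DERIV_isCont[OF DERIV_mean]
        simp: subset_iff dist_real_def \<epsilon>_def)
    have L: "(\<lambda>k. L k \<epsilon>) \<longlonglongrightarrow> b (\<psi>0 + \<epsilon>) - b \<psi>0 - \<epsilon> * mean \<psi>0"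
      "(\<lambda>k. L k (- \<epsilon>)) \<longlonglongrightarrow> b (\<psi>0 - \<epsilon>) - b \<psi>0 - (- \<epsilon>) * mean \<psi>0"
      unfolding L_def using isC
      by (auto intro!: tendsto_intros isCont_tendsto_compose[of _ b] isCont_tendsto_compose[of _ mean] \<psi>(2))
    have "(\<lambda>k. 96 / \<epsilon> ^ 3 * (t\<^sup>2 / \<sigma>\<^sup>2 * \<bar>s k\<bar>) * (exp (L k \<epsilon>) + exp (L k (- \<epsilon>)))) \<longlonglongrightarrow>
        96 / \<epsilon> ^ 3 * (t\<^sup>2 / \<sigma>\<^sup>2 * \<bar>0\<bar>) * (exp (b (\<psi>0 + \<epsilon>) - b \<psi>0 - \<epsilon> * mean \<psi>0) + exp (b (\<psi>0 - \<epsilon>) - b \<psi>0 - (- \<epsilon>) * mean \<psi>0))"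
      by (intro tendsto_mult tendsto_add tendsto_const tendsto_exp L tendsto_rabs s0)
    then show "(\<lambda>k. 96 / \<epsilon> ^ 3 * (t\<^sup>2 / \<sigma>\<^sup>2 * \<bar>s k\<bar>) * (exp (L k \<epsilon>) + exp (L k (- \<epsilon>)))) \<longlonglongrightarrow> 0"
      by simp
  qed
  from tendsto_add[OF this W] show ?thesis by (simp add: \<phi>_def s_def)
qed

text \<open>The central limit theorem with a parameter that moves with the sample size. It is used for the data, whose
  parameters approach \<open>\<eta>0\<close> at rate \<open>1 / sqrt n\<close>, and for the bootstrap samples, whose parameters
  are the estimates.\<close>

lemma std_mean_weak_conv:
  fixes m :: "nat \<Rightarrow> nat"
  assumes \<psi>: "\<And>k. \<psi> k \<in> \<Psi>" "\<psi> \<longlonglongrightarrow> \<psi>0" "\<psi>0 \<in> \<Psi>"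
    and m: "filterlim m at_top sequentially" and \<sigma>: "0 < \<sigma>" "\<sigma>\<^sup>2 = var \<psi>0"
  shows "weak_conv_m (\<lambda>k. std_mean_law (law (\<psi> k)) (mean (\<psi> k)) \<sigma> (m k)) std_normal_distribution"
proof (rule levy_continuity)
  let ?N = "\<lambda>k. std_mean_law (law (\<psi> k)) (mean (\<psi> k)) \<sigma> (m k)"
  show "real_distribution (?N k)" for k
    by (intro real_distribution_std_mean_law real_distribution_law \<psi>)
  fix t :: real
  define \<phi> where "\<phi> = (\<lambda>k. CLINT x|law (\<psi> k). iexp (t / (sqrt (real (m k)) * \<sigma>) * (x - mean (\<psi> k))))"
  define E where "E = (\<lambda>k. exp (- t\<^sup>2 / 2 / real (m k)))"
  have rm: "filterlim (\<lambda>k. real (m k)) at_top sequentially"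
    by (rule filterlim_compose[OF filterlim_real_sequentially m])
  have m_pos: "\<forall>\<^sub>F k in sequentially. 0 < m k"
    by (rule eventually_compose_filterlim[OF eventually_gt_at_top m])
  have "(\<lambda>k. - t\<^sup>2 / 2) \<longlonglongrightarrow> - t\<^sup>2 / 2" by simp
  then have "(\<lambda>k. real (m k) * (- t\<^sup>2 / 2 / real (m k))) \<longlonglongrightarrow> - t\<^sup>2 / 2"
  proof (rule Lim_transform_eventually)
    show "\<forall>\<^sub>F k in sequentially. - t\<^sup>2 / 2 = real (m k) * (- t\<^sup>2 / 2 / real (m k))"
      using m_pos by eventually_elim simp
  qed
  then have "(\<lambda>k. real (m k) * (E k - 1)) \<longlonglongrightarrow> - t\<^sup>2 / 2"
    unfolding E_def by (rule tendsto_mult_exp_minus_one[OF _ rm])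
  then have "(\<lambda>k. complex_of_real (real (m k) * (E k - 1))) \<longlonglongrightarrow> complex_of_real (- t\<^sup>2 / 2)"
    by (rule tendsto_of_real)
  from tendsto_diff[OF char_centered_tendsto[OF \<psi> m \<sigma>, of t] this]
  have diff: "(\<lambda>k. of_nat (m k) * (\<phi> k - complex_of_real (E k))) \<longlonglongrightarrow> 0"
    by (simp add: \<phi>_def algebra_simps)
  have "(\<lambda>k. char (?N k) t - complex_of_real (exp (- t\<^sup>2 / 2))) \<longlonglongrightarrow> 0"
  proof (rule Lim_null_comparison[OF _ tendsto_norm_zero[OF diff]])
    show "\<forall>\<^sub>F k in sequentially. norm (char (?N k) t - complex_of_real (exp (- t\<^sup>2 / 2)))
        \<le> norm (of_nat (m k) * (\<phi> k - complex_of_real (E k)))"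
      using m_pos
    proof eventually_elim
      case (elim k)
      interpret real_distribution "law (\<psi> k)" by (rule real_distribution_law[OF \<psi>(1)])
      have "char (?N k) t = \<phi> k ^ m k"
        unfolding \<phi>_def by (rule char_std_mean_law[OF real_distribution_law[OF \<psi>(1)] elim])
      moreover have "exp (- t\<^sup>2 / 2) = E k ^ m k"
        using elim by (simp add: E_def flip: exp_of_nat_mult)
      moreover have "norm (\<phi> k) \<le> 1"
      proof -
        have "norm (\<phi> k) \<le> (\<integral>x. norm (iexp (t / (sqrt (real (m k)) * \<sigma>) * (x - mean (\<psi> k)))) \<partial>law (\<psi> k))"
          unfolding \<phi>_def by (rule integral_norm_bound)
        also have "\<dots> = 1" using prob_space by simp
        finally show ?thesis .
      qed
      moreover have "norm (complex_of_real (E k)) \<le> 1"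
        by (simp add: E_def)
      ultimately show ?case
        using norm_power_diff[of "\<phi> k" "complex_of_real (E k)" "m k"] by (simp add: norm_mult)
    qed
  qed
  then show "(\<lambda>k. char (?N k) t) \<longlonglongrightarrow> char std_normal_distribution t"
    by (simp add: char_std_normal_distribution LIM_zero_cancel)
qed (rule real_dist_normal_dist)
end

section \<open>Laws of the two samples and their dependence on the parameters\<close>

lemma (in prob_space) distr_indep_vars_reindex:
  fixes X :: "'i \<Rightarrow> 'a \<Rightarrow> real"
  assumes ind: "indep_vars (\<lambda>_. borel) X K" and f: "inj_on f I" "f ` I \<subseteq> K" "I \<noteq> {}"
    and D: "\<And>i. i \<in> I \<Longrightarrow> distr M borel (X (f i)) = D"
  shows "distr M (PiM I (\<lambda>_. borel)) (\<lambda>w. \<lambda>i\<in>I. X (f i) w) = PiM I (\<lambda>_. D)"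
proof -
  have ind': "indep_vars (\<lambda>_. borel) X (f ` I)"
    using indep_vars_subset[OF ind f(2)] .
  then have rv: "X j \<in> borel_measurable M" if "j \<in> f ` I" for j
    using that unfolding indep_vars_def by auto
  have ne: "f ` I \<noteq> {}" using f(3) by simp
  have "PiM I (\<lambda>i. distr M borel (X (f i)))
      = distr (PiM (f ` I) (\<lambda>j. distr M borel (X j))) (PiM I (\<lambda>i. distr M borel (X (f i)))) (\<lambda>x. \<lambda>i\<in>I. x (f i))"
    by (rule distr_PiM_reindex[symmetric, OF _ f(1)]) (use rv in \<open>auto intro!: prob_space_distr\<close>)
  also have "\<dots> = distr (PiM (f ` I) (\<lambda>j. distr M borel (X j))) (PiM I (\<lambda>i. borel)) (\<lambda>x. \<lambda>i\<in>I. x (f i))"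
    by (rule distr_cong) (auto intro!: sets_PiM_cong)
  also have "PiM (f ` I) (\<lambda>j. distr M borel (X j)) = distr M (PiM (f ` I) (\<lambda>_. borel)) (\<lambda>w. \<lambda>j\<in>f ` I. X j w)"
    using indep_vars_iff_distr_eq_PiM'[OF ne, where M'="\<lambda>_. borel" and X=X] rv ind' by simp
  also have "distr (distr M (PiM (f ` I) (\<lambda>_. borel)) (\<lambda>w. \<lambda>j\<in>f ` I. X j w)) (PiM I (\<lambda>i. borel)) (\<lambda>x. \<lambda>i\<in>I. x (f i))
      = distr M (PiM I (\<lambda>_. borel)) ((\<lambda>x. \<lambda>i\<in>I. x (f i)) \<circ> (\<lambda>w. \<lambda>j\<in>f ` I. X j w))"
    by (rule distr_distr) (use rv in \<open>auto intro!: measurable_restrict measurable_component_singleton\<close>)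
  also have "(\<lambda>x. \<lambda>i\<in>I. x (f i)) \<circ> (\<lambda>w. \<lambda>j\<in>f ` I. X j w) = (\<lambda>w. \<lambda>i\<in>I. X (f i) w)"
    by (auto simp: fun_eq_iff restrict_def)
  also have "PiM I (\<lambda>i. distr M borel (X (f i))) = PiM I (\<lambda>_. D)"
    by (rule PiM_cong) (simp_all add: D)
  finally show ?thesis by (rule sym)
qed

lemma sample_mean_restrict [simp]: "sample_mean m (restrict x {Suc 0..m}) = sample_mean m x"
  unfolding sample_mean_def by (intro arg_cong2[of _ _ _ _ "(/)"] sum.cong) auto

text \<open>For the data, given only by independence and marginal laws on some probability space, the pair of standardised
  means has the product law. The companion \<open>product_std_mean_laws\<close> is the same statement on the product space
  on which the bootstrap distribution functions are defined; from here on both experiments are treated alike.\<close>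

lemma two_samples_std_mean_laws:
  assumes two: "two_samples P X1 X2 n1 n2 D1 D2" and n: "0 < n1" "0 < n2"
  shows "distr P borel2
      (\<lambda>w. (std_mean n1 \<theta>1 \<sigma> (\<lambda>j. X1 j w),
             std_mean n2 \<theta>2 \<sigma> (\<lambda>j. X2 j w)))
    = std_mean_law D1 \<theta>1 \<sigma> n1 \<Otimes>\<^sub>M std_mean_law D2 \<theta>2 \<sigma> n2" (is "?eq")
    and "(\<lambda>w. sample_mean n1 (\<lambda>j. X1 j w)) \<in> borel_measurable P" (is ?m1)
    and "(\<lambda>w. sample_mean n2 (\<lambda>j. X2 j w)) \<in> borel_measurable P" (is ?m2)
proof -
  interpret prob_space P using two by (simp add: two_samples_def)
  let ?X = "case_sum X1 X2" and ?I = "Inl ` {1..n1} :: (nat + nat) set" and ?J = "Inr ` {1..n2} :: (nat + nat) set"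
  have ind: "indep_vars (\<lambda>_. borel) ?X ({1..n1} <+> {1..n2})"
    and D: "\<And>j. j \<in> {1..n1} \<Longrightarrow> distr P borel (X1 j) = D1" "\<And>j. j \<in> {1..n2} \<Longrightarrow> distr P borel (X2 j) = D2"
    using two by (auto simp: two_samples_def)
  have rv: "?X j \<in> borel_measurable P" if "j \<in> {1..n1} <+> {1..n2}" for j
    using ind that unfolding indep_vars_def by blast
  have rv1: "X1 j \<in> borel_measurable P" if "j \<in> {1..n1}" for j using rv[of "Inl j"] that by (auto simp: Plus_def)
  have rv2: "X2 j \<in> borel_measurable P" if "j \<in> {1..n2}" for j using rv[of "Inr j"] that by (auto simp: Plus_def)
  show ?m1 ?m2
    unfolding sample_mean_def
    by (intro borel_measurable_divide borel_measurable_sum borel_measurable_const rv1 rv2; assumption)+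
  have sD: "sets D1 = sets borel" "sets D2 = sets borel"
    using D(1)[of 1] D(2)[of 1] n by (auto dest: arg_cong[of _ _ sets])
  let ?Y = "\<lambda>m \<theta> x. std_mean m \<theta> \<sigma> x"
  let ?G1 = "(?Y n1 \<theta>1 \<circ> (\<lambda>x. \<lambda>j\<in>{1..n1}. x (Inl j))) \<circ> (\<lambda>w. restrict (\<lambda>i. ?X i w) ?I)" and ?G2 = "(?Y n2 \<theta>2 \<circ> (\<lambda>x. \<lambda>j\<in>{1..n2}. x (Inr j))) \<circ> (\<lambda>w. restrict (\<lambda>i. ?X i w) ?J)"
  have Y [measurable]: "?Y m \<theta> \<in> borel_measurable (PiM {1..m} (\<lambda>_. borel))" for m and \<theta> :: real
    using sample_mean_measurable[OF refl, of m] by measurable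
  have "indep_var (PiM ?I (\<lambda>_. borel)) (\<lambda>w. restrict (\<lambda>i. ?X i w) ?I) (PiM ?J (\<lambda>_. borel)) (\<lambda>w. restrict (\<lambda>i. ?X i w) ?J)"
    by (rule indep_var_restrict[OF ind]) (auto simp: Plus_def)
  moreover have "(\<lambda>x. \<lambda>j\<in>{1..n1}. x (Inl j)) \<in> measurable (PiM ?I (\<lambda>_. borel)) (PiM {1..n1} (\<lambda>_. borel))"
    "(\<lambda>x. \<lambda>j\<in>{1..n2}. x (Inr j)) \<in> measurable (PiM ?J (\<lambda>_. borel)) (PiM {1..n2} (\<lambda>_. borel))"
    by (auto intro!: measurable_restrict measurable_component_singleton)
  ultimately have "indep_var borel ?G1
      borel ?G2"
    by (intro indep_var_compose measurable_comp[OF _ Y])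
  moreover have "?G1 = (\<lambda>w. ?Y n1 \<theta>1 (\<lambda>j. X1 j w))"
    "?G2 = (\<lambda>w. ?Y n2 \<theta>2 (\<lambda>j. X2 j w))"
    by (auto simp: fun_eq_iff sample_mean_def)
  ultimately have "indep_var borel (\<lambda>w. ?Y n1 \<theta>1 (\<lambda>j. X1 j w)) borel (\<lambda>w. ?Y n2 \<theta>2 (\<lambda>j. X2 j w))"
    by simp
  then have "distr P borel (\<lambda>w. ?Y n1 \<theta>1 (\<lambda>j. X1 j w)) \<Otimes>\<^sub>M distr P borel (\<lambda>w. ?Y n2 \<theta>2 (\<lambda>j. X2 j w))
      = distr P borel2 (\<lambda>w. (?Y n1 \<theta>1 (\<lambda>j. X1 j w), ?Y n2 \<theta>2 (\<lambda>j. X2 j w)))"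
    using indep_var_distribution_eq by blast
  moreover have "distr P borel (\<lambda>w. ?Y m \<theta> (\<lambda>j. ?X (f j) w)) = std_mean_law D \<theta> \<sigma> m"
    if f: "inj_on f {1..m}" "f ` {1..m} \<subseteq> {1..n1} <+> {1..n2}" "0 < m" "sets D = sets borel"
      and D: "\<And>j. j \<in> {1..m} \<Longrightarrow> distr P borel (?X (f j)) = D" for m \<theta> f D
  proof -
    have rvf: "(\<lambda>w. \<lambda>j\<in>{1..m}. ?X (f j) w) \<in> measurable P (PiM {1..m} (\<lambda>_. borel))"
      using rv f(2) by (intro measurable_restrict) blast
    have "std_mean_law D \<theta> \<sigma> m = distr (PiM {1..m} (\<lambda>_. D)) borel (?Y m \<theta>)"
      by (simp add: std_mean_law_def)
    also have "PiM {1..m} (\<lambda>_. D) = distr P (PiM {1..m} (\<lambda>_. borel)) (\<lambda>w. \<lambda>j\<in>{1..m}. ?X (f j) w)"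
      using f(3) by (intro distr_indep_vars_reindex[OF ind f(1,2) _ D, symmetric]) auto
    also have "distr \<dots> borel (?Y m \<theta>) = distr P borel (?Y m \<theta> \<circ> (\<lambda>w. \<lambda>j\<in>{1..m}. ?X (f j) w))"
      by (rule distr_distr[OF Y rvf])
    also have "?Y m \<theta> \<circ> (\<lambda>w. \<lambda>j\<in>{1..m}. ?X (f j) w) = (\<lambda>w. ?Y m \<theta> (\<lambda>j. ?X (f j) w))"
      by (simp add: fun_eq_iff)
    finally show ?thesis by simp
  qed
  from this[of Inl n1 D1 \<theta>1] this[of Inr n2 D2 \<theta>2]
  have "distr P borel (\<lambda>w. ?Y n1 \<theta>1 (\<lambda>j. X1 j w)) = std_mean_law D1 \<theta>1 \<sigma> n1"
    "distr P borel (\<lambda>w. ?Y n2 \<theta>2 (\<lambda>j. X2 j w)) = std_mean_law D2 \<theta>2 \<sigma> n2"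
    using D sD n by (auto simp: Plus_def)
  ultimately show ?eq by simp
qed

lemma product_std_mean_laws:
  assumes D: "real_distribution D1" "real_distribution D2"
  shows "distr (PiM {1..n1} (\<lambda>_. D1) \<Otimes>\<^sub>M PiM {1..n2} (\<lambda>_. D2)) borel2
      (\<lambda>(x1, x2). (std_mean n1 \<theta>1 \<sigma> x1,
             std_mean n2 \<theta>2 \<sigma> x2))
    = std_mean_law D1 \<theta>1 \<sigma> n1 \<Otimes>\<^sub>M std_mean_law D2 \<theta>2 \<sigma> n2"
proof -
  interpret D1: real_distribution D1 by fact
  interpret D2: real_distribution D2 by fact
  interpret L: real_distribution "std_mean_law D2 \<theta>2 \<sigma> n2" by (rule real_distribution_std_mean_law[OF D(2)])
  show ?thesis
    unfolding std_mean_law_def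
    by (rule pair_measure_distr[symmetric])
      (use sample_mean_measurable[OF D1.events_eq_borel, of n1] sample_mean_measurable[OF D2.events_eq_borel, of n2]
        L.sigma_finite_measure_axioms in \<open>simp_all add: std_mean_law_def\<close>)
qed

context nef
begin

text \<open>A measure on a finite product is determined by its values on rectangles, and over a rectangle the integral of a
  product density factorises.\<close>

lemma PiM_law_tilt:
  assumes "\<psi> \<in> \<Psi>" "\<psi>0 \<in> \<Psi>" "finite I"
  shows "PiM I (\<lambda>_. law \<psi>)
    = density (PiM I (\<lambda>_. law \<psi>0)) (\<lambda>x. \<Prod>i\<in>I. ennreal (exp ((\<psi> - \<psi>0) * x i - (b \<psi> - b \<psi>0))))"
proof -
  interpret L: real_distribution "law \<psi>" by (rule real_distribution_law) fact
  interpret L0: real_distribution "law \<psi>0" by (rule real_distribution_law) fact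
  interpret P: product_sigma_finite "\<lambda>_. law \<psi>" by unfold_locales
  interpret P0: product_sigma_finite "\<lambda>_. law \<psi>0" by unfold_locales
  let ?f = "\<lambda>x. ennreal (exp ((\<psi> - \<psi>0) * x - (b \<psi> - b \<psi>0)))"
  show ?thesis
  proof (rule P.PiM_eqI[symmetric])
    show "sets (density (PiM I (\<lambda>_. law \<psi>0)) (\<lambda>x. \<Prod>i\<in>I. ?f (x i))) = sets (PiM I (\<lambda>_. law \<psi>))"
      by (simp cong: sets_PiM_cong)
    fix A assume A: "\<And>i. i \<in> I \<Longrightarrow> A i \<in> sets (law \<psi>)"
    have "emeasure (density (PiM I (\<lambda>_. law \<psi>0)) (\<lambda>x. \<Prod>i\<in>I. ?f (x i))) (Pi\<^sub>E I A)
        = (\<integral>\<^sup>+x. (\<Prod>i\<in>I. ?f (x i)) * indicator (Pi\<^sub>E I A) x \<partial>PiM I (\<lambda>_. law \<psi>0))"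
    proof (rule emeasure_density)
      show "(\<lambda>x. \<Prod>i\<in>I. ?f (x i)) \<in> borel_measurable (PiM I (\<lambda>_. law \<psi>0))"
        by (intro borel_measurable_prod_ennreal measurable_compose[OF measurable_component_singleton]) simp_all
      show "Pi\<^sub>E I A \<in> sets (PiM I (\<lambda>_. law \<psi>0))"
        using A assms(3) by (intro sets_PiM_I_finite) simp_all
    qed
    also have "\<dots> = (\<integral>\<^sup>+x. (\<Prod>i\<in>I. ?f (x i) * indicator (A i) (x i)) \<partial>PiM I (\<lambda>_. law \<psi>0))"
    proof (rule nn_integral_cong)
      fix x assume "x \<in> space (PiM I (\<lambda>_. law \<psi>0))"
      then have "indicator (Pi\<^sub>E I A) x = (\<Prod>i\<in>I. indicator (A i) (x i) :: ennreal)"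
        using assms(3) by (auto simp: space_PiM indicator_def PiE_iff prod_zero_iff)
      then show "(\<Prod>i\<in>I. ?f (x i)) * indicator (Pi\<^sub>E I A) x = (\<Prod>i\<in>I. ?f (x i) * indicator (A i) (x i))"
        by (simp add: prod.distrib)
    qed
    also have "\<dots> = (\<Prod>i\<in>I. \<integral>\<^sup>+x. ?f x * indicator (A i) x \<partial>law \<psi>0)"
      using A assms(3) by (intro P0.product_nn_integral_prod) auto
    also have "\<dots> = (\<Prod>i\<in>I. emeasure (law \<psi>) (A i))"
    proof (rule prod.cong[OF refl])
      fix i assume "i \<in> I"
      then show "(\<integral>\<^sup>+x. ?f x * indicator (A i) x \<partial>law \<psi>0) = emeasure (law \<psi>) (A i)"
        using A[of i] by (subst law_tilt[of \<psi> \<psi>0], subst emeasure_density) auto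
    qed
    finally show "emeasure (density (PiM I (\<lambda>_. law \<psi>0)) (\<lambda>x. \<Prod>i\<in>I. ?f (x i))) (Pi\<^sub>E I A) = (\<Prod>i\<in>I. emeasure (law \<psi>) (A i))" .
  qed (use assms in auto)
qed

text \<open>Without this the coverage event need not be an event at all. Under a fixed reference parameter
  \<open>\<psi>0\<close> the probability is an integral of an explicit density that depends measurably on the
  parameters, because the natural parameter is a continuous function of the mean. The default value
  \<open>0\<close> outside the mean range is needed since nothing is known about \<open>b\<close> there.\<close>

lemma borel_measurable_two_sample_prob:
  fixes I1 I2 :: "nat set"
  assumes B: "B \<in> sets (PiM I1 (\<lambda>_. borel) \<Otimes>\<^sub>M PiM I2 (\<lambda>_. borel))"
    and \<psi>0: "\<psi>0 \<in> \<Psi>" and fin: "finite I1" "finite I2"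
  shows "(\<lambda>(t1, t2). if t1 \<in> mean_range b \<Psi> \<and> t2 \<in> mean_range b \<Psi>
      then measure (PiM I1 (\<lambda>_. nef_law \<nu> a b \<Psi> t1) \<Otimes>\<^sub>M PiM I2 (\<lambda>_. nef_law \<nu> a b \<Psi> t2)) B
      else 0) \<in> borel_measurable borel2"
proof -
  let ?R = "\<lambda>t1 t2. PiM I1 (\<lambda>_. nef_law \<nu> a b \<Psi> t1) \<Otimes>\<^sub>M PiM I2 (\<lambda>_. nef_law \<nu> a b \<Psi> t2)"
  let ?M = "mean_range b \<Psi>"
  interpret L0: real_distribution "law \<psi>0" by (rule real_distribution_law) fact
  interpret P01: prob_space "PiM I1 (\<lambda>_. law \<psi>0)" by (rule prob_space_PiM) unfold_locales
  interpret P0: prob_space "PiM I2 (\<lambda>_. law \<psi>0)" by (rule prob_space_PiM) unfold_locales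
  have [measurable]: "?M \<in> sets borel" using open_mean_range by simp
  define N where "N t = indicator ?M t * natural_param b \<Psi> t" for t
  define C where "C t = indicator ?M t * b (natural_param b \<Psi> t)" for t
  have "continuous_on \<Psi> b" using DERIV_isCont[OF DERIV_b] by (intro continuous_at_imp_continuous_on) simp
  then have "continuous_on ?M (\<lambda>t. b (natural_param b \<Psi> t))"
    by (rule continuous_on_compose2[OF _ continuous_on_natural_param]) (use natural_param_mem in auto)
  then have [measurable]: "C \<in> borel_measurable borel"
    using borel_measurable_continuous_on_indicator[of ?M "\<lambda>t. b (natural_param b \<Psi> t)"]
    unfolding C_def by simp
  have [measurable]: "N \<in> borel_measurable borel"
    using borel_measurable_continuous_on_indicator[OF _ continuous_on_natural_param]
    unfolding N_def by simp
  define d where "d = (\<lambda>I t (x :: nat \<Rightarrow> real). \<Prod>i\<in>I. ennreal (exp ((N t - \<psi>0) * x i - (C t - b \<psi>0))))"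
  let ?P1 = "PiM I1 (\<lambda>_. law \<psi>0)" and ?P2 = "PiM I2 (\<lambda>_. law \<psi>0)"
  have [measurable_cong]: "sets (PiM I (\<lambda>_. law \<psi>0)) = sets (PiM I (\<lambda>_. borel))" for I :: "nat set"
    by (simp cong: sets_PiM_cong)
  have [measurable]: "(\<lambda>(t, x). d I t x) \<in> borel_measurable (borel \<Otimes>\<^sub>M PiM I (\<lambda>_. borel))" for I
    unfolding d_def by measurable
  have dm [measurable]: "d I t \<in> borel_measurable (PiM I (\<lambda>_. borel))" for I t
    unfolding d_def by measurable
  note [measurable] = B
  have "sets (?P1 \<Otimes>\<^sub>M ?P2) = sets (PiM I1 (\<lambda>_. borel) \<Otimes>\<^sub>M PiM I2 (\<lambda>_. borel))"
    by (intro sets_pair_measure_cong sets_PiM_cong) simp_all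
  with B have B': "B \<in> sets (?P1 \<Otimes>\<^sub>M ?P2)" by simp
  have ind: "(\<lambda>y. indicator B (x, y) :: ennreal) \<in> borel_measurable ?P2" if "x \<in> space ?P1" for x
    using that by (rule measurable_compose[OF measurable_Pair1' borel_measurable_indicator[OF B']])
  have eq: "(if t1 \<in> ?M \<and> t2 \<in> ?M
      then measure (?R t1 t2) B else 0)
    = (if t1 \<in> ?M \<and> t2 \<in> ?M then enn2real (\<integral>\<^sup>+x. \<integral>\<^sup>+y. d I1 t1 x * (d I2 t2 y * indicator B (x, y)) \<partial>?P2 \<partial>?P1) else 0)" for t1 t2
  proof (cases "t1 \<in> ?M \<and> t2 \<in> ?M")
    case True
    have law_t: "nef_law \<nu> a b \<Psi> t = law (natural_param b \<Psi> t)" for t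
      by (simp add: nef_law_def natural_law_def)
    have dens: "PiM I (\<lambda>_. nef_law \<nu> a b \<Psi> t) = density (PiM I (\<lambda>_. law \<psi>0)) (d I t)" if "t \<in> ?M" "finite I" for I t
      using PiM_law_tilt[OF natural_param_mem[OF that(1)] \<psi>0 that(2)] that
      by (simp add: law_t d_def N_def C_def)
    interpret Q1: real_distribution "nef_law \<nu> a b \<Psi> t1"
      using True by (simp add: law_t natural_param_mem real_distribution_law)
    interpret Q2: real_distribution "nef_law \<nu> a b \<Psi> t2"
      using True by (simp add: law_t natural_param_mem real_distribution_law)
    interpret R2: prob_space "PiM I2 (\<lambda>_. nef_law \<nu> a b \<Psi> t2)" by (rule prob_space_PiM) unfold_locales
    have "emeasure (?R t1 t2) B
        = (\<integral>\<^sup>+x. \<integral>\<^sup>+y. indicator B (x, y) \<partial>PiM I2 (\<lambda>_. nef_law \<nu> a b \<Psi> t2) \<partial>PiM I1 (\<lambda>_. nef_law \<nu> a b \<Psi> t1))"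
    proof (rule R2.emeasure_pair_measure)
      have "sets (?R t1 t2)
          = sets (PiM I1 (\<lambda>_. borel) \<Otimes>\<^sub>M PiM I2 (\<lambda>_. borel))"
        by (intro sets_pair_measure_cong sets_PiM_cong) (simp_all add: law_t)
      then show "B \<in> sets (?R t1 t2)"
        using B by simp
    qed
    also have "\<dots> = (\<integral>\<^sup>+x. \<integral>\<^sup>+y. d I2 t2 y * indicator B (x, y) \<partial>?P2 \<partial>density ?P1 (d I1 t1))"
      unfolding dens[OF conjunct1[OF True] fin(1)] dens[OF conjunct2[OF True] fin(2)]
    proof (rule nn_integral_cong)
      fix x assume x: "x \<in> space (density ?P1 (d I1 t1))"
      from x have "x \<in> space ?P1" by simp
      from ind[OF this]
      show "(\<integral>\<^sup>+y. indicator B (x, y) \<partial>density ?P2 (d I2 t2)) = (\<integral>\<^sup>+y. d I2 t2 y * indicator B (x, y) \<partial>?P2)"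
        by (subst nn_integral_density) simp_all
    qed
    also have "\<dots> = (\<integral>\<^sup>+x. d I1 t1 x * (\<integral>\<^sup>+y. d I2 t2 y * indicator B (x, y) \<partial>?P2) \<partial>?P1)"
    proof (rule nn_integral_density)
      show "(\<lambda>x. \<integral>\<^sup>+y. d I2 t2 y * indicator B (x, y) \<partial>?P2) \<in> borel_measurable ?P1"
        by measurable
    qed simp
    also have "\<dots> = (\<integral>\<^sup>+x. \<integral>\<^sup>+y. d I1 t1 x * (d I2 t2 y * indicator B (x, y)) \<partial>?P2 \<partial>?P1)"
      by (intro nn_integral_cong nn_integral_cmult[symmetric] borel_measurable_times_ennreal ind) simp_all
    finally show ?thesis using True by (simp add: measure_def)
  qed auto
  show ?thesis unfolding eq d_def by measurable
qed
end

section \<open>Local coordinates of the two sample means\<close>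

text \<open>The constrained estimators of the two means in local coordinates, with \<open>d = \<delta> / \<sigma>0\<close>. The pooled
  mean has different local coordinates relative to the two true means, which differ by \<open>d\<close>; hence the
  two offsets.\<close>

definition est1 :: "real \<Rightarrow> real \<Rightarrow> real \<times> real \<Rightarrow> real" where
  "est1 \<omega> d z = min (fst z) (\<omega> * fst z + (1 - \<omega>) * snd z + (1 - \<omega>) * d)"

definition est2 :: "real \<Rightarrow> real \<Rightarrow> real \<times> real \<Rightarrow> real" where
  "est2 \<omega> d z = max (snd z) (\<omega> * fst z + (1 - \<omega>) * snd z - \<omega> * d)"

text \<open>The Gaussian limit of the local coordinates of the two means when the parameters of the samples have local
  coordinates \<open>x\<close> and \<open>y\<close>.\<close>

definition lim_means :: "real \<Rightarrow> real \<Rightarrow> real \<Rightarrow> real \<times> real \<Rightarrow> real \<times> real" where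
  "lim_means \<omega> x y z = (fst z / sqrt \<omega> + x, snd z / sqrt (1 - \<omega>) + y)"

definition lim_prob :: "real \<Rightarrow> (real \<times> real) set \<Rightarrow> real \<Rightarrow> real \<Rightarrow> real" where
  "lim_prob \<omega> A x y = measure gauss2 {z. lim_means \<omega> x y z \<in> A}"

text \<open>The limit of the conditional probability, given the data, that the bootstrap means fall into \<open>A\<close>, as a
  function of the local coordinates of the data.\<close>

definition est_prob :: "real \<Rightarrow> real \<Rightarrow> (real \<times> real) set \<Rightarrow> real \<times> real \<Rightarrow> real" where
  "est_prob \<omega> d A z = lim_prob \<omega> A (est1 \<omega> d z) (est2 \<omega> d z)"

lemma est1_measurable [measurable]: "est1 \<omega> d \<in> borel_measurable borel2"
  and est2_measurable [measurable]: "est2 \<omega> d \<in> borel_measurable borel2"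
  and lim_means_measurable [measurable]: "lim_means \<omega> x y \<in> measurable borel2 borel2"
  unfolding est1_def [abs_def] est2_def [abs_def] lim_means_def [abs_def] by measurable

lemma lim_prob_eq_integral:
  assumes [measurable]: "A \<in> sets borel2"
  shows "lim_prob \<omega> A x y = (\<integral>z. indicator A (lim_means \<omega> x y z) \<partial>gauss2)"
proof -
  have "{z \<in> space gauss2. lim_means \<omega> x y z \<in> A} \<in> sets gauss2" by measurable
  then have "lim_prob \<omega> A x y = (\<integral>z. indicator {z. lim_means \<omega> x y z \<in> A} z \<partial>gauss2)"
    by (simp add: lim_prob_def)
  then show ?thesis by (simp add: indicator_def)
qed

lemma lim_prob_measurable [measurable]:
  assumes [measurable]: "A \<in> sets borel2"
  shows "(\<lambda>(x, y). lim_prob \<omega> A x y) \<in> borel_measurable borel2"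
proof -
  have [measurable]: "(\<lambda>p. lim_means \<omega> (fst (fst p)) (snd (fst p)) (snd p))
      \<in> measurable (borel2 \<Otimes>\<^sub>M borel2) borel2"
    unfolding lim_means_def by measurable
  have "(\<lambda>p. \<integral>z. (indicator A (lim_means \<omega> (fst p) (snd p) z) :: real) \<partial>gauss2) \<in> borel_measurable borel2"
  proof (rule gauss2.P.borel_measurable_lebesgue_integral)
    have "(\<lambda>p. indicator A (lim_means \<omega> (fst (fst p)) (snd (fst p)) (snd p)) :: real)
      \<in> borel_measurable (borel2 \<Otimes>\<^sub>M borel2)" by measurable
    then show "(\<lambda>(p, z). indicator A (lim_means \<omega> (fst p) (snd p) z) :: real) \<in> borel_measurable (borel2 \<Otimes>\<^sub>M gauss2)"
      by (simp add: case_prod_beta cong: measurable_cong_sets)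
  qed
  then show ?thesis by (simp add: lim_prob_eq_integral[OF assms] case_prod_beta)
qed

lemma est_prob_measurable [measurable]:
  assumes "A \<in> sets borel2"
  shows "est_prob \<omega> d A \<in> borel_measurable borel2"
  using measurable_compose[OF measurable_Pair[OF est1_measurable est2_measurable] lim_prob_measurable[OF assms]]
  by (simp add: est_prob_def [abs_def])

lemma nef_law_eq_natural_law: "nef_law \<nu> a b \<Psi> t = natural_law \<nu> a b (natural_param b \<Psi> t)"
  by (simp add: nef_law_def natural_law_def)

lemma sets_nef_law [simp, measurable_cong]: "sets (nef_law \<nu> a b \<Psi> t) = sets borel"
  by (simp add: nef_law_def)

text \<open>A sequence of admissible sizes \<open>n k\<close> together with the limiting parameter. That the sample sizes are exact
  fractions of \<open>n k\<close> makes the change of scale in \<open>loc_means_affine\<close> an identity.\<close>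

locale local_alternatives = nef \<nu> a b \<Psi> for \<nu> a b \<Psi> +
  fixes \<omega> \<delta> \<eta>0 \<sigma>0 :: real and n n1 n2 :: "nat \<Rightarrow> nat"
  assumes \<omega>: "0 < \<omega>" "\<omega> < 1" and \<eta>0: "\<eta>0 \<in> mean_range b \<Psi>"
    and \<sigma>0: "0 < \<sigma>0" "\<sigma>0\<^sup>2 = deriv (deriv b) (natural_param b \<Psi> \<eta>0)"
    and n: "filterlim n at_top sequentially" "\<And>k. 0 < n k"
    and n1: "\<And>k. real (n1 k) = \<omega> * real (n k)" and n2: "\<And>k. real (n2 k) = (1 - \<omega>) * real (n k)"
begin

abbreviation "M \<equiv> mean_range b \<Psi>"
abbreviation "theta_law \<equiv> nef_law \<nu> a b \<Psi>"
abbreviation "sample_space k \<equiv> PiM {1..n1 k} (\<lambda>_. borel :: real measure) \<Otimes>\<^sub>M PiM {1..n2 k} (\<lambda>_. borel :: real measure)"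
abbreviation "d \<equiv> \<delta> / \<sigma>0"

text \<open>The parameter values with local coordinate \<open>x\<close> or \<open>y\<close>; at \<open>0\<close> they are the true parameters.\<close>

definition par1 :: "nat \<Rightarrow> real \<Rightarrow> real" where
  "par1 k x = \<eta>0 - (1 - \<omega>) * (\<delta> / sqrt (real (n k))) + \<sigma>0 * x / sqrt (real (n k))"

definition par2 :: "nat \<Rightarrow> real \<Rightarrow> real" where
  "par2 k y = \<eta>0 + \<omega> * (\<delta> / sqrt (real (n k))) + \<sigma>0 * y / sqrt (real (n k))"

definition loc_means :: "nat \<Rightarrow> (nat \<Rightarrow> real) \<Rightarrow> (nat \<Rightarrow> real) \<Rightarrow> real \<times> real" where
  "loc_means k x1 x2 = (sqrt (real (n k)) * (sample_mean (n1 k) x1 - par1 k 0) / \<sigma>0,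
                  sqrt (real (n k)) * (sample_mean (n2 k) x2 - par2 k 0) / \<sigma>0)"

definition loc_law :: "nat \<Rightarrow> real \<Rightarrow> real \<Rightarrow> (real \<times> real) measure" where
  "loc_law k t1 t2 = distr (PiM {1..n1 k} (\<lambda>_. theta_law t1) \<Otimes>\<^sub>M PiM {1..n2 k} (\<lambda>_. theta_law t2))
     borel2 (\<lambda>(x1, x2). loc_means k x1 x2)"

lemma sqrt_n_pos: "0 < sqrt (real (n k))" using n(2)[of k] by simp

lemma n1_pos: "0 < n1 k" and n2_pos: "0 < n2 k"
proof -
  have "0 < real (n1 k)" "0 < real (n2 k)" unfolding n1 n2 using \<omega> n(2)[of k] by simp_all
  then show "0 < n1 k" "0 < n2 k" by simp_all
qed

lemma n1_at_top: "filterlim n1 at_top sequentially" and n2_at_top: "filterlim n2 at_top sequentially"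
proof -
  have "filterlim (\<lambda>k. real (n k)) at_top sequentially"
    by (rule filterlim_compose[OF filterlim_real_sequentially n(1)])
  then have "filterlim (\<lambda>k. \<omega> * real (n k)) at_top sequentially" "filterlim (\<lambda>k. (1 - \<omega>) * real (n k)) at_top sequentially"
    using \<omega> by (auto intro!: filterlim_tendsto_pos_mult_at_top[OF tendsto_const])
  then show "filterlim n1 at_top sequentially" "filterlim n2 at_top sequentially"
    unfolding n1[symmetric] n2[symmetric] by (simp_all add: filterlim_sequentially_iff_filterlim_real)
qed

lemma inverse_sqrt_n: "(\<lambda>k. 1 / sqrt (real (n k))) \<longlonglongrightarrow> 0"
  by (intro tendsto_divide_0[OF tendsto_const] filterlim_at_top_imp_at_infinity
      filterlim_compose[OF sqrt_at_top] filterlim_compose[OF filterlim_real_sequentially n(1)])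

lemma par_tendsto:
  assumes "x \<longlonglongrightarrow> x0"
  shows "(\<lambda>k. par1 k (x k)) \<longlonglongrightarrow> \<eta>0" "(\<lambda>k. par2 k (x k)) \<longlonglongrightarrow> \<eta>0"
proof -
  have "(\<lambda>k. \<eta>0 - (1 - \<omega>) * (\<delta> * (1 / sqrt (real (n k)))) + \<sigma>0 * x k * (1 / sqrt (real (n k)))) \<longlonglongrightarrow>
      \<eta>0 - (1 - \<omega>) * (\<delta> * 0) + \<sigma>0 * x0 * 0"
    "(\<lambda>k. \<eta>0 + \<omega> * (\<delta> * (1 / sqrt (real (n k)))) + \<sigma>0 * x k * (1 / sqrt (real (n k)))) \<longlonglongrightarrow>
      \<eta>0 + \<omega> * (\<delta> * 0) + \<sigma>0 * x0 * 0"
    by (intro tendsto_intros inverse_sqrt_n assms)+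
  then show "(\<lambda>k. par1 k (x k)) \<longlonglongrightarrow> \<eta>0" "(\<lambda>k. par2 k (x k)) \<longlonglongrightarrow> \<eta>0"
    by (simp_all add: par1_def par2_def)
qed

lemma eventually_par_mem:
  assumes "x \<longlonglongrightarrow> x0"
  shows "\<forall>\<^sub>F k in sequentially. par1 k (x k) \<in> M" "\<forall>\<^sub>F k in sequentially. par2 k (x k) \<in> M"
  using par_tendsto[OF assms] open_mean_range \<eta>0 by (auto simp: topological_tendstoD)

lemma real_distribution_theta_law: "t \<in> M \<Longrightarrow> real_distribution (theta_law t)"
  by (simp add: nef_law_eq_natural_law natural_param_mem real_distribution_law)

lemma std_mean_theta_law_conv:
  assumes m: "filterlim m at_top sequentially" and t: "\<And>k. t k \<in> M" "t \<longlonglongrightarrow> \<eta>0"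
  shows "weak_conv_m (\<lambda>k. std_mean_law (theta_law (t k)) (t k) \<sigma>0 (m k)) std_normal_distribution"
proof -
  have "isCont (natural_param b \<Psi>) \<eta>0"
    using continuous_on_natural_param open_mean_range \<eta>0 by (simp add: continuous_on_eq_continuous_at)
  then have "(\<lambda>k. natural_param b \<Psi> (t k)) \<longlonglongrightarrow> natural_param b \<Psi> \<eta>0"
    using t(2) by (rule isCont_tendsto_compose)
  from std_mean_weak_conv[OF _ this _ m \<sigma>0] show ?thesis
    using t(1) \<eta>0 by (simp add: natural_param_mem nef_law_eq_natural_law)
qed

text \<open>Standardising around the parameter with coordinate \<open>x\<close> instead of the true one is an affine change of
  variable, and the factor \<open>1 / sqrt \<omega>\<close> converts the scale \<open>sqrt n1\<close> into \<open>sqrt n\<close>.\<close>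

lemma loc_means_affine:
  "loc_means k x1 x2 = lim_means \<omega> x y (std_mean (n1 k) (par1 k x) \<sigma>0 x1,
      std_mean (n2 k) (par2 k y) \<sigma>0 x2)"
proof -
  have "sqrt (real (n1 k)) = sqrt \<omega> * sqrt (real (n k))" "sqrt (real (n2 k)) = sqrt (1 - \<omega>) * sqrt (real (n k))"
    by (simp_all add: n1 n2 real_sqrt_mult)
  moreover have "par1 k x = par1 k 0 + \<sigma>0 * x / sqrt (real (n k))" "par2 k y = par2 k 0 + \<sigma>0 * y / sqrt (real (n k))"
    by (simp_all add: par1_def par2_def)
  moreover have rescale: "s * (m - t) / \<sigma>0 = r * s * (m - (t + \<sigma>0 * x / s)) / \<sigma>0 / r + x"
    if "0 < r" "0 < s" for r s m t x :: real
  proof -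
    have "r * s * (m - (t + \<sigma>0 * x / s)) / \<sigma>0 / r = s * (m - (t + \<sigma>0 * x / s)) / \<sigma>0"
      using that by simp
    also have "\<dots> = s * (m - t) / \<sigma>0 - x"
      using that \<sigma>0(1) by (simp add: field_simps)
    finally show ?thesis by simp
  qed
  ultimately show ?thesis
    using rescale[OF _ sqrt_n_pos, of "sqrt \<omega>"] rescale[OF _ sqrt_n_pos, of "sqrt (1 - \<omega>)"] \<omega>
    by (simp only: loc_means_def lim_means_def prod.inject fst_conv snd_conv) simp
qed

lemma loc_means_measurable [measurable]:
  "(\<lambda>(x1, x2). loc_means k x1 x2) \<in> measurable (sample_space k) borel2"
  using sample_mean_measurable[of borel "n1 k"] sample_mean_measurable[of borel "n2 k"]
  unfolding loc_means_def by simp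

lemma sets_two_sample: "sets (PiM {1..n1 k} (\<lambda>_. theta_law t1) \<Otimes>\<^sub>M PiM {1..n2 k} (\<lambda>_. theta_law t2))
    = sets (sample_space k)"
  by (intro sets_pair_measure_cong sets_PiM_cong) simp_all

lemma loc_law_eq:
  assumes "real_distribution (theta_law (par1 k x))" "real_distribution (theta_law (par2 k y))"
  shows "loc_law k (par1 k x) (par2 k y)
    = distr (std_mean_law (theta_law (par1 k x)) (par1 k x) \<sigma>0 (n1 k) \<Otimes>\<^sub>M std_mean_law (theta_law (par2 k y)) (par2 k y) \<sigma>0 (n2 k))
        borel2 (lim_means \<omega> x y)"
  unfolding product_std_mean_laws[OF assms, symmetric]
proof (subst distr_distr)
  let ?P = "PiM {1..n1 k} (\<lambda>_. theta_law (par1 k x)) \<Otimes>\<^sub>M PiM {1..n2 k} (\<lambda>_. theta_law (par2 k y))"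
  show "(\<lambda>(x1, x2). (std_mean (n1 k) (par1 k x) \<sigma>0 x1,
      std_mean (n2 k) (par2 k y) \<sigma>0 x2)) \<in> measurable ?P borel2"
    using sample_mean_measurable[of "theta_law (par1 k x)" "n1 k"] sample_mean_measurable[of "theta_law (par2 k y)" "n2 k"]
    by simp
  show "loc_law k (par1 k x) (par2 k y) = distr ?P borel2 (lim_means \<omega> x y \<circ>
     (\<lambda>(x1, x2). (std_mean (n1 k) (par1 k x) \<sigma>0 x1,
      std_mean (n2 k) (par2 k y) \<sigma>0 x2)))"
    unfolding loc_law_def by (rule distr_cong) (auto simp: loc_means_affine[of k _ _ x y])
qed (rule lim_means_measurable)

lemma tendsto_lim_means: "x \<longlonglongrightarrow> x0 \<Longrightarrow> y \<longlonglongrightarrow> y0 \<Longrightarrow> z \<longlonglongrightarrow> z0 \<Longrightarrow> (\<lambda>k. lim_means \<omega> (x k) (y k) (z k)) \<longlonglongrightarrow> lim_means \<omega> x0 y0 z0"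
  unfolding lim_means_def using \<omega> by (intro tendsto_intros) auto

text \<open>The limit theorem used twice: with \<open>x = y = 0\<close> for the data, and with the local coordinates of the
  estimates for the bootstrap. Parameters may lie outside the mean range for small \<open>k\<close>; replacing them there by
  \<open>\<eta>0\<close> changes only finitely many terms.\<close>

lemma loc_law_tendsto:
  fixes f :: "nat \<Rightarrow> real \<times> real \<Rightarrow> real"
  assumes x: "x \<longlonglongrightarrow> x0" and y: "y \<longlonglongrightarrow> y0"
    and f [measurable]: "\<And>k. f k \<in> borel_measurable borel2"
    and g [measurable]: "g \<in> borel_measurable borel2"
    and bound: "\<And>k z. \<bar>f k z\<bar> \<le> C"
    and conv: "AE z in gauss2. \<forall>z'. z' \<longlonglongrightarrow> lim_means \<omega> x0 y0 z \<longrightarrow> (\<lambda>k. f k (z' k)) \<longlonglongrightarrow> g (lim_means \<omega> x0 y0 z)"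
  shows "(\<lambda>k. \<integral>z. f k z \<partial>loc_law k (par1 k (x k)) (par2 k (y k))) \<longlonglongrightarrow> (\<integral>z. g (lim_means \<omega> x0 y0 z) \<partial>gauss2)"
proof -
  define t1 where "t1 = (\<lambda>k. if par1 k (x k) \<in> M then par1 k (x k) else \<eta>0)"
  define t2 where "t2 = (\<lambda>k. if par2 k (y k) \<in> M then par2 k (y k) else \<eta>0)"
  have t: "t1 k \<in> M" "t2 k \<in> M" for k using \<eta>0 by (auto simp: t1_def t2_def)
  have e1: "\<forall>\<^sub>F k in sequentially. par1 k (x k) = t1 k"
    using eventually_par_mem(1)[OF x] by eventually_elim (simp add: t1_def)
  have e2: "\<forall>\<^sub>F k in sequentially. par2 k (y k) = t2 k"
    using eventually_par_mem(2)[OF y] by eventually_elim (simp add: t2_def)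
  have "t1 \<longlonglongrightarrow> \<eta>0" "t2 \<longlonglongrightarrow> \<eta>0"
    using Lim_transform_eventually[OF par_tendsto(1)[OF x] e1] Lim_transform_eventually[OF par_tendsto(2)[OF y] e2] .
  note w = std_mean_theta_law_conv[OF n1_at_top t(1) this(1)] std_mean_theta_law_conv[OF n2_at_top t(2) this(2)]
  let ?L1 = "\<lambda>k. std_mean_law (theta_law (t1 k)) (t1 k) \<sigma>0 (n1 k)"
  let ?L2 = "\<lambda>k. std_mean_law (theta_law (t2 k)) (t2 k) \<sigma>0 (n2 k)"
  have rd: "real_distribution (?L1 k)" "real_distribution (?L2 k)" for k
    using t by (auto intro!: real_distribution_std_mean_law real_distribution_theta_law)
  have "(\<lambda>k. \<integral>z. f k (lim_means \<omega> (x k) (y k) z) \<partial>(?L1 k \<Otimes>\<^sub>M ?L2 k)) \<longlonglongrightarrow> (\<integral>z. g (lim_means \<omega> x0 y0 z) \<partial>gauss2)"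
  proof (rule product_weak_conv_integral[OF rd(1) real_dist_normal_dist w(1) rd(2) real_dist_normal_dist w(2), where B = C])
    show "AE z in gauss2. \<forall>z'. z' \<longlonglongrightarrow> z \<longrightarrow> (\<lambda>k. f k (lim_means \<omega> (x k) (y k) (z' k))) \<longlonglongrightarrow> g (lim_means \<omega> x0 y0 z)"
      using conv by eventually_elim (auto intro: tendsto_lim_means[OF x y])
    show "(\<lambda>z. f k (lim_means \<omega> (x k) (y k) z)) \<in> borel_measurable borel2" for k
      by (rule measurable_compose[OF lim_means_measurable f])
    show "(\<lambda>z. g (lim_means \<omega> x0 y0 z)) \<in> borel_measurable borel2"
      by (rule measurable_compose[OF lim_means_measurable g])
    show "\<bar>f k (lim_means \<omega> (x k) (y k) z)\<bar> \<le> C" for k z by (rule bound)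
  qed
  moreover have "\<forall>\<^sub>F k in sequentially. (\<integral>z. f k (lim_means \<omega> (x k) (y k) z) \<partial>(?L1 k \<Otimes>\<^sub>M ?L2 k))
      = (\<integral>z. f k z \<partial>loc_law k (par1 k (x k)) (par2 k (y k)))"
    using e1 e2
  proof eventually_elim
    case (elim k)
    have "real_distribution (theta_law (par1 k (x k)))" "real_distribution (theta_law (par2 k (y k)))"
      using t elim by (simp_all add: real_distribution_theta_law)
    note eq = loc_law_eq[OF this, unfolded elim]
    have [measurable_cong]: "sets (?L1 k \<Otimes>\<^sub>M ?L2 k) = sets borel2"
      by (intro sets_pair_measure_cong) (simp_all add: std_mean_law_def)
    show ?case unfolding elim eq by (subst integral_distr) simp_all
  qed
  ultimately show ?thesis by (rule Lim_transform_eventually)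
qed

lemma loc_law_measure_tendsto:
  assumes x: "x \<longlonglongrightarrow> x0" and y: "y \<longlonglongrightarrow> y0" and A [measurable]: "A \<in> sets borel2"
    and null: "AE z in gauss2. lim_means \<omega> x0 y0 z \<notin> frontier A"
  shows "(\<lambda>k. measure (loc_law k (par1 k (x k)) (par2 k (y k))) A) \<longlonglongrightarrow> lim_prob \<omega> A x0 y0"
proof -
  have "(\<lambda>k. \<integral>z. (indicator A z :: real) \<partial>loc_law k (par1 k (x k)) (par2 k (y k))) \<longlonglongrightarrow> (\<integral>z. indicator A (lim_means \<omega> x0 y0 z) \<partial>gauss2)"
  proof (rule loc_law_tendsto[OF x y, where C = 1 and f = "\<lambda>_. indicator A" and g = "indicator A"])
    show "AE z in gauss2. \<forall>z'. z' \<longlonglongrightarrow> lim_means \<omega> x0 y0 z \<longrightarrow>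
        (\<lambda>k. indicator A (z' k) :: real) \<longlonglongrightarrow> indicator A (lim_means \<omega> x0 y0 z)"
      using null by eventually_elim (auto intro!: isCont_tendsto_compose[of _ "indicator A"] simp: isCont_indicator)
  qed (auto simp: indicator_def)
  moreover have "(\<integral>z. (indicator A z :: real) \<partial>loc_law k (par1 k (x k)) (par2 k (y k))) = measure (loc_law k (par1 k (x k)) (par2 k (y k))) A" for k
    by (simp add: loc_law_def)
  ultimately show ?thesis by (simp only: lim_prob_eq_integral[OF A])
qed
end

section \<open>The limit of the coverage probability of a bootstrap interval\<close>

lemma continuous_on_est1: "continuous_on UNIV (est1 \<omega> d)" and continuous_on_est2: "continuous_on UNIV (est2 \<omega> d)"
  unfolding est1_def [abs_def] est2_def [abs_def] by (intro continuous_intros)+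

context local_alternatives
begin

text \<open>The parametrisations \<open>par1\<close> and \<open>par2\<close> are increasing, so they commute with \<open>min\<close> and
  \<open>max\<close>.\<close>

lemma theta1_hat_eq_par1: "theta1_hat \<omega> (n1 k) (n2 k) x1 x2 = par1 k (est1 \<omega> d (loc_means k x1 x2))"
  and theta2_hat_eq_par2: "theta2_hat \<omega> (n1 k) (n2 k) x1 x2 = par2 k (est2 \<omega> d (loc_means k x1 x2))"
proof -
  define s where "s = sqrt (real (n k))"
  have s: "0 < s" using sqrt_n_pos by (simp add: s_def)
  define p q where "p = fst (loc_means k x1 x2)" and "q = snd (loc_means k x1 x2)"
  have m1: "sample_mean (n1 k) x1 = par1 k p"
    using s \<sigma>0(1) by (simp add: p_def loc_means_def par1_def s_def[symmetric] field_simps)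
  have m2: "sample_mean (n2 k) x2 = par2 k q"
    using s \<sigma>0(1) by (simp add: q_def loc_means_def par2_def s_def[symmetric] field_simps)
  have mono: "mono (par1 k)" "mono (par2 k)"
    using s \<sigma>0(1) by (auto simp: mono_def par1_def par2_def s_def[symmetric] divide_right_mono)
  have pooled: "pooled_mean \<omega> (n1 k) (n2 k) x1 x2 = par1 k (\<omega> * p + (1 - \<omega>) * q + (1 - \<omega>) * d)"
    "pooled_mean \<omega> (n1 k) (n2 k) x1 x2 = par2 k (\<omega> * p + (1 - \<omega>) * q - \<omega> * d)"
    using s \<sigma>0(1) unfolding pooled_mean_def m1 m2 par1_def par2_def s_def[symmetric] by (simp_all add: field_simps)
  show "theta1_hat \<omega> (n1 k) (n2 k) x1 x2 = par1 k (est1 \<omega> d (loc_means k x1 x2))"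
    unfolding theta1_hat_def est1_def p_def[symmetric] q_def[symmetric] m1 pooled(1)
    by (rule min_of_mono[OF mono(1)])
  show "theta2_hat \<omega> (n1 k) (n2 k) x1 x2 = par2 k (est2 \<omega> d (loc_means k x1 x2))"
    unfolding theta2_hat_def est2_def p_def[symmetric] q_def[symmetric] m2 pooled(2)
    by (rule max_of_mono[OF mono(2)])
qed

lemma distr_loc_means_two_samples:
  assumes two: "two_samples P X1 X2 (n1 k) (n2 k) (theta_law (par1 k 0)) (theta_law (par2 k 0))"
  defines "Z \<equiv> \<lambda>w. loc_means k (\<lambda>j. X1 j w) (\<lambda>j. X2 j w)"
  shows "distr P borel2 Z = loc_law k (par1 k 0) (par2 k 0)"
    and "Z \<in> measurable P borel2"
proof -
  interpret P: prob_space P using two by (simp add: two_samples_def)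
  note two_samples_std_mean_laws[OF two n1_pos n2_pos]
  note [measurable] = this(2,3)
  show Z: "Z \<in> measurable P borel2" unfolding Z_def loc_means_def by measurable
  have rv: "X1 1 \<in> borel_measurable P" "X2 1 \<in> borel_measurable P"
    and D: "distr P borel (X1 1) = theta_law (par1 k 0)" "distr P borel (X2 1) = theta_law (par2 k 0)"
  proof -
    have "prob_space.indep_vars P (\<lambda>_. borel) (case_sum X1 X2) ({1..n1 k} <+> {1..n2 k})"
      using two by (simp add: two_samples_def)
    then have *: "\<forall>i\<in>{1..n1 k} <+> {1..n2 k}. case_sum X1 X2 i \<in> borel_measurable P"
      unfolding P.indep_vars_def by blast
    show "X1 1 \<in> borel_measurable P" "X2 1 \<in> borel_measurable P"
      using *[rule_format, of "Inl 1"] *[rule_format, of "Inr 1"] n1_pos[of k] n2_pos[of k] by (auto simp: Plus_def)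
    show "distr P borel (X1 1) = theta_law (par1 k 0)" "distr P borel (X2 1) = theta_law (par2 k 0)"
      using two n1_pos[of k] n2_pos[of k] by (auto simp: two_samples_def)
  qed
  have "real_distribution (theta_law (par1 k 0))" "real_distribution (theta_law (par2 k 0))"
    using P.real_distribution_distr[OF rv(1)] P.real_distribution_distr[OF rv(2)] D by simp_all
  from loc_law_eq[OF this] have "loc_law k (par1 k 0) (par2 k 0) = distr (distr P borel2
      (\<lambda>w. (std_mean (n1 k) (par1 k 0) \<sigma>0 (\<lambda>j. X1 j w),
             std_mean (n2 k) (par2 k 0) \<sigma>0 (\<lambda>j. X2 j w))))
      borel2 (lim_means \<omega> 0 0)"
    by (simp add: two_samples_std_mean_laws(1)[OF two n1_pos n2_pos])
  also have "\<dots> = distr P borel2 Z"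
    by (subst distr_distr) (auto simp: Z_def loc_means_affine[of k _ _ 0 0] comp_def)
  finally show "distr P borel2 Z = loc_law k (par1 k 0) (par2 k 0)" by simp
qed

text \<open>The statistic \<open>T\<close> enters only through the sets \<open>A\<close> and \<open>B\<close> of local coordinates on which
  it is at most, respectively below, the true value. Two sets are needed because a statistic with an atom at the
  true value has \<open>G(\<theta>-) < G(\<theta>)\<close> even in the limit; this happens for the difference of the means
  when \<open>\<delta> = 0\<close>. The bootstrap quantities are arbitrary where an estimate leaves the mean
  range; the coverage event is therefore enclosed between two events that depend on local coordinates only, and
  both have the same limiting probability.\<close>

lemma coverage_tendsto:
  fixes P :: "nat \<Rightarrow> 'a measure" and X1 X2 :: "nat \<Rightarrow> nat \<Rightarrow> 'a \<Rightarrow> real"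
    and T :: "nat \<Rightarrow> (nat \<Rightarrow> real) \<Rightarrow> (nat \<Rightarrow> real) \<Rightarrow> real" and \<theta> :: "nat \<Rightarrow> real"
    and c q :: "nat \<Rightarrow> real \<Rightarrow> 'a \<Rightarrow> real"
  assumes two: "\<And>k. two_samples (P k) (X1 k) (X2 k) (n1 k) (n2 k) (theta_law (par1 k 0)) (theta_law (par2 k 0))"
    and T: "\<And>k. (\<lambda>(x1, x2). T k x1 x2) \<in> borel_measurable (sample_space k)"
    and T_le: "\<And>k x1 x2. T k x1 x2 \<le> \<theta> k \<longleftrightarrow> loc_means k x1 x2 \<in> A"
    and T_less: "\<And>k x1 x2. T k x1 x2 < \<theta> k \<longleftrightarrow> loc_means k x1 x2 \<in> B"
    and AB [measurable]: "A \<in> sets borel2" "B \<in> sets borel2"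
    and null: "\<And>x y. AE z in gauss2. lim_means \<omega> x y z \<notin> frontier A"
      "\<And>x y. AE z in gauss2. lim_means \<omega> x y z \<notin> frontier B"
    and \<alpha>: "0 < \<alpha>" "\<alpha> < 1" and \<beta>: "0 < \<beta>" "\<beta> < 1"
    and ne: "AE z in gauss2. est_prob \<omega> d A (lim_means \<omega> 0 0 z) \<noteq> \<alpha>"
      "AE z in gauss2. est_prob \<omega> d B (lim_means \<omega> 0 0 z) \<noteq> \<beta>"
    and c: "\<And>k \<gamma>. c k \<gamma> \<in> borel_measurable (P k)"
    and q: "\<And>k \<gamma> w. q k \<gamma> w =
      (let t1 = theta1_hat \<omega> (n1 k) (n2 k) (\<lambda>j. X1 k j w) (\<lambda>j. X2 k j w);
           t2 = theta2_hat \<omega> (n1 k) (n2 k) (\<lambda>j. X1 k j w) (\<lambda>j. X2 k j w)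
       in if t1 \<in> M \<and> t2 \<in> M
          then quantile (two_sample_cdf (theta_law t1) (theta_law t2) (n1 k) (n2 k) (T k)) \<gamma> else c k \<gamma> w)"
  shows "(\<lambda>k. measure (P k) {w \<in> space (P k). \<theta> k \<in> {q k \<alpha> w .. q k \<beta> w}}) \<longlonglongrightarrow>
    measure gauss2 {z. \<alpha> \<le> est_prob \<omega> d A (lim_means \<omega> 0 0 z) \<and>
      est_prob \<omega> d B (lim_means \<omega> 0 0 z) \<le> \<beta>}"
proof -
  let ?PP = "\<lambda>k t1 t2. PiM {1..n1 k} (\<lambda>_. theta_law t1) \<Otimes>\<^sub>M PiM {1..n2 k} (\<lambda>_. theta_law t2)"
  define Z where "Z = (\<lambda>k w. loc_means k (\<lambda>j. X1 k j w) (\<lambda>j. X2 k j w))"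
  define h1 h2 where "h1 = (\<lambda>k z. par1 k (est1 \<omega> d z))" and "h2 = (\<lambda>k z. par2 k (est2 \<omega> d z))"
  define boot where "boot = (\<lambda>k z. distr (?PP k (h1 k z) (h2 k z)) borel (\<lambda>(x1, x2). T k x1 x2))"
  define inM where "inM = (\<lambda>k. {z. h1 k z \<in> M \<and> h2 k z \<in> M})"
  \<comment> \<open>countably many conditions, so that the set is measurable; see \<open>le_quantile_iff\<close>\<close>
  define cover where "cover = (\<lambda>k. {z. \<alpha> \<le> cdf (boot k z) (\<theta> k) \<and> (\<forall>j::nat. cdf (boot k z) (\<theta> k - 1 / real (Suc j)) < \<beta>)})"
  define pA where "pA = est_prob \<omega> d A"
  define pB where "pB = est_prob \<omega> d B"
  define lim where "lim = {z. \<alpha> \<le> pA z \<and> pB z \<le> \<beta>}"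
  have Z: "distr (P k) borel2 (Z k) = loc_law k (par1 k 0) (par2 k 0)"
    and Z_meas [measurable]: "Z k \<in> measurable (P k) borel2" for k
    using distr_loc_means_two_samples[OF two] by (simp_all add: Z_def)
  have P: "prob_space (P k)" for k using two by (auto simp: two_samples_def)
  have T': "(\<lambda>(x1, x2). T k x1 x2) \<in> borel_measurable (?PP k t1 t2)" for k t1 t2
    using T[of k] measurable_cong_sets[OF sets_two_sample refl] by blast
  have loc': "(\<lambda>(x1, x2). loc_means k x1 x2) \<in> measurable (?PP k t1 t2) borel2" for k t1 t2
    using loc_means_measurable[of k] measurable_cong_sets[OF sets_two_sample refl] by blast
  have h_meas [measurable]: "h1 k \<in> borel_measurable borel2" "h2 k \<in> borel_measurable borel2" for k
    unfolding h1_def h2_def par1_def par2_def by measurable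
  have M_meas [measurable]: "M \<in> sets borel" using open_mean_range by simp
  have inM_meas [measurable]: "inM k \<in> sets borel2" for k
  proof -
    have "{z \<in> space borel2. h1 k z \<in> M \<and> h2 k z \<in> M} \<in> sets borel2" by measurable
    then show ?thesis by (simp add: inM_def space_pair_measure)
  qed
  have boot_rd: "real_distribution (boot k z)" if "z \<in> inM k" for k z
  proof -
    interpret F1: real_distribution "theta_law (h1 k z)" using that by (intro real_distribution_theta_law) (simp add: inM_def)
    interpret F2: real_distribution "theta_law (h2 k z)" using that by (intro real_distribution_theta_law) (simp add: inM_def)
    interpret G1: prob_space "PiM {1..n1 k} (\<lambda>_. theta_law (h1 k z))" by (rule prob_space_PiM) unfold_locales
    interpret G2: prob_space "PiM {1..n2 k} (\<lambda>_. theta_law (h2 k z))" by (rule prob_space_PiM) unfold_locales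
    interpret PP: pair_prob_space "PiM {1..n1 k} (\<lambda>_. theta_law (h1 k z))" "PiM {1..n2 k} (\<lambda>_. theta_law (h2 k z))" ..
    show ?thesis unfolding boot_def by (rule PP.P.real_distribution_distr[OF T'])
  qed
  have cdf_meas: "(\<lambda>z. if z \<in> inM k then cdf (boot k z) t else 0) \<in> borel_measurable borel2" for k t
  proof -
    define S where "S = {x \<in> space (sample_space k). (case x of (x1, x2) \<Rightarrow> T k x1 x2) \<in> {..t}}"
    have S: "S \<in> sets (sample_space k)"
      unfolding S_def by (rule measurable_sets_Collect[OF T]) simp
    have "cdf (boot k z) t = measure (?PP k (h1 k z) (h2 k z)) S" for z
    proof -
      have sp: "space (?PP k (h1 k z) (h2 k z)) = space (sample_space k)"
        by (rule sets_eq_imp_space_eq[OF sets_two_sample])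
      have "(\<lambda>(x1, x2). T k x1 x2) -` {..t} \<inter> space (?PP k (h1 k z) (h2 k z)) = S"
        unfolding sp S_def by auto
      then show ?thesis
        unfolding cdf_def boot_def by (subst measure_distr[OF T']) simp_all
    qed
    then have eq: "(\<lambda>z. if z \<in> inM k then cdf (boot k z) t else 0)
        = (\<lambda>z. (case (h1 k z, h2 k z) of (t1, t2) \<Rightarrow> if t1 \<in> M \<and> t2 \<in> M then measure (?PP k t1 t2) S else 0))"
      by (auto simp: inM_def fun_eq_iff)
    show ?thesis unfolding eq
      by (rule measurable_compose[OF _ borel_measurable_two_sample_prob[OF S natural_param_mem[OF \<eta>0]]])
        (use h_meas in measurable)
  qed
  have D_meas [measurable]: "inM k \<inter> cover k \<in> sets borel2" for k
  proof -
    note [measurable] = cdf_meas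
    have eq: "inM k \<inter> cover k = {z \<in> space borel2. z \<in> inM k \<and> \<alpha> \<le> (if z \<in> inM k then cdf (boot k z) (\<theta> k) else 0) \<and>
        (\<forall>j::nat. (if z \<in> inM k then cdf (boot k z) (\<theta> k - 1 / real (Suc j)) else 0) < \<beta>)}"
      by (auto simp: cover_def space_pair_measure)
    show ?thesis unfolding eq by measurable
  qed
  \<comment> \<open>local coordinates determine the event unless an estimate leaves the mean range, where the bootstrap is arbitrary\<close>
  have q_cases: "\<theta> k \<in> {q k \<alpha> w .. q k \<beta> w} \<longleftrightarrow>
      (if Z k w \<in> inM k then Z k w \<in> cover k else \<theta> k \<in> {c k \<alpha> w .. c k \<beta> w})" for k w
  proof (cases "Z k w \<in> inM k")
    case True
    interpret real_distribution "boot k (Z k w)" by (rule boot_rd[OF True])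
    have "q k \<gamma> w = quantile (cdf (boot k (Z k w))) \<gamma>" for \<gamma>
      using True by (simp add: q Let_def inM_def theta1_hat_eq_par1 theta2_hat_eq_par2 h1_def h2_def Z_def boot_def two_sample_cdf_def)
    then show ?thesis
      using True by (simp add: quantile_le_iff[OF \<alpha>] le_quantile_iff[OF \<beta>] cover_def)
  next
    case False
    then have "q k \<gamma> w = c k \<gamma> w" for \<gamma>
      by (auto simp add: q Let_def inM_def theta1_hat_eq_par1 theta2_hat_eq_par2 h1_def h2_def Z_def)
    with False show ?thesis by simp
  qed
  let ?E = "\<lambda>k. {w \<in> space (P k). \<theta> k \<in> {q k \<alpha> w .. q k \<beta> w}}"
  have E_meas: "?E k \<in> sets (P k)" for k
  proof -
    note [measurable] = c
    have eq: "?E k = {w \<in> space (P k). if Z k w \<in> inM k then Z k w \<in> inM k \<inter> cover k else \<theta> k \<in> {c k \<alpha> w .. c k \<beta> w}}"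
      unfolding q_cases by auto
    show ?thesis by (subst eq, unfold atLeastAtMost_iff) measurable
  qed
  have ev: "\<forall>\<^sub>F k in sequentially. z' k \<in> inM k \<and> (z' k \<in> cover k \<longleftrightarrow> z \<in> lim)"
    if z': "z' \<longlonglongrightarrow> z" and z: "pA z \<noteq> \<alpha>" "pB z \<noteq> \<beta>" for z' z
  proof -
    have S: "(\<lambda>k. est1 \<omega> d (z' k)) \<longlonglongrightarrow> est1 \<omega> d z" "(\<lambda>k. est2 \<omega> d (z' k)) \<longlonglongrightarrow> est2 \<omega> d z"
      using continuous_on_tendsto_compose[OF continuous_on_est1 z'] continuous_on_tendsto_compose[OF continuous_on_est2 z'] by simp_all
    have M: "\<forall>\<^sub>F k in sequentially. z' k \<in> inM k"
      using eventually_par_mem(1)[OF S(1)] eventually_par_mem(2)[OF S(2)] by eventually_elim (simp add: inM_def h1_def h2_def)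
    have A: "(\<lambda>k. measure (loc_law k (h1 k (z' k)) (h2 k (z' k))) A) \<longlonglongrightarrow> pA z"
      and B: "(\<lambda>k. measure (loc_law k (h1 k (z' k)) (h2 k (z' k))) B) \<longlonglongrightarrow> pB z"
      unfolding h1_def h2_def pA_def pB_def est_prob_def
      by (intro loc_law_measure_tendsto S null AB)+
    have mA: "cdf (boot k y) (\<theta> k) = measure (loc_law k (h1 k y) (h2 k y)) A" for k y
      unfolding cdf_def boot_def loc_law_def
      by (subst measure_distr[OF T'], simp, subst measure_distr[OF loc' AB(1)])
        (auto simp: T_le intro!: arg_cong[of _ _ "measure _"])
    have mB: "measure (boot k y) {..<\<theta> k} = measure (loc_law k (h1 k y) (h2 k y)) B" for k y
      unfolding boot_def loc_law_def
      by (subst measure_distr[OF T'], simp, subst measure_distr[OF loc' AB(2)])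
        (auto simp: T_less intro!: arg_cong[of _ _ "measure _"])
    have cov: "y \<in> cover k \<longleftrightarrow> \<alpha> \<le> cdf (boot k y) (\<theta> k) \<and> \<theta> k \<le> quantile (cdf (boot k y)) \<beta>" if "y \<in> inM k" for k y
      unfolding cover_def using real_distribution.le_quantile_iff[OF boot_rd[OF that] \<beta>] by simp
    have evA: "\<forall>\<^sub>F k in sequentially. (\<alpha> \<le> cdf (boot k (z' k)) (\<theta> k)) \<longleftrightarrow> \<alpha> \<le> pA z"
    proof (cases "\<alpha> < pA z")
      case True
      from order_tendstoD(1)[OF A this] show ?thesis
        by eventually_elim (use True in \<open>simp add: mA\<close>)
    next
      case False
      then have "pA z < \<alpha>" using z by simp
      from order_tendstoD(2)[OF A this] show ?thesis
        by eventually_elim (use False z in \<open>simp add: mA\<close>)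
    qed
    have evB: "\<forall>\<^sub>F k in sequentially. (\<theta> k \<le> quantile (cdf (boot k (z' k))) \<beta>) \<longleftrightarrow> pB z \<le> \<beta>"
    proof (cases "pB z < \<beta>")
      case True
      from order_tendstoD(2)[OF B this] M show ?thesis
      proof eventually_elim
        case (elim k)
        then show ?case
          using real_distribution.less_imp_le_quantile[OF boot_rd[OF elim(2)] \<beta>, of "\<theta> k"] True by (simp add: mB)
      qed
    next
      case False
      then have "\<beta> < pB z" using z by simp
      from order_tendstoD(1)[OF B this] M show ?thesis
      proof eventually_elim
        case (elim k)
        then show ?case
          using real_distribution.le_quantile_imp[OF boot_rd[OF elim(2)] \<beta>, of "\<theta> k"] \<open>\<beta> < pB z\<close> by (auto simp: mB)
      qed
    qed
    show ?thesis using M evA evB by eventually_elim (auto simp: cov lim_def)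
  qed
  have pAB [measurable]: "pA \<in> borel_measurable borel2" "pB \<in> borel_measurable borel2"
    unfolding pA_def pB_def by measurable
  have lim_meas [measurable]: "lim \<in> sets borel2"
  proof -
    have "{z \<in> space borel2. \<alpha> \<le> pA z \<and> pB z \<le> \<beta>} \<in> sets borel2" by measurable
    then show ?thesis by (simp add: lim_def space_pair_measure)
  qed
  let ?I = "\<integral>z. (indicator lim (lim_means \<omega> 0 0 z) :: real) \<partial>gauss2"
  let ?L = "\<lambda>k. measure (loc_law k (par1 k 0) (par2 k 0))"
  have conv: "(\<lambda>k. ?L k (F k)) \<longlonglongrightarrow> ?I"
    if F: "\<And>k. F k \<in> sets borel2" "\<And>k y. y \<in> inM k \<Longrightarrow> y \<in> F k \<longleftrightarrow> y \<in> cover k" for F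
  proof -
    have "(\<lambda>k. \<integral>z. (indicator (F k) z :: real) \<partial>loc_law k (par1 k 0) (par2 k 0)) \<longlonglongrightarrow> ?I"
    proof (rule loc_law_tendsto[where C = 1 and x = "\<lambda>_. 0" and y = "\<lambda>_. 0" and f = "\<lambda>k. indicator (F k)" and g = "indicator lim"])
      show "AE z in gauss2. \<forall>z'. z' \<longlonglongrightarrow> lim_means \<omega> 0 0 z \<longrightarrow>
          (\<lambda>k. indicator (F k) (z' k) :: real) \<longlonglongrightarrow> indicator lim (lim_means \<omega> 0 0 z)"
        using ne
      proof eventually_elim
        case (elim z)
        show ?case
        proof (intro allI impI)
          fix z' assume "z' \<longlonglongrightarrow> lim_means \<omega> 0 0 z"
          from ev[OF this] elim have "\<forall>\<^sub>F k in sequentially. z' k \<in> inM k \<and> (z' k \<in> cover k \<longleftrightarrow> lim_means \<omega> 0 0 z \<in> lim)"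
            by (simp add: pA_def pB_def)
          then have "\<forall>\<^sub>F k in sequentially. indicator lim (lim_means \<omega> 0 0 z) = (indicator (F k) (z' k) :: real)"
            by eventually_elim (auto simp: F(2) indicator_def)
          then show "(\<lambda>k. indicator (F k) (z' k) :: real) \<longlonglongrightarrow> indicator lim (lim_means \<omega> 0 0 z)"
            by (rule Lim_transform_eventually[OF tendsto_const])
        qed
      qed
    qed (use F(1) in \<open>auto simp: indicator_def\<close>)
    moreover have "(\<integral>z. (indicator (F k) z :: real) \<partial>loc_law k (par1 k 0) (par2 k 0)) = ?L k (F k)" for k
      using F(1)[of k] by (simp add: loc_law_def)
    ultimately show ?thesis by simp
  qed
  have lower: "?L k (inM k \<inter> cover k) \<le> measure (P k) (?E k)" for k
  proof -
    interpret prob_space "P k" by (rule P)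
    have "?L k (inM k \<inter> cover k) = prob (Z k -` (inM k \<inter> cover k) \<inter> space (P k))"
      unfolding Z[symmetric] by (rule measure_distr) simp_all
    also have "\<dots> \<le> prob (?E k)" by (rule finite_measure_mono[OF _ E_meas]) (unfold q_cases, auto)
    finally show ?thesis .
  qed
  have U: "- inM k \<union> (inM k \<inter> cover k) \<in> sets borel2" for k
    using sets.compl_sets[OF inM_meas[of k]] D_meas[of k] by (auto simp: space_pair_measure Compl_eq_Diff_UNIV)
  have upper: "measure (P k) (?E k) \<le> ?L k (- inM k \<union> (inM k \<inter> cover k))" for k
  proof -
    interpret prob_space "P k" by (rule P)
    have "prob (?E k) \<le> prob (Z k -` (- inM k \<union> (inM k \<inter> cover k)) \<inter> space (P k))"
      by (rule finite_measure_mono[OF _ measurable_sets[OF Z_meas U]]) (unfold q_cases, auto)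
    also have "\<dots> = ?L k (- inM k \<union> (inM k \<inter> cover k))"
      unfolding Z[symmetric] by (rule measure_distr[symmetric, OF Z_meas U])
    finally show ?thesis .
  qed
  have "(\<lambda>k. measure (P k) (?E k)) \<longlonglongrightarrow> ?I"
  proof (rule tendsto_sandwich[OF always_eventually always_eventually])
    show "\<forall>k. ?L k (inM k \<inter> cover k) \<le> measure (P k) (?E k)" using lower by simp
    show "\<forall>k. measure (P k) (?E k) \<le> ?L k (- inM k \<union> (inM k \<inter> cover k))" using upper by simp
    show "(\<lambda>k. ?L k (inM k \<inter> cover k)) \<longlonglongrightarrow> ?I"
      by (rule conv) auto
    show "(\<lambda>k. ?L k (- inM k \<union> (inM k \<inter> cover k))) \<longlonglongrightarrow> ?I"
      by (rule conv[OF U]) auto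
  qed
  also have "?I = measure gauss2 {z. lim_means \<omega> 0 0 z \<in> lim}"
    by (simp only: lim_prob_eq_integral[OF lim_meas, symmetric] lim_prob_def)
  finally show ?thesis by (simp add: lim_def pA_def pB_def)
qed
end

section \<open>The limiting conditional distribution functions\<close>

lemma Phi_strict_mono: "x < y \<Longrightarrow> Phi x < Phi y"
proof -
  assume "x < y"
  then have "0 < std_normal.prob {x<..<y}"
    using emeasure_std_normal_open_interval_pos[of x y] by (simp add: std_normal.emeasure_eq_measure)
  also have "\<dots> \<le> std_normal.prob {x<..y}" by (intro std_normal.finite_measure_mono) auto
  also have "\<dots> = Phi y - Phi x"
    using std_normal.cdf_diff_eq[OF \<open>x < y\<close>] by (simp add: Phi_def)
  finally show ?thesis by simp
qed

lemma Phi_le_iff: "Phi x \<le> Phi y \<longleftrightarrow> x \<le> y"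
  using Phi_strict_mono by (metis linorder_not_less order_le_less)

lemma Phi_eq_iff: "Phi x = Phi y \<longleftrightarrow> x = y"
  using Phi_le_iff[of x y] Phi_le_iff[of y x] by auto

lemma isCont_Phi: "isCont Phi x"
proof -
  have "AE y in std_normal_distribution. y \<notin> {x}" by (rule AE_std_normal_countable) simp
  then have "std_normal.prob {x} = 0" by (intro std_normal.prob_eq_0[THEN iffD2]) auto
  then show ?thesis unfolding Phi_def by (simp add: std_normal.isCont_cdf)
qed

lemma Phi_inv:
  assumes "0 < p" "p < 1"
  shows "Phi (inv Phi p) = p"
proof -
  have "\<forall>\<^sub>F x in at_bot. Phi x < p"
    using order_tendstoD(2)[OF std_normal.cdf_lim_at_bot] assms by (auto simp: Phi_def)
  then obtain l where l: "Phi l < p" by (auto simp: eventually_at_bot_linorder)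
  have "\<forall>\<^sub>F x in at_top. p < Phi x"
    using order_tendstoD(1)[OF std_normal.cdf_lim_at_top_prob] assms by (auto simp: Phi_def)
  then obtain u where u: "p < Phi u" by (auto simp: eventually_at_top_linorder)
  have "l \<le> u" using l u Phi_le_iff[of l u] by simp
  then have "\<exists>x\<ge>l. x \<le> u \<and> Phi x = p"
    using l u isCont_Phi by (intro IVT) auto
  then show ?thesis by (metis f_inv_into_f rangeI)
qed

lemma Phi_0: "Phi 0 = 1 / 2"
proof -
  let ?A = "{z :: real \<times> real. 1 * fst z + 0 * snd z \<le> 0}" and ?B = "{z :: real \<times> real. (- 1) * fst z + 0 * snd z \<le> 0}"
  have A: "{z \<in> space gauss2. 1 * fst z + 0 * snd z \<le> 0} \<in> sets gauss2" by measurable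
  have B: "{z \<in> space gauss2. (- 1) * fst z + 0 * snd z \<le> 0} \<in> sets gauss2" by measurable
  have "AE z in gauss2. z \<notin> ?A \<inter> ?B"
    using AE_gauss2_line[of 1 0 0] by (auto simp: case_prod_beta elim!: eventually_mono)
  then have "gauss2.P.prob (?A \<inter> ?B) = 0"
    using A B by (intro gauss2.P.prob_eq_0[THEN iffD2]) auto
  moreover have "gauss2.P.prob (?A \<union> ?B) = 1"
  proof -
    have "?A \<union> ?B = space gauss2" by auto
    then show ?thesis by (simp only: gauss2.P.prob_space)
  qed
  moreover have "gauss2.P.prob (?A \<union> ?B) = gauss2.P.prob ?A + gauss2.P.prob ?B - gauss2.P.prob (?A \<inter> ?B)"
    using A B by (intro measure_Un3) (auto simp: gauss2.P.fmeasurable_eq_sets)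
  ultimately show ?thesis
    using measure_gauss2_halfplane[of 1 0 0] measure_gauss2_halfplane[of "- 1" 0 0] by simp
qed

text \<open>A level set of a function that is strictly decreasing in the second variable has one-point sections.\<close>

lemma AE_ne_of_strict_antimono:
  fixes F :: "real \<times> real \<Rightarrow> real"
  assumes [measurable]: "F \<in> borel_measurable borel2"
    and anti: "\<And>u v v'. v < v' \<Longrightarrow> F (u, v') < F (u, v)"
  shows "AE z in gauss2. F z \<noteq> \<alpha>"
proof (rule AE_gauss2_sections)
  fix u
  have "{v. F (u, v) = \<alpha>} \<subseteq> {THE v. F (u, v) = \<alpha>}"
  proof
    fix v assume v: "v \<in> {v. F (u, v) = \<alpha>}"
    then have "(THE v. F (u, v) = \<alpha>) = v"
    proof (intro the_equality)
      fix w assume "F (u, w) = \<alpha>"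
      then show "w = v" using v anti[of v w u] anti[of w v u] by (cases v w rule: linorder_cases) auto
    qed simp
    then show "v \<in> {THE v. F (u, v) = \<alpha>}" by simp
  qed
  from countable_subset[OF this] show "countable {v. \<not> F (u, v) \<noteq> \<alpha>}" by simp
qed measurable

lemma frontier_sublevel:
  fixes f :: "'a::topological_space \<Rightarrow> real"
  assumes "continuous_on UNIV f"
  shows "frontier {z. f z \<le> 0} \<subseteq> {z. f z = 0}" "frontier {z. f z < 0} \<subseteq> {z. f z = 0}"
proof -
  have cl: "closed {z. f z \<le> 0}" and op: "open {z. f z < 0}"
    using assms by (auto intro!: closed_Collect_le open_Collect_less continuous_on_const)
  have "{z. f z < 0} \<subseteq> interior {z. f z \<le> 0}" by (rule interior_maximal[OF _ op]) auto
  then show "frontier {z. f z \<le> 0} \<subseteq> {z. f z = 0}"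
    using cl by (force simp: frontier_def order.order_iff_strict)
  have "closure {z. f z < 0} \<subseteq> {z. f z \<le> 0}" by (rule closure_minimal[OF _ cl]) auto
  then show "frontier {z. f z < 0} \<subseteq> {z. f z = 0}"
    using op by (auto simp: frontier_def interior_open)
qed

lemma Collect_in_sets_pair:
  "Measurable.pred borel2 Q \<Longrightarrow> {z :: real \<times> real. Q z} \<in> sets borel2"
  using pred_sets1[of "borel \<Otimes>\<^sub>M borel" Q] by (simp add: pred_def space_pair_measure)

text \<open>The limit experiment: nothing in it depends on the sample sizes or on the exponential family.\<close>

locale pooling = fixes \<omega> d :: real assumes \<omega>: "0 < \<omega>" "\<omega> < 1" and d: "0 \<le> d"
begin

lemma est1_lim_means: "est1 \<omega> d (lim_means \<omega> x y z) = min (fst z / sqrt \<omega> + x)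
    (sqrt \<omega> * fst z + sqrt (1 - \<omega>) * snd z + (\<omega> * x + (1 - \<omega>) * y + (1 - \<omega>) * d))"
  and est2_lim_means: "est2 \<omega> d (lim_means \<omega> x y z) = max (snd z / sqrt (1 - \<omega>) + y)
    (sqrt \<omega> * fst z + sqrt (1 - \<omega>) * snd z + (\<omega> * x + (1 - \<omega>) * y - \<omega> * d))"
proof -
  have "r * (a / sqrt r) = sqrt r * a" if "0 < r" for r a
    using real_div_sqrt[of r] that by (metis less_imp_le times_divide_eq_left times_divide_eq_right)
  from this[of \<omega>] this[of "1 - \<omega>"]
  have "\<omega> * (a / sqrt \<omega>) = sqrt \<omega> * a" "(1 - \<omega>) * (a / sqrt (1 - \<omega>)) = sqrt (1 - \<omega>) * a" for a
    using \<omega> by simp_all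
  then show "est1 \<omega> d (lim_means \<omega> x y z) = min (fst z / sqrt \<omega> + x)
      (sqrt \<omega> * fst z + sqrt (1 - \<omega>) * snd z + (\<omega> * x + (1 - \<omega>) * y + (1 - \<omega>) * d))"
    "est2 \<omega> d (lim_means \<omega> x y z) = max (snd z / sqrt (1 - \<omega>) + y)
      (sqrt \<omega> * fst z + sqrt (1 - \<omega>) * snd z + (\<omega> * x + (1 - \<omega>) * y - \<omega> * d))"
    by (simp_all add: est1_def est2_def lim_means_def distrib_left)
qed

lemma AE_est1_ne: "AE z in gauss2. est1 \<omega> d (lim_means \<omega> x y z) \<noteq> 0"
  using AE_gauss2_line[of "1 / sqrt \<omega>" 0 "- x"]
    AE_gauss2_line[of "sqrt \<omega>" "sqrt (1 - \<omega>)" "- (\<omega> * x + (1 - \<omega>) * y + (1 - \<omega>) * d)"] \<omega>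
  by (auto simp: est1_lim_means case_prod_beta min_def elim!: eventually_elim2)

lemma AE_est2_ne: "AE z in gauss2. est2 \<omega> d (lim_means \<omega> x y z) \<noteq> 0"
  using AE_gauss2_line[of 0 "1 / sqrt (1 - \<omega>)" "- y"]
    AE_gauss2_line[of "sqrt \<omega>" "sqrt (1 - \<omega>)" "- (\<omega> * x + (1 - \<omega>) * y - \<omega> * d)"] \<omega>
  by (auto simp: est2_lim_means case_prod_beta max_def elim!: eventually_elim2)

lemma continuous_on_lim_means: "continuous_on UNIV (lim_means \<omega> x y)"
  unfolding lim_means_def [abs_def] using \<omega> by (intro continuous_intros) auto

text \<open>The sublevel set shrinks when the translation grows, and it loses a nonempty open set, which has positive
  Gaussian probability.\<close>

lemma lim_prob_strict_antimono:
  fixes S :: "real \<times> real \<Rightarrow> real"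
  assumes cont: "continuous_on UNIV S"
    and mono: "\<And>z. S (lim_means \<omega> x y z) \<le> S (lim_means \<omega> x' y' z)"
    and z: "S (lim_means \<omega> x y z) < 0" "0 < S (lim_means \<omega> x' y' z)"
  shows "lim_prob \<omega> {z. S z \<le> 0} x' y' < lim_prob \<omega> {z. S z \<le> 0} x y"
proof -
  have c: "continuous_on UNIV (\<lambda>z. S (lim_means \<omega> x y z))" for x y
    using continuous_on_compose2[OF cont continuous_on_lim_means] by simp
  let ?C = "{z. S (lim_means \<omega> x y z) \<le> 0}" and ?C' = "{z. S (lim_means \<omega> x' y' z) \<le> 0}"
  let ?U = "{z. S (lim_means \<omega> x y z) < 0} \<inter> {z. 0 < S (lim_means \<omega> x' y' z)}"
  have op: "open ?U" by (rule open_Int[OF open_Collect_less[OF c continuous_on_const] open_Collect_less[OF continuous_on_const c]])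
  have meas: "?C \<in> sets gauss2" "?C' \<in> sets gauss2" "?U \<in> sets gauss2"
    unfolding sets_gauss2 borel_prod
    by (rule borel_closed[OF closed_Collect_le[OF c continuous_on_const]]
        borel_closed[OF closed_Collect_le[OF c continuous_on_const]] borel_open[OF op])+
  have "0 < measure gauss2 ?U"
    by (rule measure_gauss2_open_pos[OF op, of z]) (use z in auto)
  also have "\<dots> = measure gauss2 (?U \<union> ?C') - measure gauss2 ?C'"
  proof -
    have "?U \<inter> ?C' = {}" by auto
    from gauss2.P.finite_measure_Union[OF meas(3,2) this] show ?thesis by linarith
  qed
  also have "measure gauss2 (?U \<union> ?C') \<le> measure gauss2 ?C"
    by (rule gauss2.P.finite_measure_mono[OF _ meas(1)]) (use mono in \<open>auto intro: order_trans\<close>)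
  finally show ?thesis by (simp add: lim_prob_def)
qed

lemma lim_prob_est1_strict:
  assumes "x \<le> x'" "y < y'"
  shows "lim_prob \<omega> {z. est1 \<omega> d z \<le> 0} x' y' < lim_prob \<omega> {z. est1 \<omega> d z \<le> 0} x y"
proof (rule lim_prob_strict_antimono[OF continuous_on_est1])
  have le: "\<omega> * x \<le> \<omega> * x'" "(1 - \<omega>) * y < (1 - \<omega>) * y'" using assms \<omega> by simp_all
  show "est1 \<omega> d (lim_means \<omega> x y z) \<le> est1 \<omega> d (lim_means \<omega> x' y' z)" for z
    unfolding est1_lim_means by (rule min.mono) (use le assms in linarith)+
  \<comment> \<open>choose the first coordinate equal to 1, out of the way, so that the sign change comes from the pooled mean\<close>
  define q where "q = - \<omega> / (1 - \<omega>) - d - (y' - y) / 2"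
  define z where "z = (sqrt \<omega> * (1 - x), sqrt (1 - \<omega>) * (q - y))"
  have sh: "lim_means \<omega> x y z = (1, q)" "lim_means \<omega> x' y' z = (1 + (x' - x), q + (y' - y))"
    using \<omega> by (simp_all add: lim_means_def z_def)
  have q: "(1 - \<omega>) * q = - \<omega> - (1 - \<omega>) * d - (1 - \<omega>) * (y' - y) / 2"
    using \<omega> by (simp add: q_def right_diff_distrib)
  have pos: "0 < (1 - \<omega>) * (y' - y)" "0 \<le> \<omega> * (x' - x)" using assms \<omega> by simp_all
  show "est1 \<omega> d (lim_means \<omega> x y z) < 0"
    unfolding sh est1_def using q pos by (simp add: min_less_iff_disj)
  have "\<omega> * (1 + (x' - x)) + (1 - \<omega>) * (q + (y' - y)) + (1 - \<omega>) * d = (1 - \<omega>) * (y' - y) / 2 + \<omega> * (x' - x)"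
    using q by (simp add: distrib_left)
  then show "0 < est1 \<omega> d (lim_means \<omega> x' y' z)"
    unfolding sh est1_def using pos assms by simp
qed

lemma lim_prob_est2_strict:
  assumes "x \<le> x'" "y < y'"
  shows "lim_prob \<omega> {z. est2 \<omega> d z \<le> 0} x' y' < lim_prob \<omega> {z. est2 \<omega> d z \<le> 0} x y"
proof (rule lim_prob_strict_antimono[OF continuous_on_est2])
  have le: "\<omega> * x \<le> \<omega> * x'" "(1 - \<omega>) * y < (1 - \<omega>) * y'" using assms \<omega> by simp_all
  show "est2 \<omega> d (lim_means \<omega> x y z) \<le> est2 \<omega> d (lim_means \<omega> x' y' z)" for z
    unfolding est2_lim_means by (rule max.mono) (use le assms in linarith)+
  \<comment> \<open>choose the second coordinate halfway across its sign change; with first coordinate \<open>d\<close> the pooled term is negative too\<close>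
  define z where "z = (sqrt \<omega> * (d - x), sqrt (1 - \<omega>) * (- (y' - y) / 2 - y))"
  have sh: "lim_means \<omega> x y z = (d, - (y' - y) / 2)" "lim_means \<omega> x' y' z = (d + (x' - x), (y' - y) / 2)"
    using \<omega> by (simp_all add: lim_means_def z_def field_simps)
  have pos: "0 < (1 - \<omega>) * (y' - y)" using assms \<omega> by simp
  have "\<omega> * d + (1 - \<omega>) * (- (y' - y) / 2) - \<omega> * d = - ((1 - \<omega>) * (y' - y) / 2)"
    by (simp, simp add: algebra_simps)
  also have "\<dots> < 0" using pos by linarith
  finally show "est2 \<omega> d (lim_means \<omega> x y z) < 0"
    unfolding sh est2_def fst_conv snd_conv using assms by (intro max_less_iff_conj[THEN iffD2] conjI) simp_all
  show "0 < est2 \<omega> d (lim_means \<omega> x' y' z)"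
    unfolding sh est2_def using assms by (simp add: less_max_iff_disj)
qed

lemma est_section_mono:
  assumes "v < v'"
  shows "est1 \<omega> d (lim_means \<omega> 0 0 (u, v)) \<le> est1 \<omega> d (lim_means \<omega> 0 0 (u, v'))"
    "est2 \<omega> d (lim_means \<omega> 0 0 (u, v)) < est2 \<omega> d (lim_means \<omega> 0 0 (u, v'))"
proof -
  have lt: "v / sqrt (1 - \<omega>) < v' / sqrt (1 - \<omega>)" "sqrt (1 - \<omega>) * v < sqrt (1 - \<omega>) * v'"
    using assms \<omega> by (simp_all add: divide_strict_right_mono)
  show "est1 \<omega> d (lim_means \<omega> 0 0 (u, v)) \<le> est1 \<omega> d (lim_means \<omega> 0 0 (u, v'))"
    unfolding est1_lim_means by (rule min.mono) (use lt in auto)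
  show "est2 \<omega> d (lim_means \<omega> 0 0 (u, v)) < est2 \<omega> d (lim_means \<omega> 0 0 (u, v'))"
    unfolding est2_lim_means using lt by (simp add: max_def)
qed

text \<open>The limiting conditional probability is strictly decreasing in \<open>Z2\<close> for fixed \<open>Z1\<close>: raising
  \<open>Z2\<close> does not lower \<open>est1\<close>, strictly raises \<open>est2\<close>, and the probability is
  strictly decreasing in the coordinate of the second mean. So it hits any given level with probability zero.\<close>

lemma AE_lim_prob_ne:
  assumes "S = est1 \<omega> d \<or> S = est2 \<omega> d"
  shows "AE z in gauss2. est_prob \<omega> d {z. S z \<le> 0} (lim_means \<omega> 0 0 z) \<noteq> \<alpha>"
proof (rule AE_ne_of_strict_antimono)
  have "S \<in> borel_measurable borel2" using assms by auto
  then have A: "{z. S z \<le> 0} \<in> sets borel2" by (intro Collect_in_sets_pair) measurable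
  show "(\<lambda>z. est_prob \<omega> d {z. S z \<le> 0} (lim_means \<omega> 0 0 z)) \<in> borel_measurable borel2"
    by (rule measurable_compose[OF lim_means_measurable est_prob_measurable[OF A]])
  fix u v v' :: real assume "v < v'"
  note mono = est_section_mono[OF this, of u]
  show "est_prob \<omega> d {z. S z \<le> 0} (lim_means \<omega> 0 0 (u, v'))
      < est_prob \<omega> d {z. S z \<le> 0} (lim_means \<omega> 0 0 (u, v))"
    unfolding est_prob_def using assms lim_prob_est1_strict[OF mono] lim_prob_est2_strict[OF mono] by (elim disjE) simp_all
qed

lemma lim_prob_strict_sublevel:
  fixes S :: "real \<times> real \<Rightarrow> real"
  assumes S: "S \<in> borel_measurable borel2"
    and "AE z in gauss2. S (lim_means \<omega> x y z) \<noteq> 0"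
  shows "lim_prob \<omega> {z. S z < 0} x y = lim_prob \<omega> {z. S z \<le> 0} x y"
proof -
  have [measurable]: "(\<lambda>z. S (lim_means \<omega> x y z)) \<in> borel_measurable borel2"
    by (rule measurable_compose[OF lim_means_measurable S])
  show ?thesis unfolding lim_prob_def
  proof (rule gauss2.P.finite_measure_eq_AE)
    show "{z. lim_means \<omega> x y z \<in> {z. S z < 0}} \<in> sets gauss2"
      "{z. lim_means \<omega> x y z \<in> {z. S z \<le> 0}} \<in> sets gauss2"
      by (simp_all add: Collect_in_sets_pair)
    show "AE z in gauss2. (z \<in> {z. lim_means \<omega> x y z \<in> {z. S z < 0}}) = (z \<in> {z. lim_means \<omega> x y z \<in> {z. S z \<le> 0}})"
      using assms(2) by eventually_elim auto
  qed
qed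

lemma div_sqrt_le_iff: "0 < r \<Longrightarrow> a / sqrt r + b \<le> 0 \<longleftrightarrow> a \<le> - (sqrt r * b)"
  using pos_divide_le_eq[of "sqrt r" a "- b"] by (simp add: mult.commute) linarith

text \<open>The minimum is at most zero on a union of two half-planes, which gives inclusion and exclusion.\<close>

lemma lim_prob_est1_eq_g1:
  assumes "d = \<delta> / \<sigma>"
  shows "lim_prob \<omega> {z. est1 \<omega> d z \<le> 0} x y = g1 \<omega> \<delta> \<sigma> x y"
proof -
  let ?A = "{z :: real \<times> real. 1 * fst z + 0 * snd z \<le> - C11 \<omega> x}"
  let ?B = "{z :: real \<times> real. sqrt \<omega> * fst z + sqrt (1 - \<omega>) * snd z \<le> - C12 \<omega> \<delta> \<sigma> x y}"
  have meas: "?A \<in> sets gauss2" "?B \<in> sets gauss2"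
    by (simp_all add: Collect_in_sets_pair)
  have "{z. est1 \<omega> d (lim_means \<omega> x y z) \<le> 0} = ?A \<union> ?B"
  proof -
    have C12: "C12 \<omega> \<delta> \<sigma> x y = \<omega> * x + (1 - \<omega>) * y + (1 - \<omega>) * d" by (simp add: C12_def assms)
    show ?thesis
      unfolding est1_lim_means min_le_iff_disj C12 C11_def div_sqrt_le_iff[OF \<omega>(1)] by auto
  qed
  then have "lim_prob \<omega> {z. est1 \<omega> d z \<le> 0} x y = measure gauss2 (?A \<union> ?B)"
    by (simp add: lim_prob_def)
  also have "\<dots> = measure gauss2 ?A + measure gauss2 ?B - measure gauss2 (?A \<inter> ?B)"
    by (rule measure_Un3) (use meas in \<open>simp_all only: gauss2.P.fmeasurable_eq_sets\<close>)
  also have "measure gauss2 ?A = Phi (- C11 \<omega> x)"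
    by (rule measure_gauss2_halfplane) simp
  also have "measure gauss2 ?B = Phi (- C12 \<omega> \<delta> \<sigma> x y)"
    by (rule measure_gauss2_halfplane) (use \<omega> in simp)
  also have "measure gauss2 (?A \<inter> ?B) = binormal_cdf 0 (Lambda1 \<omega>) (- C11 \<omega> x) (- C12 \<omega> \<delta> \<sigma> x y)"
    using \<omega> binormal_cdf_corr_matrix[of "sqrt \<omega>" "- C11 \<omega> x" "- C12 \<omega> \<delta> \<sigma> x y"]
    by (simp add: Lambda1_def Collect_conj_eq)
  finally show ?thesis by (simp add: g1_def)
qed

text \<open>The maximum is at most zero on an intersection of two half-planes. The correlated vector is built here from
  \<open>Z2\<close>, so the two variables change places.\<close>

lemma lim_prob_est2_eq_g2:
  assumes "d = \<delta> / \<sigma>"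
  shows "lim_prob \<omega> {z. est2 \<omega> d z \<le> 0} x y = g2 \<omega> \<delta> \<sigma> x y"
proof -
  let ?B = "{z :: real \<times> real. fst z \<le> - C21 \<omega> y \<and> sqrt (1 - \<omega>) * fst z + sqrt \<omega> * snd z \<le> - C22 \<omega> \<delta> \<sigma> x y}"
  have B: "?B \<in> sets borel2" by (simp add: Collect_in_sets_pair)
  have "{z. est2 \<omega> d (lim_means \<omega> x y z) \<le> 0} = (\<lambda>(u, v). (v, u)) -` ?B \<inter> space gauss2"
  proof -
    have C22: "C22 \<omega> \<delta> \<sigma> x y = \<omega> * x + (1 - \<omega>) * y - \<omega> * d" by (simp add: C22_def assms)
    have "0 < 1 - \<omega>" using \<omega> by simp
    from div_sqrt_le_iff[OF this] show ?thesis
      unfolding est2_lim_means max.bounded_iff C22 C21_def by auto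
  qed
  then have "lim_prob \<omega> {z. est2 \<omega> d z \<le> 0} x y = measure (distr gauss2 borel2 (\<lambda>(u, v). (v, u))) ?B"
    using B by (subst measure_distr) (simp_all add: lim_prob_def)
  also have "\<dots> = binormal_cdf 0 (Lambda2 \<omega>) (- C21 \<omega> y) (- C22 \<omega> \<delta> \<sigma> x y)"
    unfolding distr_gauss2_swap
    using \<omega> binormal_cdf_corr_matrix[of "sqrt (1 - \<omega>)" "- C21 \<omega> y" "- C22 \<omega> \<delta> \<sigma> x y"]
    by (simp add: Lambda2_def)
  finally show ?thesis by (simp add: g2_def)
qed

lemma F12_eq:
  assumes "d = \<delta> / \<sigma>"
  shows "F12 \<omega> \<delta> \<sigma> = distr gauss2 borel2 (\<lambda>z. (est1 \<omega> d (lim_means \<omega> 0 0 z), est2 \<omega> d (lim_means \<omega> 0 0 z)))"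
  unfolding F12_def borel_prod
  by (rule distr_cong) (auto simp: est1_lim_means est2_lim_means, simp_all add: assms)

lemma integral_F12:
  fixes g :: "real \<Rightarrow> real \<Rightarrow> real" and \<alpha> \<beta> :: real
  assumes d: "d = \<delta> / \<sigma>" and g [measurable]: "(\<lambda>(x, y). g x y) \<in> borel_measurable borel2"
  shows "(\<integral>(x, y). (indicator {\<alpha> .. \<beta>} (g x y) :: real) \<partial>F12 \<omega> \<delta> \<sigma>)
    = measure gauss2 {z. \<alpha> \<le> g (est1 \<omega> d (lim_means \<omega> 0 0 z)) (est2 \<omega> d (lim_means \<omega> 0 0 z)) \<and>
        g (est1 \<omega> d (lim_means \<omega> 0 0 z)) (est2 \<omega> d (lim_means \<omega> 0 0 z)) \<le> \<beta>}"
proof -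
  let ?g = "\<lambda>z. g (est1 \<omega> d (lim_means \<omega> 0 0 z)) (est2 \<omega> d (lim_means \<omega> 0 0 z))"
  have [measurable]: "?g \<in> borel_measurable borel2"
    using measurable_compose[OF measurable_Pair[OF measurable_compose[OF lim_means_measurable est1_measurable]
        measurable_compose[OF lim_means_measurable est2_measurable]] g] by simp
  have "(\<integral>(x, y). (indicator {\<alpha> .. \<beta>} (g x y) :: real) \<partial>F12 \<omega> \<delta> \<sigma>) = (\<integral>z. indicator {\<alpha> .. \<beta>} (?g z) \<partial>gauss2)"
  proof -
    have [measurable]: "(\<lambda>p. g (fst p) (snd p)) \<in> borel_measurable borel2"
      using g by (simp add: case_prod_beta')
    have [measurable]: "(\<lambda>p. indicator {\<alpha> .. \<beta>} (g (fst p) (snd p)) :: real) \<in> borel_measurable borel2"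
      by (rule measurable_compose[OF _ borel_measurable_indicator, where N = borel]) simp_all
    show ?thesis unfolding F12_eq[OF d] case_prod_beta' by (subst integral_distr) simp_all
  qed
  also have "\<dots> = (\<integral>z. indicator {z. \<alpha> \<le> ?g z \<and> ?g z \<le> \<beta>} z \<partial>gauss2)"
    by (simp add: indicator_def)
  also have "\<dots> = measure gauss2 {z. \<alpha> \<le> ?g z \<and> ?g z \<le> \<beta>}"
    using Collect_in_sets_pair[of "\<lambda>z. \<alpha> \<le> ?g z \<and> ?g z \<le> \<beta>"] by simp
  finally show ?thesis .
qed
end

section \<open>The difference of the means, and the theorem\<close>

context pooling begin

text \<open>The standardised difference of the two Gaussian means; its negative is the variable \<open>N\<close> of the introduction.\<close>

definition contrast :: "real \<times> real \<Rightarrow> real" where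
  "contrast z = - sqrt (1 - \<omega>) * fst z + sqrt \<omega> * snd z"

lemma contrast_measurable [measurable]: "contrast \<in> borel_measurable borel2"
  unfolding contrast_def [abs_def] by measurable

lemma measure_contrast_le: "measure gauss2 {z. contrast z \<le> t} = Phi t"
  unfolding contrast_def by (rule measure_gauss2_halfplane) (use \<omega> in simp)

lemma AE_contrast_ne: "AE z in gauss2. contrast z \<noteq> t"
  using AE_gauss2_line[of "- sqrt (1 - \<omega>)" "sqrt \<omega>" t] \<omega>
  by (simp add: contrast_def case_prod_beta)

lemma lim_means_diff:
  "sqrt (\<omega> * (1 - \<omega>)) * (snd (lim_means \<omega> x y z) - fst (lim_means \<omega> x y z)) = contrast z - sqrt (\<omega> * (1 - \<omega>)) * (x - y)"
proof -
  have "sqrt (\<omega> * (1 - \<omega>)) * (u / sqrt \<omega>) = sqrt (1 - \<omega>) * u" "sqrt (\<omega> * (1 - \<omega>)) * (v / sqrt (1 - \<omega>)) = sqrt \<omega> * v" for u v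
    using \<omega> by (simp_all add: real_sqrt_mult)
  then show ?thesis by (simp add: lim_means_def contrast_def algebra_simps)
qed

lemma scale_pos: "0 < sqrt (\<omega> * (1 - \<omega>))" using \<omega> by simp

lemma lim_means_diff_sign:
  "snd (lim_means \<omega> x y z) - fst (lim_means \<omega> x y z) \<le> 0 \<longleftrightarrow> contrast z \<le> sqrt (\<omega> * (1 - \<omega>)) * (x - y)"
  "snd (lim_means \<omega> x y z) - fst (lim_means \<omega> x y z) = 0 \<longleftrightarrow> contrast z = sqrt (\<omega> * (1 - \<omega>)) * (x - y)"
proof -
  let ?k = "sqrt (\<omega> * (1 - \<omega>))" and ?D = "snd (lim_means \<omega> x y z) - fst (lim_means \<omega> x y z)"
  have "D \<le> 0 \<longleftrightarrow> k * D \<le> 0" "D = 0 \<longleftrightarrow> k * D = 0" if "0 < k" for k D :: real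
    using that by (auto simp: mult_le_0_iff)
  from this[OF scale_pos] have "?D \<le> 0 \<longleftrightarrow> ?k * ?D \<le> 0" "?D = 0 \<longleftrightarrow> ?k * ?D = 0" .
  then show "?D \<le> 0 \<longleftrightarrow> contrast z \<le> ?k * (x - y)" "?D = 0 \<longleftrightarrow> contrast z = ?k * (x - y)"
    unfolding lim_means_diff by auto
qed

lemma lim_prob_diff:
  "lim_prob \<omega> {z. snd z - fst z \<le> 0} x y = Phi (sqrt (\<omega> * (1 - \<omega>)) * (x - y))"
  using measure_contrast_le[of "sqrt (\<omega> * (1 - \<omega>)) * (x - y)"]
  by (simp only: lim_prob_def mem_Collect_eq lim_means_diff_sign(1))

lemma AE_lim_means_diff_ne: "AE z in gauss2. snd (lim_means \<omega> x y z) - fst (lim_means \<omega> x y z) \<noteq> 0"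
  unfolding lim_means_diff_sign(2) by (rule AE_contrast_ne)

text \<open>Truncation at zero of the estimated difference, in local coordinates: the order constraint is active exactly
  when \<open>p - q\<close> exceeds \<open>d\<close>.\<close>

lemma est1_minus_est2: "est1 \<omega> d z - est2 \<omega> d z = min (fst z - snd z) d"
proof (cases "snd z - fst z + d \<ge> 0")
  case True
  then have "0 \<le> (1 - \<omega>) * (snd z - fst z + d)" "0 \<le> \<omega> * (snd z - fst z + d)" using \<omega> by simp_all
  then have "est1 \<omega> d z = fst z" "est2 \<omega> d z = snd z" by (simp_all add: est1_def est2_def algebra_simps)
  then show ?thesis using True by simp
next
  case False
  then have "(1 - \<omega>) * (snd z - fst z + d) \<le> 0" "\<omega> * (snd z - fst z + d) \<le> 0"
    using \<omega> by (simp_all add: mult_nonneg_nonpos)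
  then have "est1 \<omega> d z = \<omega> * fst z + (1 - \<omega>) * snd z + (1 - \<omega>) * d" "est2 \<omega> d z = \<omega> * fst z + (1 - \<omega>) * snd z - \<omega> * d"
    by (simp_all add: est1_def est2_def algebra_simps)
  then show ?thesis using False by (simp add: algebra_simps)
qed

lemma scaled_est1_minus_est2:
  "sqrt (\<omega> * (1 - \<omega>)) * (est1 \<omega> d (lim_means \<omega> 0 0 z) - est2 \<omega> d (lim_means \<omega> 0 0 z))
    = min (- contrast z) (sqrt (\<omega> * (1 - \<omega>)) * d)"
proof -
  have "sqrt (\<omega> * (1 - \<omega>)) * (fst (lim_means \<omega> 0 0 z) - snd (lim_means \<omega> 0 0 z)) = - contrast z"
    using lim_means_diff[of 0 0 z] by (simp add: algebra_simps)
  then show ?thesis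
    unfolding est1_minus_est2 using scale_pos by (simp add: min_mult_distrib_left[symmetric] min_mult_distrib_left)
qed

lemma measure_neg_contrast_ge: "measure gauss2 {z. t \<le> - contrast z} = Phi (- t)"
proof -
  have "{z. t \<le> - contrast z} = {z. contrast z \<le> - t}" by auto
  then show ?thesis by (simp add: measure_contrast_le)
qed

lemma Phi_minus: "Phi (- t) = 1 - Phi t"
proof -
  have "{z \<in> space gauss2. contrast z \<le> - t} \<in> sets gauss2" by measurable
  then have A: "{z. contrast z \<le> - t} \<in> sets gauss2" by simp
  have "{z \<in> space gauss2. - contrast z \<le> t} \<in> sets gauss2" by measurable
  then have B: "{z. - contrast z \<le> t} \<in> sets gauss2" by simp
  have "Phi t = measure gauss2 {z. - contrast z \<le> t}"
    using measure_gauss2_halfplane[of "sqrt (1 - \<omega>)" "- sqrt \<omega>" t] \<omega> by (simp add: contrast_def)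
  also have "\<dots> = measure gauss2 (space gauss2 - {z. contrast z \<le> - t})"
  proof (rule gauss2.P.finite_measure_eq_AE)
    show "AE z in gauss2. (z \<in> {z. - contrast z \<le> t}) = (z \<in> space gauss2 - {z. contrast z \<le> - t})"
      using AE_contrast_ne[of "- t"] by eventually_elim auto
  qed (rule B, rule sets.compl_sets[OF A])
  also have "\<dots> = 1 - Phi (- t)"
    using gauss2.P.prob_compl[OF A] by (simp add: measure_contrast_le)
  finally show ?thesis by simp
qed

lemma measure_neg_contrast_between:
  assumes "s \<le> t"
  shows "measure gauss2 {z. s \<le> - contrast z \<and> - contrast z \<le> t} = Phi t - Phi s"
proof -
  have "{z \<in> space gauss2. contrast z \<le> r} \<in> sets gauss2" for r by measurable
  then have A: "{z. contrast z \<le> r} \<in> sets gauss2" for r by simp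
  have "{z \<in> space gauss2. s \<le> - contrast z \<and> - contrast z \<le> t} \<in> sets gauss2" by measurable
  then have B: "{z. s \<le> - contrast z \<and> - contrast z \<le> t} \<in> sets gauss2" by simp
  have "measure gauss2 {z. s \<le> - contrast z \<and> - contrast z \<le> t}
      = measure gauss2 ({z. contrast z \<le> - s} - {z. contrast z \<le> - t})"
  proof (rule gauss2.P.finite_measure_eq_AE)
    show "AE z in gauss2. (z \<in> {z. s \<le> - contrast z \<and> - contrast z \<le> t})
        = (z \<in> {z. contrast z \<le> - s} - {z. contrast z \<le> - t})"
      using AE_contrast_ne[of "- t"] by eventually_elim auto
  qed (use A B in auto)
  also have "\<dots> = Phi (- s) - Phi (- t)"
    using assms by (subst gauss2.P.finite_measure_Diff[OF A A]) (auto simp: measure_contrast_le)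
  finally show ?thesis by (simp add: Phi_minus)
qed
end

context local_alternatives
begin

lemma sample_mean_borel [measurable]: "sample_mean m \<in> borel_measurable (PiM {1..m} (\<lambda>_. borel))"
  by (rule sample_mean_measurable) simp

lemma statistics_measurable:
  "(\<lambda>(x1, x2). theta1_hat \<omega> (n1 k) (n2 k) x1 x2) \<in> borel_measurable (sample_space k)"
  "(\<lambda>(x1, x2). theta2_hat \<omega> (n1 k) (n2 k) x1 x2) \<in> borel_measurable (sample_space k)"
  "(\<lambda>(x1, x2). Delta_hat (n1 k) (n2 k) x1 x2) \<in> borel_measurable (sample_space k)"
  unfolding theta1_hat_def theta2_hat_def Delta_hat_def pooled_mean_def by measurable

lemma par_sign: "par1 k s \<le> par1 k 0 \<longleftrightarrow> s \<le> 0" "par1 k s < par1 k 0 \<longleftrightarrow> s < 0"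
  "par2 k s \<le> par2 k 0 \<longleftrightarrow> s \<le> 0" "par2 k s < par2 k 0 \<longleftrightarrow> s < 0"
  using sqrt_n_pos[of k] \<sigma>0(1) by (simp_all add: par1_def par2_def mult_le_0_iff divide_le_0_iff mult_less_0_iff divide_less_0_iff)

lemma Delta_hat_iff:
  assumes "0 \<le> \<delta>"
  shows "Delta_hat (n1 k) (n2 k) x1 x2 \<le> \<delta> / sqrt (real (n k)) \<longleftrightarrow> snd (loc_means k x1 x2) - fst (loc_means k x1 x2) \<le> 0"
    and "Delta_hat (n1 k) (n2 k) x1 x2 < \<delta> / sqrt (real (n k)) \<longleftrightarrow> snd (loc_means k x1 x2) - fst (loc_means k x1 x2) < 0 \<and> 0 < \<delta>"
proof -
  define s where "s = sqrt (real (n k))"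
  have s: "0 < s" using sqrt_n_pos by (simp add: s_def)
  define D where "D = snd (loc_means k x1 x2) - fst (loc_means k x1 x2)"
  have "sample_mean (n2 k) x2 - sample_mean (n1 k) x1 - \<delta> / s = \<sigma>0 * D / s"
    using s \<sigma>0(1) by (simp add: D_def loc_means_def par1_def par2_def s_def[symmetric] field_simps)
  moreover have "\<sigma>0 * D / s \<le> 0 \<longleftrightarrow> D \<le> 0" "\<sigma>0 * D / s < 0 \<longleftrightarrow> D < 0"
    using s \<sigma>0(1) by (simp_all add: mult_le_0_iff divide_le_0_iff mult_less_0_iff divide_less_0_iff)
  ultimately have "sample_mean (n2 k) x2 - sample_mean (n1 k) x1 \<le> \<delta> / s \<longleftrightarrow> D \<le> 0"
    "sample_mean (n2 k) x2 - sample_mean (n1 k) x1 < \<delta> / s \<longleftrightarrow> D < 0"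
    by linarith+
  moreover have "0 \<le> \<delta> / s" "0 < \<delta> / s \<longleftrightarrow> 0 < \<delta>" using s assms by (simp_all add: zero_less_divide_iff)
  ultimately show "Delta_hat (n1 k) (n2 k) x1 x2 \<le> \<delta> / sqrt (real (n k)) \<longleftrightarrow> snd (loc_means k x1 x2) - fst (loc_means k x1 x2) \<le> 0"
    "Delta_hat (n1 k) (n2 k) x1 x2 < \<delta> / sqrt (real (n k)) \<longleftrightarrow> snd (loc_means k x1 x2) - fst (loc_means k x1 x2) < 0 \<and> 0 < \<delta>"
    by (simp_all add: Delta_hat_def D_def s_def)
qed
end

text \<open>The data and the bootstrap quantiles of one statistic \<open>T\<close> along a sequence of admissible sizes; the three
  parts of the theorem are three instances.\<close>

locale bootstrap = local_alternatives \<nu> a b \<Psi> \<omega> \<delta> \<eta>0 \<sigma>0 n n1 n2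
  for \<nu> a b \<Psi> \<omega> \<delta> \<eta>0 \<sigma>0 n n1 n2 +
  fixes P :: "nat \<Rightarrow> 'a measure" and X1 X2 :: "nat \<Rightarrow> nat \<Rightarrow> 'a \<Rightarrow> real" and \<alpha> \<beta> :: real
    and c q :: "nat \<Rightarrow> real \<Rightarrow> 'a \<Rightarrow> real" and T :: "nat \<Rightarrow> (nat \<Rightarrow> real) \<Rightarrow> (nat \<Rightarrow> real) \<Rightarrow> real"
  assumes \<delta>: "0 \<le> \<delta>"
    and two: "\<And>k. two_samples (P k) (X1 k) (X2 k) (n1 k) (n2 k) (theta_law (par1 k 0)) (theta_law (par2 k 0))"
    and \<alpha>: "0 < \<alpha>" "\<alpha> < 1 / 2" and \<beta>: "1 / 2 < \<beta>" "\<beta> < 1"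
    and c: "\<And>k \<gamma>. c k \<gamma> \<in> borel_measurable (P k)"
    and q: "\<And>k \<gamma> w. q k \<gamma> w =
      (let t1 = theta1_hat \<omega> (n1 k) (n2 k) (\<lambda>j. X1 k j w) (\<lambda>j. X2 k j w);
           t2 = theta2_hat \<omega> (n1 k) (n2 k) (\<lambda>j. X1 k j w) (\<lambda>j. X2 k j w)
       in if t1 \<in> M \<and> t2 \<in> M
          then quantile (two_sample_cdf (theta_law t1) (theta_law t2) (n1 k) (n2 k) (T k)) \<gamma> else c k \<gamma> w)"
begin

lemma pooling: "pooling \<omega> d"
  using \<omega> \<delta> \<sigma>0(1) by unfold_locales auto

lemma \<alpha>_lt: "\<alpha> < 1" and \<beta>_gt: "0 < \<beta>" using \<alpha> \<beta> by auto

text \<open>The estimators of the two means have no atom at the true value in the limit: \<open>est1\<close> and \<open>est2\<close>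
  vanish only on null sets, so the weak and the strict sublevel set have the same limiting probability.\<close>

lemma coverage_sublevel:
  fixes S :: "real \<times> real \<Rightarrow> real"
  assumes S: "S = est1 \<omega> d \<or> S = est2 \<omega> d"
    and T: "\<And>k. (\<lambda>(x1, x2). T k x1 x2) \<in> borel_measurable (sample_space k)"
    and T_le: "\<And>k x1 x2. T k x1 x2 \<le> \<theta> k \<longleftrightarrow> S (loc_means k x1 x2) \<le> 0"
    and T_less: "\<And>k x1 x2. T k x1 x2 < \<theta> k \<longleftrightarrow> S (loc_means k x1 x2) < 0"
    and g: "\<And>x y. lim_prob \<omega> {z. S z \<le> 0} x y = g x y"
  shows "(\<lambda>k. measure (P k) {w \<in> space (P k). \<theta> k \<in> {q k \<alpha> w .. q k \<beta> w}}) \<longlonglongrightarrow>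
    (\<integral>(x, y). indicator {\<alpha> .. \<beta>} (g x y) \<partial>F12 \<omega> \<delta> \<sigma>0)"
proof -
  interpret pooling \<omega> d by (rule pooling)
  have cont: "continuous_on UNIV S" using S continuous_on_est1 continuous_on_est2 by auto
  have S_meas [measurable]: "S \<in> borel_measurable borel2" using S by auto
  have A: "{z. S z \<le> 0} \<in> sets borel2" and B: "{z. S z < 0} \<in> sets borel2"
    by (simp_all add: Collect_in_sets_pair)
  have S0: "AE z in gauss2. S (lim_means \<omega> x y z) \<noteq> 0" for x y
    using S AE_est1_ne AE_est2_ne by auto
  have nA: "AE z in gauss2. lim_means \<omega> x y z \<notin> frontier {z. S z \<le> 0}"
    and nB: "AE z in gauss2. lim_means \<omega> x y z \<notin> frontier {z. S z < 0}" for x y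
    using S0[of x y] frontier_sublevel[OF cont] by (auto elim!: eventually_mono)
  have g': "lim_prob \<omega> {z. S z < 0} x y = g x y" for x y
    using lim_prob_strict_sublevel[OF S_meas S0] g by simp
  have ne: "AE z in gauss2. g (est1 \<omega> d (lim_means \<omega> 0 0 z)) (est2 \<omega> d (lim_means \<omega> 0 0 z)) \<noteq> r" for r
    using AE_lim_prob_ne[OF S, of r] by (simp add: est_prob_def g)
  have g_meas: "(\<lambda>(x, y). g x y) \<in> borel_measurable borel2"
    using lim_prob_measurable[OF A, of \<omega>] by (simp add: g)
  have "(\<lambda>k. measure (P k) {w \<in> space (P k). \<theta> k \<in> {q k \<alpha> w .. q k \<beta> w}}) \<longlonglongrightarrow>
      measure gauss2 {z. \<alpha> \<le> est_prob \<omega> d {z. S z \<le> 0} (lim_means \<omega> 0 0 z) \<and>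
      est_prob \<omega> d {z. S z < 0} (lim_means \<omega> 0 0 z) \<le> \<beta>}"
    by (rule coverage_tendsto[OF two T _ _ A B nA nB \<alpha>(1) \<alpha>_lt \<beta>_gt \<beta>(2) _ _ c q])
      (use ne in \<open>simp_all add: T_le T_less est_prob_def g g'\<close>)
  then show ?thesis
    unfolding est_prob_def g g' by (simp only: integral_F12[OF refl g_meas])
qed

text \<open>With \<open>\<kappa> = sqrt (\<omega> * (1 - \<omega>))\<close>: since \<open>Phi (min N (\<kappa> d))\<close> is constant on an event of positive probability, the exceptional level set is
  null only because the level \<open>\<beta>\<close> is not attained at \<open>\<kappa> d\<close>; this is where the
  threshold value of \<open>\<delta>\<close> is excluded. For the level \<open>\<alpha>\<close> it suffices that
  \<open>Phi (\<kappa> d) \<ge> 1 / 2 > \<alpha>\<close>.\<close>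

lemma coverage_Delta:
  assumes T: "T = (\<lambda>k. Delta_hat (n1 k) (n2 k))"
    and ne: "\<delta> \<noteq> inv Phi \<beta> * \<sigma>0 / sqrt (\<omega> * (1 - \<omega>))"
  shows "(\<lambda>k. measure (P k) {w \<in> space (P k). \<delta> / sqrt (real (n k)) \<in> {q k \<alpha> w .. q k \<beta> w}}) \<longlonglongrightarrow>
    (if inv Phi \<beta> * \<sigma>0 / sqrt (\<omega> * (1 - \<omega>)) < \<delta> then \<beta> - \<alpha> else 1 - \<alpha>)"
proof -
  interpret pooling \<omega> d by (rule pooling)
  let ?k = "sqrt (\<omega> * (1 - \<omega>))"
  define za zb where "za = inv Phi \<alpha>" and "zb = inv Phi \<beta>"
  have z: "Phi za = \<alpha>" "Phi zb = \<beta>" using Phi_inv \<alpha> \<alpha>_lt \<beta> \<beta>_gt by (simp_all add: za_def zb_def)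
  have sgn: "za < 0" "0 < zb"
    using Phi_le_iff[of 0 za] Phi_le_iff[of zb 0] \<alpha> \<beta> by (simp_all add: z Phi_0)
  have kd: "0 \<le> ?k * d" by (intro mult_nonneg_nonneg less_imp_le[OF scale_pos] d)
  have thr: "zb * \<sigma>0 / ?k < \<delta> \<longleftrightarrow> zb < ?k * d" "zb * \<sigma>0 / ?k = \<delta> \<longleftrightarrow> zb = ?k * d"
  proof -
    have "zb * \<sigma>0 / k < \<delta> \<longleftrightarrow> zb < k * d" "zb * \<sigma>0 / k = \<delta> \<longleftrightarrow> zb = k * d" if "0 < k" for k
      using that \<sigma>0(1) by (simp_all add: field_simps)
    from this[OF scale_pos] show "zb * \<sigma>0 / ?k < \<delta> \<longleftrightarrow> zb < ?k * d" "zb * \<sigma>0 / ?k = \<delta> \<longleftrightarrow> zb = ?k * d" .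
  qed
  let ?A = "{z :: real \<times> real. snd z - fst z \<le> 0}" and ?B = "{z :: real \<times> real. snd z - fst z < 0 \<and> 0 < \<delta>}"
  let ?D = "\<lambda>z :: real \<times> real. snd z - fst z"
  have D_meas [measurable]: "?D \<in> borel_measurable borel2" by measurable
  have AB: "?A \<in> sets borel2" "?B \<in> sets borel2"
    by (rule Collect_in_sets_pair, measurable)+
  have cont: "continuous_on UNIV ?D" by (intro continuous_intros)
  have nA: "AE z in gauss2. lim_means \<omega> x y z \<notin> frontier ?A" for x y
    using AE_lim_means_diff_ne[of x y] frontier_sublevel(1)[OF cont] by (auto elim!: eventually_mono)
  have nB: "AE z in gauss2. lim_means \<omega> x y z \<notin> frontier ?B" for x y
  proof (cases "0 < \<delta>")
    case True
    then show ?thesis using AE_lim_means_diff_ne[of x y] frontier_sublevel(2)[OF cont] by (auto elim!: eventually_mono)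
  qed simp
  define F where "F z = Phi (min (- contrast z) (?k * d))" for z
  have pA: "est_prob \<omega> d ?A (lim_means \<omega> 0 0 z) = F z" for z
    by (simp only: est_prob_def lim_prob_diff scaled_est1_minus_est2 F_def)
  have pB: "est_prob \<omega> d ?B (lim_means \<omega> 0 0 z) = (if 0 < \<delta> then F z else 0)" for z
  proof (cases "0 < \<delta>")
    case True
    then have "?B = {z. ?D z < 0}" by simp
    then show ?thesis
      using True pA[of z] by (simp only: est_prob_def lim_prob_strict_sublevel[OF D_meas AE_lim_means_diff_ne] if_True)
  next
    case False
    then have "?B = {}" by simp
    then show ?thesis using False by (simp only: est_prob_def lim_prob_def empty_iff Collect_empty_eq measure_empty if_False) simp
  qed
  have F_eq: "F z = r \<longleftrightarrow> min (- contrast z) (?k * d) = zr" if "Phi zr = r" for r zr z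
    unfolding F_def that[symmetric] by (rule Phi_eq_iff)
  have ne1: "AE z in gauss2. F z \<noteq> \<alpha>"
    using AE_contrast_ne[of "- za"] by eventually_elim (use sgn kd in \<open>auto simp: F_eq[OF z(1)] min_def split: if_splits\<close>)
  have ne2: "AE z in gauss2. (if 0 < \<delta> then F z else 0) \<noteq> \<beta>"
    using AE_contrast_ne[of "- zb"]
    by eventually_elim (use ne thr(2) \<beta>_gt in \<open>auto simp: F_eq[OF z(2)] zb_def[symmetric] min_def split: if_splits\<close>)
  have "(\<lambda>k. measure (P k) {w \<in> space (P k). \<delta> / sqrt (real (n k)) \<in> {q k \<alpha> w .. q k \<beta> w}}) \<longlonglongrightarrow>
      measure gauss2 {z. \<alpha> \<le> est_prob \<omega> d ?A (lim_means \<omega> 0 0 z) \<and>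
      est_prob \<omega> d ?B (lim_means \<omega> 0 0 z) \<le> \<beta>}"
  proof (rule coverage_tendsto[OF two _ _ _ AB nA nB \<alpha>(1) \<alpha>_lt \<beta>_gt \<beta>(2) _ _ c q])
    show "(\<lambda>(x1, x2). T k x1 x2) \<in> borel_measurable (sample_space k)" for k
      using statistics_measurable(3)[of k] by (simp add: T)
    show "T k x1 x2 \<le> \<delta> / sqrt (real (n k)) \<longleftrightarrow> loc_means k x1 x2 \<in> ?A"
      "T k x1 x2 < \<delta> / sqrt (real (n k)) \<longleftrightarrow> loc_means k x1 x2 \<in> ?B" for k x1 x2
      by (simp_all only: T Delta_hat_iff[OF \<delta>] mem_Collect_eq)
  qed (use ne1 ne2 in \<open>simp_all only: pA pB\<close>)
  also have "{z. \<alpha> \<le> est_prob \<omega> d ?A (lim_means \<omega> 0 0 z) \<and>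
      est_prob \<omega> d ?B (lim_means \<omega> 0 0 z) \<le> \<beta>}
      = (if zb < ?k * d then {z. za \<le> - contrast z \<and> - contrast z \<le> zb} else {z. za \<le> - contrast z})"
  proof -
    have a: "\<alpha> \<le> F z \<longleftrightarrow> za \<le> - contrast z" for z
      using sgn kd unfolding F_def z(1)[symmetric] Phi_le_iff by auto
    have b: "F z \<le> \<beta> \<longleftrightarrow> - contrast z \<le> zb \<or> ?k * d \<le> zb" for z
      unfolding F_def z(2)[symmetric] Phi_le_iff by (simp add: min_le_iff_disj)
    have "0 < \<delta>" if "zb < ?k * d" using that sgn \<sigma>0(1) \<delta> scale_pos
      by (metis divide_eq_0_iff less_eq_real_def mult_zero_right order_less_asym)
    then show ?thesis unfolding pA pB using a b \<beta>_gt by auto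
  qed
  also have "measure gauss2 (if zb < ?k * d then {z. za \<le> - contrast z \<and> - contrast z \<le> zb} else {z. za \<le> - contrast z})
      = (if zb < ?k * d then \<beta> - \<alpha> else 1 - \<alpha>)"
    using measure_neg_contrast_between[of za zb] sgn by (simp add: z measure_neg_contrast_ge Phi_minus)
  finally show ?thesis by (simp only: thr(1)[symmetric] zb_def[symmetric])
qed
end

theorem theorem3p1:
  fixes \<nu> :: "real measure" and a b :: "real \<Rightarrow> real" and \<Psi> M :: "real set"
    and \<omega> \<eta>0 \<delta> \<psi>0 \<sigma>0 \<alpha>1 \<alpha>2 :: real
    and \<Delta>0 \<theta>10 \<theta>20 :: "nat \<Rightarrow> real" and n1 n2 :: "nat \<Rightarrow> nat"
    and P :: "nat \<Rightarrow> 'a measure" and X1 X2 :: "nat \<Rightarrow> nat \<Rightarrow> 'a \<Rightarrow> real"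
    and h1 h2 :: "nat \<Rightarrow> 'a \<Rightarrow> real"
    and c1 c2 cD q1 q2 qD :: "nat \<Rightarrow> real \<Rightarrow> 'a \<Rightarrow> real"
  assumes nef: "natural_exponential_family \<nu> a b \<Psi>"
    and M: "M = mean_range b \<Psi>"
    and \<omega>: "0 < \<omega>" "\<omega> < 1"
    and \<eta>0: "\<eta>0 \<in> M"
    and \<delta>: "0 \<le> \<delta>"
    and \<psi>0: "\<psi>0 = natural_param b \<Psi> \<eta>0"
    and \<sigma>0: "0 < \<sigma>0" "\<sigma>0\<^sup>2 = deriv (deriv b) \<psi>0"
    and \<alpha>1: "0 < \<alpha>1" "\<alpha>1 < 1/2"
    and \<alpha>2: "0 < \<alpha>2" "\<alpha>2 < 1/2"
    and \<Delta>0: "\<And>n. \<Delta>0 n = \<delta> / sqrt (real n)"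
    and \<theta>10: "\<And>n. \<theta>10 n = \<eta>0 - (1 - \<omega>) * \<Delta>0 n"
    and \<theta>20: "\<And>n. \<theta>20 n = \<eta>0 + \<omega> * \<Delta>0 n"
    and n1: "\<And>n. n1 n = nat \<lfloor>\<omega> * real n\<rfloor>"
    and n2: "\<And>n. n2 n = nat \<lfloor>(1 - \<omega>) * real n\<rfloor>"
    \<comment> \<open>the data, for all large admissible \<open>n\<close>\<close>
    and samples: "\<forall>\<^sub>F n in admissible_sizes \<omega>.
      two_samples (P n) (X1 n) (X2 n) (n1 n) (n2 n)
        (nef_law \<nu> a b \<Psi> (\<theta>10 n)) (nef_law \<nu> a b \<Psi> (\<theta>20 n))"
    and h1: "\<And>n w. h1 n w = theta1_hat \<omega> (n1 n) (n2 n) (\<lambda>j. X1 n j w) (\<lambda>j. X2 n j w)"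
    and h2: "\<And>n w. h2 n w = theta2_hat \<omega> (n1 n) (n2 n) (\<lambda>j. X1 n j w) (\<lambda>j. X2 n j w)"
    \<comment> \<open>bootstrap quantiles, arbitrary random variables where an estimate lies outside \<open>M\<close>\<close>
    and c: "\<And>n \<alpha>. c1 n \<alpha> \<in> borel_measurable (P n)" "\<And>n \<alpha>. c2 n \<alpha> \<in> borel_measurable (P n)"
      "\<And>n \<alpha>. cD n \<alpha> \<in> borel_measurable (P n)"
    and q1: "\<And>n \<alpha> w. q1 n \<alpha> w =
      (if h1 n w \<in> M \<and> h2 n w \<in> M
       then quantile (two_sample_cdf (nef_law \<nu> a b \<Psi> (h1 n w)) (nef_law \<nu> a b \<Psi> (h2 n w))
              (n1 n) (n2 n) (theta1_hat \<omega> (n1 n) (n2 n))) \<alpha>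
       else c1 n \<alpha> w)"
    and q2: "\<And>n \<alpha> w. q2 n \<alpha> w =
      (if h1 n w \<in> M \<and> h2 n w \<in> M
       then quantile (two_sample_cdf (nef_law \<nu> a b \<Psi> (h1 n w)) (nef_law \<nu> a b \<Psi> (h2 n w))
              (n1 n) (n2 n) (theta2_hat \<omega> (n1 n) (n2 n))) \<alpha>
       else c2 n \<alpha> w)"
    and qD: "\<And>n \<alpha> w. qD n \<alpha> w =
      (if h1 n w \<in> M \<and> h2 n w \<in> M
       then quantile (two_sample_cdf (nef_law \<nu> a b \<Psi> (h1 n w)) (nef_law \<nu> a b \<Psi> (h2 n w))
              (n1 n) (n2 n) (Delta_hat (n1 n) (n2 n))) \<alpha>
       else cD n \<alpha> w)"
  shows
    "((\<lambda>n. measure (P n) {w \<in> space (P n). \<theta>10 n \<in> {q1 n \<alpha>1 w .. q1 n (1 - \<alpha>2) w}}) \<longlongrightarrow>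
        (\<integral>(x, y). indicator {\<alpha>1 .. 1 - \<alpha>2} (g1 \<omega> \<delta> \<sigma>0 x y) \<partial>F12 \<omega> \<delta> \<sigma>0))
       (admissible_sizes \<omega>) \<and>
     ((\<lambda>n. measure (P n) {w \<in> space (P n). \<theta>20 n \<in> {q2 n \<alpha>1 w .. q2 n (1 - \<alpha>2) w}}) \<longlongrightarrow>
        (\<integral>(x, y). indicator {\<alpha>1 .. 1 - \<alpha>2} (g2 \<omega> \<delta> \<sigma>0 x y) \<partial>F12 \<omega> \<delta> \<sigma>0))
       (admissible_sizes \<omega>) \<and>
     (\<delta> > inv Phi (1 - \<alpha>2) * \<sigma>0 / sqrt (\<omega> * (1 - \<omega>)) \<longrightarrow>
        ((\<lambda>n. measure (P n) {w \<in> space (P n). \<Delta>0 n \<in> {qD n \<alpha>1 w .. qD n (1 - \<alpha>2) w}}) \<longlongrightarrow>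
          1 - \<alpha>1 - \<alpha>2) (admissible_sizes \<omega>)) \<and>
     (\<delta> < inv Phi (1 - \<alpha>2) * \<sigma>0 / sqrt (\<omega> * (1 - \<omega>)) \<longrightarrow>
        ((\<lambda>n. measure (P n) {w \<in> space (P n). \<Delta>0 n \<in> {qD n \<alpha>1 w .. qD n (1 - \<alpha>2) w}}) \<longlongrightarrow>
          1 - \<alpha>1) (admissible_sizes \<omega>))"

proof -
  define Q where "Q n \<longleftrightarrow> two_samples (P n) (X1 n) (X2 n) (n1 n) (n2 n)
        (nef_law \<nu> a b \<Psi> (\<theta>10 n)) (nef_law \<nu> a b \<Psi> (\<theta>20 n))" for n
  define adm where "adm n \<longleftrightarrow> \<omega> * real n \<in> \<int> \<and> (1 - \<omega>) * real n \<in> \<int> \<and> 0 < n \<and> Q n" for n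
  have \<beta>: "1 / 2 < 1 - \<alpha>2" "1 - \<alpha>2 < 1" using \<alpha>2 by auto
  have local_alt: "local_alternatives \<nu> a b \<Psi> \<omega> \<eta>0 \<sigma>0 r (\<lambda>k. n1 (r k)) (\<lambda>k. n2 (r k))"
    if r: "strict_mono r" "\<And>k. adm (r k)" for r
  proof
    show "natural_exponential_family \<nu> a b \<Psi>" by (rule nef)
    show "filterlim r at_top sequentially" using r(1) by (rule filterlim_subseq)
    have nat_floor: "real (nat \<lfloor>x\<rfloor>) = x" if "x \<in> \<int>" "0 \<le> x" for x
      using that by (auto elim!: Ints_cases)
    show "real (n1 (r k)) = \<omega> * real (r k)" "real (n2 (r k)) = (1 - \<omega>) * real (r k)" for k
      unfolding n1 n2 using r(2)[of k, unfolded adm_def] \<omega> by (auto intro!: nat_floor)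
  qed (use \<omega> \<eta>0 M \<sigma>0 \<psi>0 r(2)[unfolded adm_def] in auto)
  have boot: "bootstrap \<nu> a b \<Psi> \<omega> \<delta> \<eta>0 \<sigma>0 r (\<lambda>k. n1 (r k)) (\<lambda>k. n2 (r k)) (\<lambda>k. P (r k)) (\<lambda>k. X1 (r k)) (\<lambda>k. X2 (r k))
      \<alpha>1 (1 - \<alpha>2) (\<lambda>k. c (r k)) (\<lambda>k. q (r k)) (\<lambda>k. T (r k))"
    if r: "strict_mono r" "\<And>k. adm (r k)"
      and c: "\<And>n \<gamma>. c n \<gamma> \<in> borel_measurable (P n)"
      and q: "\<And>n \<gamma> w. q n \<gamma> w = (if h1 n w \<in> M \<and> h2 n w \<in> M
       then quantile (two_sample_cdf (nef_law \<nu> a b \<Psi> (h1 n w)) (nef_law \<nu> a b \<Psi> (h2 n w)) (n1 n) (n2 n) (T n)) \<gamma>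
       else c n \<gamma> w)" for r c q T
  proof -
    interpret local_alternatives \<nu> a b \<Psi> \<omega> \<delta> \<eta>0 \<sigma>0 r "\<lambda>k. n1 (r k)" "\<lambda>k. n2 (r k)" by (rule local_alt[OF r])
    show ?thesis
    proof
      show "two_samples (P (r k)) (X1 (r k)) (X2 (r k)) (n1 (r k)) (n2 (r k)) (theta_law (par1 k 0)) (theta_law (par2 k 0))" for k
        using r(2)[of k] by (simp add: adm_def Q_def par1_def par2_def \<theta>10 \<theta>20 \<Delta>0)
    qed (use \<delta> \<alpha>1 \<beta> c q M in \<open>simp_all add: h1 h2 Let_def\<close>)
  qed
  have ev: "\<forall>\<^sub>F n in admissible_sizes \<omega>. Q n"
    using samples by (simp add: Q_def)
  have part_a: "((\<lambda>n. measure (P n) {w \<in> space (P n). \<theta>10 n \<in> {q1 n \<alpha>1 w .. q1 n (1 - \<alpha>2) w}}) \<longlongrightarrow>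
        (\<integral>(x, y). indicator {\<alpha>1 .. 1 - \<alpha>2} (g1 \<omega> \<delta> \<sigma>0 x y) \<partial>F12 \<omega> \<delta> \<sigma>0)) (admissible_sizes \<omega>)"
    (is "(?f \<longlongrightarrow> ?L) _")
  proof (rule tendsto_admissible_sizesI[OF ev, folded adm_def])
    fix r :: "nat \<Rightarrow> nat"
    assume r: "strict_mono r" "\<And>k. adm (r k)"
    interpret bootstrap \<nu> a b \<Psi> \<omega> \<delta> \<eta>0 \<sigma>0 r "\<lambda>k. n1 (r k)" "\<lambda>k. n2 (r k)" "\<lambda>k. P (r k)" "\<lambda>k. X1 (r k)" "\<lambda>k. X2 (r k)"
      \<alpha>1 "1 - \<alpha>2" "\<lambda>k. c1 (r k)" "\<lambda>k. q1 (r k)" "\<lambda>k. theta1_hat \<omega> (n1 (r k)) (n2 (r k))"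
      by (rule boot[OF r c(1) q1])
    have \<theta>: "\<theta>10 (r k) = par1 k 0" for k by (simp add: par1_def \<theta>10 \<Delta>0)
    show "(\<lambda>k. ?f (r k)) \<longlonglongrightarrow> ?L"
      by (rule coverage_sublevel[where S = "est1 \<omega> (\<delta> / \<sigma>0)", OF _ statistics_measurable(1)])
        (simp_all only: \<theta> theta1_hat_eq_par1 par_sign simp_thms pooling.lim_prob_est1_eq_g1[OF pooling refl])
  qed
  have part_b: "((\<lambda>n. measure (P n) {w \<in> space (P n). \<theta>20 n \<in> {q2 n \<alpha>1 w .. q2 n (1 - \<alpha>2) w}}) \<longlongrightarrow>
        (\<integral>(x, y). indicator {\<alpha>1 .. 1 - \<alpha>2} (g2 \<omega> \<delta> \<sigma>0 x y) \<partial>F12 \<omega> \<delta> \<sigma>0)) (admissible_sizes \<omega>)"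
    (is "(?f \<longlongrightarrow> ?L) _")
  proof (rule tendsto_admissible_sizesI[OF ev, folded adm_def])
    fix r :: "nat \<Rightarrow> nat"
    assume r: "strict_mono r" "\<And>k. adm (r k)"
    interpret bootstrap \<nu> a b \<Psi> \<omega> \<delta> \<eta>0 \<sigma>0 r "\<lambda>k. n1 (r k)" "\<lambda>k. n2 (r k)" "\<lambda>k. P (r k)" "\<lambda>k. X1 (r k)" "\<lambda>k. X2 (r k)"
      \<alpha>1 "1 - \<alpha>2" "\<lambda>k. c2 (r k)" "\<lambda>k. q2 (r k)" "\<lambda>k. theta2_hat \<omega> (n1 (r k)) (n2 (r k))"
      by (rule boot[OF r c(2) q2])
    have \<theta>: "\<theta>20 (r k) = par2 k 0" for k by (simp add: par2_def \<theta>20 \<Delta>0)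
    show "(\<lambda>k. ?f (r k)) \<longlonglongrightarrow> ?L"
      by (rule coverage_sublevel[where S = "est2 \<omega> (\<delta> / \<sigma>0)", OF _ statistics_measurable(2)])
        (simp_all only: \<theta> theta2_hat_eq_par2 par_sign simp_thms pooling.lim_prob_est2_eq_g2[OF pooling refl])
  qed
  have part_c: "((\<lambda>n. measure (P n) {w \<in> space (P n). \<Delta>0 n \<in> {qD n \<alpha>1 w .. qD n (1 - \<alpha>2) w}}) \<longlongrightarrow>
        (if inv Phi (1 - \<alpha>2) * \<sigma>0 / sqrt (\<omega> * (1 - \<omega>)) < \<delta> then 1 - \<alpha>1 - \<alpha>2 else 1 - \<alpha>1)) (admissible_sizes \<omega>)"
    (is "(?f \<longlongrightarrow> ?L) _")
    if ne: "\<delta> \<noteq> inv Phi (1 - \<alpha>2) * \<sigma>0 / sqrt (\<omega> * (1 - \<omega>))"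
  proof (rule tendsto_admissible_sizesI[OF ev, folded adm_def])
    fix r :: "nat \<Rightarrow> nat"
    assume r: "strict_mono r" "\<And>k. adm (r k)"
    interpret bootstrap \<nu> a b \<Psi> \<omega> \<delta> \<eta>0 \<sigma>0 r "\<lambda>k. n1 (r k)" "\<lambda>k. n2 (r k)" "\<lambda>k. P (r k)" "\<lambda>k. X1 (r k)" "\<lambda>k. X2 (r k)"
      \<alpha>1 "1 - \<alpha>2" "\<lambda>k. cD (r k)" "\<lambda>k. qD (r k)" "\<lambda>k. Delta_hat (n1 (r k)) (n2 (r k))"
      by (rule boot[OF r c(3) qD])
    show "(\<lambda>k. ?f (r k)) \<longlonglongrightarrow> ?L"
      using coverage_Delta[OF refl ne] by (simp only: \<Delta>0 diff_diff_eq add.commute[of \<alpha>1])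
  qed
  show ?thesis
    using part_a part_b part_c by auto
qed

end
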